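(* Let $(P_t)_{t\ge0}$ be a Markov transition semi-group on $\mathbb R^d$ admitting a unique invariant distribution $\nu$. Assume: (i) there exist $\theta_0>0$ and $c(\theta_0)>0$ such that for every bounded Borel function $g:\mathbb R^d\to\mathbb R$, $P_{\theta_0}g$ is Lipschitz with $[P_{\theta_0}g]_{\mathrm{Lip}}\le c(\theta_0)\|g\|_{\sup}$; (ii) there exist $\mu_0\in\mathcal P_q(\mathbb R^d)$ for some $q>1$ and Borel functions $\psi:\mathbb R^d\to[0,+\infty)$ and $e\in\mathbb L^1([0,+\infty))$ (with values in $[0,+\infty)$) such that $$\forall\,t\ge0,\ \forall\,x\in\mathbb R^d,\quad\mathcal W_1(P_t(x,dy),\nu)\le\psi(x)e(t)\qquad\text{and}\qquad\sup_{t\ge0}\mu_0P_t(\psi^q+|\cdot|^q)<+\infty.$$ Then, setting $\tilde\psi=\psi\vee1$ and $\tilde e(t)=2\,\mathbf 1_{\{t\le\theta_0\}}+c(\theta_0)e(t-\theta_0)\mathbf 1_{\{t\ge\theta_0\}}$, one has $\tilde e\in\mathbb L^1([0,+\infty))$, $\|P_t(x,dy)-\nu\|_{TV}\le\tilde\psi(x)\tilde e(t)$ for all $t\ge0$, $x\in\mathbb R^d$, and $\sup_{t\ge0}\mu_0P_t(\tilde\psi^q+|\cdot|^q)<+\infty$. Consequently $\int|\xi|^q\nu(d\xi)<+\infty$ and, for the occupation measures $\nu_t$ of a right continuous Markov process $(X_t)_{t\ge0}$ with transition $(P_t)_{t\ge0}$ and $X_0\sim\mu_0$, Property $\mathbf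 A_{\beta,q,\frac12}$ (see context) holds for every $t_0>0$ with $\beta=\frac12(1-\frac1q)$, $\pi_t=\frac12(\bar\nu_t+\nu)$; and for every $p\in(0,q)$ and $t_0>0$ there is a positive constant $K$ such that for every $t\ge t_0$, $\mathbb E\,\mathcal W_p^p(\nu_t,\nu)\le K\,\mathsf M_{\pi,q}\,r(t)$ where, with $d_-:=\frac{d+\sqrt{d^2+8d}}4$ and $d_+:=\frac{d+1+\sqrt{(d+1)^2+4d}}2$, - if $p<\frac d2(1+\frac1q)$: $r(t)=t^{-\frac{pq}{(q+1)d}}$ when $p<\frac{dq}{d+q}$, and $r(t)=t^{-\frac{q-p}{q+1}}$ when $\frac{dq}{d+q}<p<q$; - if $p=\frac d2(1+\frac1q)$: $r(t)=t^{-\frac{q-p}{q+1}}$ when $d_-<q<d_+$, and $r(t)=t^{-\frac12}\log(1+t)$ when $q>d_+$; - if $p>\frac d2(1+\frac1q)$: $r(t)=t^{-\frac12}$ when $p<\frac{q-1}2$, and $r(t)=t^{-\frac{q-p}{q+1}}$ when $\frac{q-1}2<p<q$. In particular, if $\sup_{t\ge0}\mu_0P_t(\psi^q+|\cdot|^q)<+\infty$ for every $q>0$, then for every $p>0$, $\varepsilon>0$, $t_0>0$ there is a finite constant $\bar K$ such that for every $t\ge t_0$, $\|\mathcal W_p(\nu_t,\nu)\|_p\le\bar K t^{-\frac{1-\varepsilon}d}$ if $p\le\frac d2$ and $\|\mathcal W_p(\nu_t,\nu)\|_p\le\bar Kt^{-\frac1{2p}}$ if $p>\frac d2$.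
   Context: $\nu_t(\omega,d\xi)=\frac1t\int_0^t\delta_{X_s(\omega)}(d\xi)\,ds$ and $\bar\nu_t(f)=\frac1t\int_0^t\mathbb E f(X_s)\,ds$. $\mathcal P_q(\mathbb R^d)$: Borel probability measures with finite $q$-th moment. $\|\mu-\mu'\|_{TV}=\sup\{|\mu(f)-\mu'(f)|: f$ Borel, $|f|\le1\}$. $[f]_{\mathrm{Lip}}$ is the Lipschitz constant. The paper calls the semi-group strongly Feller, a property it regards as ensured by (i). $|\cdot|$ is the Euclidean norm, $M_\mu(q)=\int|\xi|^q\mu(d\xi)$; for $p>0$, $\mathcal W_p(\mu,\nu)=\inf_\varpi(\int|x-y|^p\varpi(dx,dy))^{1/p}$ over couplings $\varpi$ of $\mu$ and $\nu$; $\|Z\|_p=(\mathbb E|Z|^p)^{1/p}$; $a\vee b=\max(a,b)$. Property $\mathbf A_{\beta,q,\gamma}$ (for a given $t_0>0$ and a family $(\pi_t)_{t\ge t_0}$ of probability measures): there is a constant $C_0\in(0,\infty)$ with $\mathbb E|\nu_t(A)-\nu(A)|\le C_0\min\big(\pi_t(A),\pi_t(A)^\beta t^{-\gamma}\big)$ for every $t\ge t_0$ and every Borel $A$, and $\mathsf M_{\pi,q}:=1\vee\sup_{t\ge t_0}M_{\pi_t}(q)<+\infty$. *)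

theory Defs
  imports "HOL-Probability.Probability"
begin

definition markov_semigroup :: "(real \<Rightarrow> 'a::euclidean_space \<Rightarrow> 'a measure) \<Rightarrow> bool" where
  "markov_semigroup P \<longleftrightarrow>
     (\<forall>t\<ge>0. P t \<in> borel \<rightarrow>\<^sub>M prob_algebra borel) \<and>
     (\<forall>x. P 0 x = return borel x) \<and>
     (\<forall>s\<ge>0. \<forall>t\<ge>0. \<forall>x. P (s + t) x = P s x \<bind> P t)"

definition invariant_distribution ::
  "(real \<Rightarrow> 'a::euclidean_space \<Rightarrow> 'a measure) \<Rightarrow> 'a measure \<Rightarrow> bool" where
  "invariant_distribution P \<nu> \<longleftrightarrow>
     \<nu> \<in> space (prob_algebra borel) \<and> (\<forall>t\<ge>0. \<nu> \<bind> P t = \<nu>)"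

definition past :: "'w measure \<Rightarrow> (real \<Rightarrow> 'w \<Rightarrow> 'a::euclidean_space) \<Rightarrow> real \<Rightarrow> 'w measure" where
  "past M X s = sigma (space M) (\<Union>u\<in>{0..s}. {X u -` B \<inter> space M | B. B \<in> sets borel})"

text \<open>The Markov property is taken with respect to the natural filtration; it follows from the one
  with respect to any larger filtration to which the process is adapted.\<close>

definition right_continuous_markov_process ::
  "'w measure \<Rightarrow> (real \<Rightarrow> 'w \<Rightarrow> 'a::euclidean_space) \<Rightarrow> (real \<Rightarrow> 'a \<Rightarrow> 'a measure) \<Rightarrow> 'a measure \<Rightarrow> bool"
where
  "right_continuous_markov_process M X P \<mu>0 \<longleftrightarrow>
     prob_space M \<and>
     (\<forall>t\<ge>0. X t \<in> borel_measurable M) \<and>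
     (\<forall>\<omega>\<in>space M. \<forall>t\<ge>0. continuous (at_right t) (\<lambda>s. X s \<omega>)) \<and>
     distr M borel (X 0) = \<mu>0 \<and>
     (\<forall>s\<ge>0. \<forall>t\<ge>0. \<forall>B\<in>sets borel.
        AE \<omega> in M. real_cond_exp M (past M X s) (\<lambda>\<omega>. indicator B (X (s + t) \<omega>)) \<omega>
                   = measure (P t (X s \<omega>)) B)"

definition moment :: "real \<Rightarrow> 'a::euclidean_space measure \<Rightarrow> ennreal" where
  "moment q \<mu> = (\<integral>\<^sup>+\<xi>. ennreal (norm \<xi> powr q) \<partial>\<mu>)"

definition prob_moment :: "real \<Rightarrow> 'a::euclidean_space measure set" where
  "prob_moment q = {\<mu> \<in> space (prob_algebra borel). moment q \<mu> < \<infinity>}"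

definition tv_norm :: "'a::euclidean_space measure \<Rightarrow> 'a measure \<Rightarrow> real" where
  "tv_norm \<mu> \<mu>' =
     (SUP f\<in>{f \<in> borel_measurable borel. \<forall>x. \<bar>f x\<bar> \<le> 1}. \<bar>(\<integral>x. f x \<partial>\<mu>) - (\<integral>x. f x \<partial>\<mu>')\<bar>)"

text \<open>Real powers of extended nonnegative reals; only used for positive exponents.\<close>

definition ennpowr :: "ennreal \<Rightarrow> real \<Rightarrow> ennreal" where
  "ennpowr a r = (if a = \<infinity> then \<infinity> else ennreal (enn2real a powr r))"

definition couplings ::
  "'a::euclidean_space measure \<Rightarrow> 'a measure \<Rightarrow> ('a \<times> 'a) measure set" where
  "couplings \<mu> \<nu> = {\<pi>. sets \<pi> = sets (borel \<Otimes>\<^sub>M borel) \<and> distr \<pi> borel fst = \<mu> \<and> distr \<pi> borel snd = \<nu>}"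

definition wasserstein :: "real \<Rightarrow> 'a::euclidean_space measure \<Rightarrow> 'a measure \<Rightarrow> ennreal" where
  "wasserstein p \<mu> \<nu> =
     (INF \<pi>\<in>couplings \<mu> \<nu>. ennpowr (\<integral>\<^sup>+(x, y). ennreal (norm (x - y) powr p) \<partial>\<pi>) (1 / p))"

text \<open>The uniform law on \<open>[0, t]\<close>. It lives on the restricted space because a process is only
  specified, and only measurable in time, at nonnegative times.\<close>

definition uniform_time :: "real \<Rightarrow> real measure" where
  "uniform_time t = uniform_measure (restrict_space lborel {0..t}) {0..t}"

definition occupation :: "(real \<Rightarrow> 'w \<Rightarrow> 'a::euclidean_space) \<Rightarrow> real \<Rightarrow> 'w \<Rightarrow> 'a measure" where
  "occupation X t \<omega> = uniform_time t \<bind> (\<lambda>s. return borel (X s \<omega>))"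

definition mean_occupation ::
  "'w measure \<Rightarrow> (real \<Rightarrow> 'w \<Rightarrow> 'a::euclidean_space) \<Rightarrow> real \<Rightarrow> 'a measure" where
  "mean_occupation M X t = uniform_time t \<bind> (\<lambda>s. distr M borel (X s))"

definition half_sum :: "'a::euclidean_space measure \<Rightarrow> 'a measure \<Rightarrow> 'a measure" where
  "half_sum \<mu> \<nu> = measure_of UNIV (sets borel) (\<lambda>A. (emeasure \<mu> A + emeasure \<nu> A) / 2)"

definition max_moment :: "real \<Rightarrow> (real \<Rightarrow> 'a::euclidean_space measure) \<Rightarrow> real \<Rightarrow> ennreal" where
  "max_moment t0 \<pi> q = max 1 (SUP t\<in>{t0..}. moment q (\<pi> t))"

definition property_A ::
  "'w measure \<Rightarrow> (real \<Rightarrow> 'w \<Rightarrow> 'a::euclidean_space measure) \<Rightarrow> 'a measure \<Rightarrow>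
   real \<Rightarrow> (real \<Rightarrow> 'a measure) \<Rightarrow> real \<Rightarrow> real \<Rightarrow> real \<Rightarrow> bool" where
  "property_A M N \<nu> t0 \<pi> \<beta> q \<gamma> \<longleftrightarrow>
     (\<forall>t\<ge>t0. \<pi> t \<in> space (prob_algebra borel)) \<and>
     (\<exists>C0>0. \<forall>t\<ge>t0. \<forall>A\<in>sets borel.
        (\<integral>\<^sup>+\<omega>. ennreal \<bar>measure (N t \<omega>) A - measure \<nu> A\<bar> \<partial>M)
          \<le> ennreal (C0 * min (measure (\<pi> t) A) (measure (\<pi> t) A powr \<beta> * t powr (- \<gamma>)))) \<and>
     max_moment t0 \<pi> q < \<infinity>"

definition psi_tilde :: "('a \<Rightarrow> real) \<Rightarrow> 'a \<Rightarrow> real" where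
  "psi_tilde \<psi> x = max (\<psi> x) 1"

definition e_tilde :: "real \<Rightarrow> real \<Rightarrow> (real \<Rightarrow> real) \<Rightarrow> real \<Rightarrow> real" where
  "e_tilde \<theta> c e t = 2 * indicator {..\<theta>} t + c * e (t - \<theta>) * indicator {\<theta>..} t"

definition d_minus :: "real \<Rightarrow> real" where
  "d_minus d = (d + sqrt (d\<^sup>2 + 8 * d)) / 4"

definition d_plus :: "real \<Rightarrow> real" where
  "d_plus d = (d + 1 + sqrt ((d + 1)\<^sup>2 + 4 * d)) / 2"

end

theory Submission
  imports Defs
begin

text \<open>The proof separates geometry from probability.

\<^bold>\<open>Geometry.\<close> For probability measures \<open>\<mu>\<close> and \<open>\<nu>\<close> a coupling is built scale by scale. Space is cut into
the unit ball and the shells \<open>2\<^sup>n\<^sup>-\<^sup>1 \<le> norm x < 2\<^sup>n\<close>, and each of these is cut into ever finer dyadic cubes. At every scale the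
conditional laws of the two measures on the children of a cell are coupled maximally: mass that
lands in the same child is passed on to the next scale, the remaining mass is coupled
independently and pays at most the size of the cell. The mass lost at a cell is the discrepancy
between \<open>\<mu>\<close> and \<open>\<nu>\<close> on its children, so the \<open>p\<close>-th power of the Wasserstein distance is
bounded by a sum over scales \<open>l\<close>, shells \<open>n\<close> and cells \<open>C\<close> of
\<open>2\<^sup>(\<^sup>n\<^sup>-\<^sup>l\<^sup>)\<^sup>p \<bar>\<mu> C - \<nu> C\<bar>\<close> (\<open>multiscale_coupling\<close>, \<open>wasserstein_dyadic_bound\<close>). This bound is linear in the
discrepancies, so for a random measure its expectation only involves the mean discrepancy of
each single cell.

\<^bold>\<open>Probability.\<close> The mean discrepancy of the occupation measure on a set \<open>A\<close> is trivially at most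
\<open>2 \<pi>\<^sub>t(A)\<close>. Testing the Wasserstein decay against the Lipschitz functions that \<open>P \<theta>0\<close> produces gives decay in
total variation with an integrable rate (\<open>tv_decay\<close>), hence an integrable bound on the covariance
of the indicators of \<open>A\<close> along the path. Integrating it over the square of times gives the variance
a factor \<open>1 / t\<close>; the Hoelder inequality with the moments of \<open>psi_tilde\<close> keeps a power \<open>1 - 1 / q\<close> of the
mass of \<open>A\<close>. Taking square roots gives the bound \<open>\<pi>\<^sub>t(A)\<^sup>\<beta> t\<^sup>-\<^sup>1\<^sup>/\<^sup>2\<close>
(\<open>second_moment_deviation_le\<close>, \<open>deviation_rate\<close>).

\<^bold>\<open>Rates.\<close> A shell contains at most \<open>2\<^sup>d\<^sup>l\<close> cells of scale \<open>l\<close> and has mass of order \<open>2\<^sup>-\<^sup>q\<^sup>n\<close>. By concavity the sum over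
the cells of a shell turns the two bounds into the double series of
\<open>min (2 powr (-(q-p)n - pl)) (\<tau> * 2 powr ((p-b)n + (D-p)l))\<close> with \<open>\<tau> = t powr (-1/2)\<close>, \<open>b = (q-1)/2\<close> and
\<open>D = d/2 (1 + 1/q)\<close> (\<open>expected_wasserstein_le\<close>). The first, trivial bound is the smaller one for large \<open>n\<close> and \<open>l\<close>, the second
one, from the variance, for small ones. The different rates record where the series concentrates: at the crossing of the two terms
in \<open>n\<close> for \<open>l = 0\<close>, at their crossing in \<open>l\<close> for \<open>n = 0\<close>, at \<open>n = l = 0\<close>, or, for \<open>p = D < b\<close>, spread evenly over
logarithmically many scales \<open>l\<close>. If all moments are finite, a large \<open>q\<close> gives the last claim.\<close>

section \<open>Transport costs and maximal couplings\<close>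

lemma ennpowr_mono: "0 < r \<Longrightarrow> a \<le> b \<Longrightarrow> ennpowr a r \<le> ennpowr b r"
  by (auto simp: ennpowr_def top_unique less_top intro!: ennreal_leI powr_mono2 enn2real_mono)

lemma ennpowr_root_power: "0 < p \<Longrightarrow> ennpowr (ennpowr a (1 / p)) p = a"
  by (auto simp: ennpowr_def powr_powr less_top)

text \<open>Bounding the cost of some coupling, rather than an infimum of costs, lets couplings be combined without
choosing near-optimal ones; the Wasserstein distance enters only at the end.\<close>

definition transport_le ::
  "('a::euclidean_space \<times> 'a \<Rightarrow> ennreal) \<Rightarrow> 'a measure \<Rightarrow> 'a measure \<Rightarrow> ennreal \<Rightarrow> bool" where
  "transport_le c \<mu> \<nu> T \<longleftrightarrow> (\<exists>\<pi>\<in>couplings \<mu> \<nu>. (\<integral>\<^sup>+z. c z \<partial>\<pi>) \<le> T)"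

lemma transport_le_mono: "transport_le c \<mu> \<nu> T \<Longrightarrow> T \<le> T' \<Longrightarrow> transport_le c \<mu> \<nu> T'"
  unfolding transport_le_def by (meson order_trans)

lemma wasserstein_power_le:
  assumes p: "0 < p" and T: "transport_le (\<lambda>(x, y). ennreal (norm (x - y) powr p)) \<mu> \<nu> T"
  shows "ennpowr (wasserstein p \<mu> \<nu>) p \<le> T"
proof -
  obtain \<pi> where \<pi>: "\<pi> \<in> couplings \<mu> \<nu>"
      "(\<integral>\<^sup>+(x, y). ennreal (norm (x - y) powr p) \<partial>\<pi>) \<le> T"
    using T unfolding transport_le_def by auto
  have "wasserstein p \<mu> \<nu> \<le> ennpowr (\<integral>\<^sup>+(x, y). ennreal (norm (x - y) powr p) \<partial>\<pi>) (1 / p)"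
    unfolding wasserstein_def by (rule INF_lower[OF \<pi>(1)])
  then have "ennpowr (wasserstein p \<mu> \<nu>) p
      \<le> ennpowr (ennpowr (\<integral>\<^sup>+(x, y). ennreal (norm (x - y) powr p) \<partial>\<pi>) (1 / p)) p"
    by (rule ennpowr_mono[OF p])
  also have "\<dots> \<le> T" using \<pi>(2) by (simp add: ennpowr_root_power[OF p])
  finally show ?thesis .
qed

text \<open>Put the common mass \<open>min (pmf a i) (pmf b i)\<close> on the diagonal and couple the two excesses independently.
The excesses \<open>u\<close> and \<open>v\<close> have disjoint supports, so the second part adds nothing to the diagonal.\<close>

lemma maximal_coupling_pmf:
  fixes a b :: "'i pmf"
  obtains J :: "('i \<times> 'i) pmf" where "map_pmf fst J = a" "map_pmf snd J = b"
    "\<And>i. pmf J (i, i) = min (pmf a i) (pmf b i)"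
proof -
  define m where "m i = min (pmf a i) (pmf b i)" for i
  define u where "u i = pmf a i - m i" for i
  define v where "v i = pmf b i - m i" for i
  have nn: "0 \<le> m i" "0 \<le> u i" "0 \<le> v i" for i by (auto simp: m_def u_def v_def)
  have uv: "u i * v i = 0" for i by (auto simp: m_def u_def v_def min_def)
  let ?S = "\<lambda>f. \<integral>\<^sup>+i. ennreal (f i) \<partial>count_space UNIV"
  have amu: "?S m + ?S u = 1" 
  proof -
    have "?S m + ?S u = (\<integral>\<^sup>+i. ennreal (pmf a i) \<partial>count_space UNIV)"
      by (subst nn_integral_add[symmetric]) (auto intro!: nn_integral_cong simp: ennreal_plus[symmetric] nn simp del: ennreal_plus, auto simp: u_def)
    then show ?thesis by (simp add: nn_integral_pmf_eq_1)
  qed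
  have bmv: "?S m + ?S v = 1" 
  proof -
    have "?S m + ?S v = (\<integral>\<^sup>+i. ennreal (pmf b i) \<partial>count_space UNIV)"
      by (subst nn_integral_add[symmetric]) (auto intro!: nn_integral_cong simp: ennreal_plus[symmetric] nn simp del: ennreal_plus, auto simp: v_def)
    then show ?thesis by (simp add: nn_integral_pmf_eq_1)
  qed
  have fin: "?S m \<noteq> \<infinity>" "?S u \<noteq> \<infinity>" using amu by (auto simp: add_top)
  have Suv: "?S u = ?S v" using amu bmv fin
    by (metis ennreal_add_left_cancel infinity_ennreal_def)
  show ?thesis
  proof (cases "?S u = 0")
    case True
    then have "\<forall>i. ennreal (u i) = 0" "\<forall>i. ennreal (v i) = 0" using Suv
      by (auto simp: nn_integral_0_iff_AE AE_count_space)
    then have "u i = 0" "v i = 0" for i using nn[of i] by (auto simp: ennreal_eq_0_iff intro: antisym)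
    then have "pmf a i = pmf b i" "m i = pmf a i" for i by (auto simp: u_def v_def)
    then have "a = b" by (auto intro: pmf_eqI)
    have "pmf (map_pmf (\<lambda>i. (i, i)) a) (i, i) = pmf a i" for i
      by (rule pmf_map_inj') (auto simp: inj_def)
    then show ?thesis using \<open>a = b\<close>
      by (intro that[of "map_pmf (\<lambda>i. (i, i)) a"]) (auto simp: pmf.map_comp o_def)
  next
    case False
    define r where "r = enn2real (?S u)"
    have r: "ennreal r = ?S u" using fin by (simp add: r_def less_top)
    have r0: "0 < r" using False r by (metis ennreal_eq_0_iff not_less)
    define w where "w z = (case z of (i, j) \<Rightarrow> (if i = j then m i else 0) + u i * v j / r)" for z
    have w0: "0 \<le> w z" for z using nn r0 by (auto simp: w_def split: prod.split)
    have e1: "(\<integral>\<^sup>+j. ennreal (w (i, j)) \<partial>count_space UNIV) = ennreal (pmf a i)" for i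
    proof -
      have "(\<integral>\<^sup>+j. ennreal (w (i, j)) \<partial>count_space UNIV)
        = (\<integral>\<^sup>+j. ennreal (m i) * indicator {i} j + ennreal (u i / r) * ennreal (v j) \<partial>count_space UNIV)"
        using nn r0 by (intro nn_integral_cong)
          (auto simp: w_def ennreal_plus[symmetric] ennreal_mult[symmetric] simp del: ennreal_plus split: split_indicator)
      also have "\<dots> = ennreal (m i) + ennreal (u i / r) * ?S v"
        by (subst nn_integral_add) (auto simp: nn_integral_cmult)
      also have "\<dots> = ennreal (m i + u i / r * r)"
        using nn r0 by (simp add: Suv[symmetric] r[symmetric] ennreal_mult[symmetric])
      also have "m i + u i / r * r = pmf a i" using r0 by (simp add: u_def)
      finally show ?thesis .
    qed
    have e2: "(\<integral>\<^sup>+i. ennreal (w (i, j)) \<partial>count_space UNIV) = ennreal (pmf b j)" for j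
    proof -
      have "(\<integral>\<^sup>+i. ennreal (w (i, j)) \<partial>count_space UNIV)
        = (\<integral>\<^sup>+i. ennreal (m j) * indicator {j} i + ennreal (v j / r) * ennreal (u i) \<partial>count_space UNIV)"
        using nn r0 by (intro nn_integral_cong)
          (auto simp: w_def ennreal_plus[symmetric] ennreal_mult[symmetric] mult.commute simp del: ennreal_plus split: split_indicator)
      also have "\<dots> = ennreal (m j) + ennreal (v j / r) * ?S u"
        by (subst nn_integral_add) (auto simp: nn_integral_cmult)
      also have "\<dots> = ennreal (m j + v j / r * r)"
        using nn r0 by (simp add: r[symmetric] ennreal_mult[symmetric])
      also have "m j + v j / r * r = pmf b j" using r0 by (simp add: v_def)
      finally show ?thesis .
    qed
    have tot: "(\<integral>\<^sup>+z. ennreal (w z) \<partial>count_space UNIV) = 1"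
      by (simp add: nn_integral_fst_count_space[symmetric] e1 nn_integral_pmf_eq_1)
    define J where "J = embed_pmf w"
    have pJ: "pmf J z = w z" for z unfolding J_def by (rule pmf_embed_pmf[OF w0 tot])
    have "ennreal (pmf (map_pmf fst J) i) = ennreal (pmf a i)" for i
    proof -
      have "ennreal (pmf (map_pmf fst J) i)
        = (\<integral>\<^sup>+z. ennreal (w z) * indicator (fst -` {i}) z \<partial>count_space UNIV)"
        by (simp add: ennreal_pmf_map nn_integral_measure_pmf pJ)
      also have "\<dots> = (\<integral>\<^sup>+i'. \<integral>\<^sup>+j. ennreal (w (i', j)) * indicator {i} i' \<partial>count_space UNIV \<partial>count_space UNIV)"
        by (subst nn_integral_fst_count_space[symmetric]) (auto intro!: nn_integral_cong split: split_indicator)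
      also have "\<dots> = ennreal (pmf a i)"
        by (simp add: nn_integral_multc e1 nn_integral_indicator_singleton)
      finally show ?thesis .
    qed
    then have 1: "map_pmf fst J = a" by (intro pmf_eqI) (simp add: pmf_nonneg)
    have "ennreal (pmf (map_pmf snd J) j) = ennreal (pmf b j)" for j
    proof -
      have "ennreal (pmf (map_pmf snd J) j)
        = (\<integral>\<^sup>+z. ennreal (w z) * indicator (snd -` {j}) z \<partial>count_space UNIV)"
        by (simp add: ennreal_pmf_map nn_integral_measure_pmf pJ)
      also have "\<dots> = (\<integral>\<^sup>+j'. \<integral>\<^sup>+i. ennreal (w (i, j')) * indicator {j} j' \<partial>count_space UNIV \<partial>count_space UNIV)"
        by (subst nn_integral_snd_count_space[symmetric]) (auto intro!: nn_integral_cong split: split_indicator)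
      also have "\<dots> = ennreal (pmf b j)"
        by (simp add: nn_integral_multc e2 nn_integral_indicator_singleton)
      finally show ?thesis .
    qed
    then have 2: "map_pmf snd J = b" by (intro pmf_eqI) (simp add: pmf_nonneg)
    show ?thesis
      by (rule that[OF 1 2]) (simp add: pJ w_def uv m_def[symmetric])
  qed
qed

section \<open>Conditioning on the cells of a countable partition\<close>

lemma count_space_measurable_pred[measurable]:
  "\<kappa> \<in> borel \<rightarrow>\<^sub>M count_space UNIV \<Longrightarrow> \<kappa> -` S \<in> sets borel"
  using measurable_sets[of \<kappa> borel "count_space UNIV" S] by simp

lemma index_pmf:
  fixes \<kappa> :: "'a::euclidean_space \<Rightarrow> 'i::countable"
  assumes \<mu>: "\<mu> \<in> space (prob_algebra borel)" and \<kappa>: "\<kappa> \<in> borel \<rightarrow>\<^sub>M count_space UNIV"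
  obtains a where "\<And>i. pmf a i = measure \<mu> (\<kappa> -` {i})"
proof -
  interpret prob_space \<mu> using \<mu> by (simp add: space_prob_algebra)
  have S[measurable_cong]: "sets \<mu> = sets borel" using \<mu> by (simp add: space_prob_algebra)
  note \<kappa>[measurable]
  have sp: "space \<mu> = UNIV" using sets_eq_imp_space_eq[OF S] by simp
  have "(\<integral>\<^sup>+i. ennreal (measure \<mu> (\<kappa> -` {i})) \<partial>count_space UNIV)
      = (\<integral>\<^sup>+i. emeasure (distr \<mu> (count_space UNIV) \<kappa>) {i} \<partial>count_space UNIV)"
    by (intro nn_integral_cong) (simp add: emeasure_distr emeasure_eq_measure sp)
  also have "\<dots> = emeasure (distr \<mu> (count_space UNIV) \<kappa>) UNIV"
    by (subst emeasure_countable_singleton) auto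
  also have "\<dots> = 1" by (simp add: emeasure_distr sp emeasure_space_1[unfolded sp])
  finally have "pmf (embed_pmf (\<lambda>i. measure \<mu> (\<kappa> -` {i}))) i = measure \<mu> (\<kappa> -` {i})" for i
    by (intro pmf_embed_pmf) auto
  then show ?thesis by (rule that)
qed

lemma emeasure_split_index:
  fixes \<kappa> :: "'a::euclidean_space \<Rightarrow> 'i::countable"
  assumes \<mu>: "sets \<mu> = sets borel" and \<kappa>: "\<kappa> \<in> borel \<rightarrow>\<^sub>M count_space UNIV" and A: "A \<in> sets borel"
  shows "emeasure \<mu> A = (\<integral>\<^sup>+i. emeasure \<mu> (\<kappa> -` {i} \<inter> A) \<partial>count_space UNIV)"
proof -
  note \<mu>[measurable_cong] \<kappa>[measurable] A[measurable]
  have "emeasure \<mu> (\<Union>i\<in>UNIV. \<kappa> -` {i} \<inter> A) = (\<integral>\<^sup>+i. emeasure \<mu> (\<kappa> -` {i} \<inter> A) \<partial>count_space UNIV)"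
    by (rule emeasure_UN_countable) (auto simp: disjoint_family_on_def \<mu> A)
  moreover have "(\<Union>i\<in>UNIV. \<kappa> -` {i} \<inter> A) = A" by auto
  ultimately show ?thesis by simp
qed

text \<open>On null sets the measure itself is returned, so that conditioning is a total map into probability measures
and \<open>emeasure_cond_measure\<close> holds for every set.\<close>

definition cond_measure :: "'a measure \<Rightarrow> 'a set \<Rightarrow> 'a measure" where
  "cond_measure \<mu> A = (if measure \<mu> A = 0 then \<mu> else uniform_measure \<mu> A)"

lemma cond_measure_prob:
  assumes \<mu>: "\<mu> \<in> space (prob_algebra borel)"
  shows "cond_measure \<mu> A \<in> space (prob_algebra borel)"
proof -
  interpret prob_space \<mu> using \<mu> by (simp add: space_prob_algebra)
  show ?thesis using \<mu>
    by (auto simp: cond_measure_def space_prob_algebra emeasure_eq_measure intro!: prob_space_uniform_measure)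
qed

lemma emeasure_cond_measure:
  assumes \<mu>: "\<mu> \<in> space (prob_algebra borel)" and [measurable]: "A \<in> sets borel" "B \<in> sets borel"
  shows "ennreal (measure \<mu> A) * emeasure (cond_measure \<mu> A) B = emeasure \<mu> (A \<inter> B)"
proof -
  interpret prob_space \<mu> using \<mu> by (simp add: space_prob_algebra)
  have S[measurable_cong, simp]: "sets \<mu> = sets borel" using \<mu> by (simp add: space_prob_algebra)
  show ?thesis
  proof (cases "measure \<mu> A = 0")
    case True
    have "emeasure \<mu> (A \<inter> B) \<le> emeasure \<mu> A" by (intro emeasure_mono) auto
    then show ?thesis using True by (simp add: emeasure_eq_measure)
  next
    case False
    then have "0 < measure \<mu> A" using measure_nonneg[of \<mu> A] by linarith
    then show ?thesis using False
      by (simp add: cond_measure_def emeasure_eq_measure divide_ennreal ennreal_mult[symmetric])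
  qed
qed

lemma product_coupling:
  fixes \<mu> \<nu> :: "'a::euclidean_space measure"
  assumes \<mu>: "\<mu> \<in> space (prob_algebra borel)" and \<nu>: "\<nu> \<in> space (prob_algebra borel)"
  shows "\<mu> \<Otimes>\<^sub>M \<nu> \<in> couplings \<mu> \<nu>" "\<mu> \<Otimes>\<^sub>M \<nu> \<in> space (prob_algebra (borel \<Otimes>\<^sub>M borel))"
proof -
  interpret \<mu>: prob_space \<mu> using \<mu> by (simp add: space_prob_algebra)
  interpret \<nu>: prob_space \<nu> using \<nu> by (simp add: space_prob_algebra)
  interpret pair_prob_space \<mu> \<nu> ..
  have S[measurable_cong, simp]: "sets \<mu> = sets borel" "sets \<nu> = sets borel"
    using \<mu> \<nu> by (auto simp: space_prob_algebra)
  have sp[simp]: "space \<mu> = UNIV" "space \<nu> = UNIV"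
    using sets_eq_imp_space_eq[OF S(1)] sets_eq_imp_space_eq[OF S(2)] by simp_all
  have P: "sets (\<mu> \<Otimes>\<^sub>M \<nu>) = sets (borel \<Otimes>\<^sub>M borel)" by (intro sets_pair_measure_cong) auto
  have 1: "distr (\<mu> \<Otimes>\<^sub>M \<nu>) borel fst = \<mu>"
  proof (rule measure_eqI)
    fix A assume "A \<in> sets (distr (\<mu> \<Otimes>\<^sub>M \<nu>) borel fst)"
    then have A: "A \<in> sets borel" by simp
    have "emeasure (distr (\<mu> \<Otimes>\<^sub>M \<nu>) borel fst) A = emeasure (\<mu> \<Otimes>\<^sub>M \<nu>) (A \<times> UNIV)"
      using A by (subst emeasure_distr) (auto simp: space_pair_measure intro!: arg_cong[where f="emeasure _"])
    also have "\<dots> = emeasure \<mu> A"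
      using A by (subst \<nu>.emeasure_pair_measure_Times) (simp_all add: \<nu>.emeasure_space_1[simplified] \<mu>.emeasure_space_1[simplified])
    finally show "emeasure (distr (\<mu> \<Otimes>\<^sub>M \<nu>) borel fst) A = emeasure \<mu> A" .
  qed simp
  have 2: "distr (\<mu> \<Otimes>\<^sub>M \<nu>) borel snd = \<nu>"
  proof (rule measure_eqI)
    fix A assume "A \<in> sets (distr (\<mu> \<Otimes>\<^sub>M \<nu>) borel snd)"
    then have A: "A \<in> sets borel" by simp
    have "emeasure (distr (\<mu> \<Otimes>\<^sub>M \<nu>) borel snd) A = emeasure (\<mu> \<Otimes>\<^sub>M \<nu>) (UNIV \<times> A)"
      using A by (subst emeasure_distr) (auto simp: space_pair_measure intro!: arg_cong[where f="emeasure _"])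
    also have "\<dots> = emeasure \<nu> A"
      using A by (subst \<nu>.emeasure_pair_measure_Times) (simp_all add: \<nu>.emeasure_space_1[simplified] \<mu>.emeasure_space_1[simplified])
    finally show "emeasure (distr (\<mu> \<Otimes>\<^sub>M \<nu>) borel snd) A = emeasure \<nu> A" .
  qed simp
  show "\<mu> \<Otimes>\<^sub>M \<nu> \<in> couplings \<mu> \<nu>" using 1 2 P by (simp add: couplings_def)
  show "\<mu> \<Otimes>\<^sub>M \<nu> \<in> space (prob_algebra (borel \<Otimes>\<^sub>M borel))" using P by (simp add: space_prob_algebra prob_space_axioms)
qed

lemma coupling_prob:
  assumes \<mu>: "\<mu> \<in> space (prob_algebra borel)" and \<pi>: "\<pi> \<in> couplings \<mu> \<nu>"
  shows "\<pi> \<in> space (prob_algebra (borel \<Otimes>\<^sub>M borel))"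
proof -
  have S[measurable_cong]: "sets \<pi> = sets (borel \<Otimes>\<^sub>M borel)" and D: "distr \<pi> borel fst = \<mu>"
    using \<pi> by (auto simp: couplings_def)
  have "prob_space (distr \<pi> borel fst)" using D \<mu> by (simp add: space_prob_algebra)
  then have "prob_space \<pi>" by (rule prob_space_distrD[rotated]) (simp add: measurable_cong_sets[OF S refl])
  then show ?thesis using S by (simp add: space_prob_algebra)
qed

lemma AE_couplings:
  assumes "\<pi> \<in> couplings \<mu> \<nu>" and [measurable]: "Measurable.pred borel P" "Measurable.pred borel Q"
    and "AE x in \<mu>. P x" "AE y in \<nu>. Q y"
  shows "AE z in \<pi>. P (fst z) \<and> Q (snd z)"
proof -
  have S[measurable_cong]: "sets \<pi> = sets (borel \<Otimes>\<^sub>M borel)"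
    and D: "\<mu> = distr \<pi> borel fst" "\<nu> = distr \<pi> borel snd"
    using assms(1) by (auto simp: couplings_def)
  have "AE z in \<pi>. P (fst z)" "AE z in \<pi>. Q (snd z)"
    using assms(4,5) unfolding D by (simp_all add: AE_distr_iff)
  then show ?thesis by auto
qed

lemma AE_cond_measure:
  assumes \<mu>: "\<mu> \<in> space (prob_algebra borel)" and A: "A \<in> sets borel" and "measure \<mu> A \<noteq> 0"
  shows "AE x in cond_measure \<mu> A. x \<in> A"
proof -
  interpret prob_space \<mu> using \<mu> by (simp add: space_prob_algebra)
  have "cond_measure \<mu> A = uniform_measure \<mu> A" using assms by (simp add: cond_measure_def)
  moreover have "AE x in uniform_measure \<mu> A. x \<in> A"
    using A \<mu> by (intro AE_uniform_measureI) (auto simp: space_prob_algebra)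
  ultimately show ?thesis by (simp only:)
qed

section \<open>Gluing couplings over a partition\<close>

text \<open>Draw a pair of cell indices from the maximal coupling of the two index laws. If both indices agree,
use the coupling available on that cell, which costs \<open>T i\<close>; otherwise draw the points independently
from the two cells, which costs at most \<open>G i + G j\<close>. The probability that the first index is \<open>i\<close> and the second is
different is the excess of \<open>\<mu>\<close> over the common mass of cell \<open>i\<close>, and likewise for \<open>\<nu>\<close>; together the excesses are
the discrepancy of the cell.\<close>

lemma glue_couplings:
  fixes \<mu> \<nu> :: "'a::euclidean_space measure" and \<kappa> :: "'a \<Rightarrow> 'i::countable"
    and c :: "'a \<times> 'a \<Rightarrow> ennreal" and T G :: "'i \<Rightarrow> ennreal"
  assumes \<mu>: "\<mu> \<in> space (prob_algebra borel)" and \<nu>: "\<nu> \<in> space (prob_algebra borel)"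
    and \<kappa>[measurable]: "\<kappa> \<in> borel \<rightarrow>\<^sub>M count_space UNIV"
    and c[measurable]: "c \<in> borel_measurable (borel \<Otimes>\<^sub>M borel)"
    and T: "\<And>i. measure \<mu> (\<kappa> -` {i}) \<noteq> 0 \<Longrightarrow> measure \<nu> (\<kappa> -` {i}) \<noteq> 0 \<Longrightarrow>
      transport_le c (cond_measure \<mu> (\<kappa> -` {i})) (cond_measure \<nu> (\<kappa> -` {i})) (T i)"
    and G: "\<And>x y. \<kappa> x \<noteq> \<kappa> y \<Longrightarrow> c (x, y) \<le> G (\<kappa> x) + G (\<kappa> y)"
  shows "transport_le c \<mu> \<nu>
    ((\<integral>\<^sup>+i. ennreal (min (measure \<mu> (\<kappa> -` {i})) (measure \<nu> (\<kappa> -` {i}))) * T i \<partial>count_space UNIV)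
     + (\<integral>\<^sup>+i. G i * ennreal \<bar>measure \<mu> (\<kappa> -` {i}) - measure \<nu> (\<kappa> -` {i})\<bar> \<partial>count_space UNIV))"
proof -
  define K where "K i = \<kappa> -` {i}" for i
  have K[measurable]: "K i \<in> sets borel" for i by (simp add: K_def)
  obtain a where a: "\<And>i. pmf a i = measure \<mu> (K i)" using index_pmf[OF \<mu> \<kappa>] unfolding K_def by metis
  obtain b where b: "\<And>i. pmf b i = measure \<nu> (K i)" using index_pmf[OF \<nu> \<kappa>] unfolding K_def by metis
  obtain J where J: "map_pmf fst J = a" "map_pmf snd J = b"
      and Jd: "\<And>i. pmf J (i, i) = min (pmf a i) (pmf b i)"
    using maximal_coupling_pmf[of a b] by metis
  define R0 where "R0 z = cond_measure \<mu> (K (fst z)) \<Otimes>\<^sub>M cond_measure \<nu> (K (snd z))" for z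
  define good where "good i \<longleftrightarrow> measure \<mu> (K i) \<noteq> 0 \<and> measure \<nu> (K i) \<noteq> 0" for i
  have "\<exists>\<pi>. \<pi> \<in> couplings (cond_measure \<mu> (K i)) (cond_measure \<nu> (K i)) \<and> (\<integral>\<^sup>+z. c z \<partial>\<pi>) \<le> T i"
    if "good i" for i using T[of i] that unfolding good_def transport_le_def K_def by auto
  then obtain \<rho> where \<rho>: "\<And>i. good i \<Longrightarrow> \<rho> i \<in> couplings (cond_measure \<mu> (K i)) (cond_measure \<nu> (K i))"
      "\<And>i. good i \<Longrightarrow> (\<integral>\<^sup>+z. c z \<partial>\<rho> i) \<le> T i" by metis
  define R where "R z = (if fst z = snd z \<and> good (fst z) then \<rho> (fst z) else R0 z)" for z
  have Rc: "R z \<in> couplings (cond_measure \<mu> (K (fst z))) (cond_measure \<nu> (K (snd z)))" for z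
    using \<rho> product_coupling[OF cond_measure_prob[OF \<mu>] cond_measure_prob[OF \<nu>]] by (auto simp: R_def R0_def)
  have Rp: "R z \<in> space (prob_algebra (borel \<Otimes>\<^sub>M borel))" for z
    by (rule coupling_prob[OF cond_measure_prob[OF \<mu>] Rc])
  then have Rm[measurable]: "R \<in> measure_pmf J \<rightarrow>\<^sub>M subprob_algebra (borel \<Otimes>\<^sub>M borel)"
    by (auto simp: space_prob_algebra space_subprob_algebra prob_space_imp_subprob_space)
  define \<pi> where "\<pi> = measure_pmf J \<bind> R"
  have S\<pi>: "sets \<pi> = sets (borel \<Otimes>\<^sub>M borel)"
    unfolding \<pi>_def by (rule sets_bind[OF sets_kernel[OF Rm]]) auto
  have marg: "distr \<pi> borel f = \<eta>"
    if f: "f \<in> borel \<Otimes>\<^sub>M borel \<rightarrow>\<^sub>M borel" and \<eta>: "\<eta> \<in> space (prob_algebra borel)"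
      and h: "\<And>z. distr (R z) borel f = cond_measure \<eta> (K (h z))"
      and w: "map_pmf h J = w" "\<And>i. pmf w i = measure \<eta> (K i)" for f h w \<eta>
  proof (rule measure_eqI)
    have S': "sets \<eta> = sets borel" using \<eta> by (simp add: space_prob_algebra)
    then show "sets (distr \<pi> borel f) = sets \<eta>" by simp
    fix A assume "A \<in> sets (distr \<pi> borel f)"
    then have A: "A \<in> sets borel" by simp
    have "emeasure (distr \<pi> borel f) A = (\<integral>\<^sup>+z. emeasure (cond_measure \<eta> (K (h z))) A \<partial>measure_pmf J)"
      unfolding \<pi>_def
      by (subst distr_bind[OF Rm _ f]; (subst emeasure_bind[where N=borel])?)
        (auto simp: A h space_subprob_algebra cond_measure_prob[OF \<eta>, unfolded space_prob_algebra] prob_space_imp_subprob_space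
          cond_measure_prob[OF \<eta>, unfolded space_prob_algebra, simplified])
    also have "\<dots> = (\<integral>\<^sup>+i. emeasure (cond_measure \<eta> (K i)) A \<partial>measure_pmf (map_pmf h J))" by simp
    also have "\<dots> = (\<integral>\<^sup>+i. emeasure \<eta> (K i \<inter> A) \<partial>count_space UNIV)"
      by (simp add: w nn_integral_measure_pmf emeasure_cond_measure[OF \<eta> K A])
    also have "\<dots> = emeasure \<eta> A" unfolding K_def by (rule emeasure_split_index[OF S' \<kappa> A, symmetric])
    finally show "emeasure (distr \<pi> borel f) A = emeasure \<eta> A" .
  qed
  have "\<pi> \<in> couplings \<mu> \<nu>"
    using marg[OF measurable_fst \<mu> _ J(1) a] marg[OF measurable_snd \<nu> _ J(2) b] Rc S\<pi>
    by (auto simp: couplings_def)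
  have cost: "(\<integral>\<^sup>+z. c z \<partial>R (i, j)) \<le> (if i = j then T i else G i + G j)" if z: "(i, j) \<in> set_pmf J" for i j
  proof -
    have "i \<in> set_pmf a" "j \<in> set_pmf b" using z J by force+
    then have ij: "measure \<mu> (K i) \<noteq> 0" "measure \<nu> (K j) \<noteq> 0" by (auto simp: set_pmf_iff a b)
    show ?thesis
    proof (cases "i = j")
      case True
      then show ?thesis using \<rho>(2)[of i] ij by (simp add: R_def good_def)
    next
      case False
      have "AE z in R (i, j). fst z \<in> K i \<and> snd z \<in> K j"
        using Rc[of "(i, j)"] ij AE_cond_measure[OF \<mu> K] AE_cond_measure[OF \<nu> K]
        by (intro AE_couplings) auto
      then have "(\<integral>\<^sup>+z. c z \<partial>R (i, j)) \<le> (\<integral>\<^sup>+z. G i + G j \<partial>R (i, j))"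
      proof (intro nn_integral_mono_AE, eventually_elim)
        fix z assume "fst z \<in> K i \<and> snd z \<in> K j"
        then show "c z \<le> G i + G j" using G[of "fst z" "snd z"] False by (auto simp: K_def)
      qed
      also have "\<dots> = G i + G j"
        using Rp[of "(i, j)"] by (simp add: space_prob_algebra prob_space.emeasure_space_1)
      finally show ?thesis using False by simp
    qed
  qed
  have ms: "(\<integral>\<^sup>+j. ennreal (pmf J (i, j)) \<partial>count_space UNIV) = ennreal (pmf a i)" for i
  proof -
    have "ennreal (pmf a i) = (\<integral>\<^sup>+z. ennreal (pmf J z) * indicator (fst -` {i}) z \<partial>count_space UNIV)"
      by (simp add: J(1)[symmetric] ennreal_pmf_map nn_integral_measure_pmf)
    also have "\<dots> = (\<integral>\<^sup>+i'. \<integral>\<^sup>+j. ennreal (pmf J (i', j)) * indicator {i} i' \<partial>count_space UNIV \<partial>count_space UNIV)"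
      by (subst nn_integral_fst_count_space[symmetric]) (auto intro!: nn_integral_cong split: split_indicator)
    also have "\<dots> = (\<integral>\<^sup>+j. ennreal (pmf J (i, j)) \<partial>count_space UNIV)"
      by (simp add: nn_integral_multc nn_integral_indicator_singleton)
    finally show ?thesis by simp
  qed
  have ms2: "(\<integral>\<^sup>+i. ennreal (pmf J (i, j)) \<partial>count_space UNIV) = ennreal (pmf b j)" for j
  proof -
    have "ennreal (pmf b j) = (\<integral>\<^sup>+z. ennreal (pmf J z) * indicator (snd -` {j}) z \<partial>count_space UNIV)"
      by (simp add: J(2)[symmetric] ennreal_pmf_map nn_integral_measure_pmf)
    also have "\<dots> = (\<integral>\<^sup>+j'. \<integral>\<^sup>+i. ennreal (pmf J (i, j')) * indicator {j} j' \<partial>count_space UNIV \<partial>count_space UNIV)"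
      by (subst nn_integral_snd_count_space[symmetric]) (auto intro!: nn_integral_cong split: split_indicator)
    also have "\<dots> = (\<integral>\<^sup>+i. ennreal (pmf J (i, j)) \<partial>count_space UNIV)"
      by (simp add: nn_integral_multc nn_integral_indicator_singleton)
    finally show ?thesis by simp
  qed
  define m where "m i = min (pmf a i) (pmf b i)" for i
  have m0: "0 \<le> m i" "m i \<le> pmf a i" "m i \<le> pmf b i" for i by (auto simp: m_def)
  have off1: "(\<integral>\<^sup>+j. ennreal (pmf J (i, j)) * indicator (- {i}) j \<partial>count_space UNIV) = ennreal (pmf a i - m i)" (is "?o = _") for i
  proof -
    have "?o + ennreal (m i) = (\<integral>\<^sup>+j. ennreal (pmf J (i, j)) * indicator (- {i}) j + ennreal (m i) * indicator {i} j \<partial>count_space UNIV)"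
      by (subst nn_integral_add) auto
    also have "\<dots> = (\<integral>\<^sup>+j. ennreal (pmf J (i, j)) \<partial>count_space UNIV)"
      by (intro nn_integral_cong) (auto simp: Jd m_def split: split_indicator)
    also have "\<dots> = ennreal (pmf a i)" by (rule ms)
    finally show ?thesis using m0[of i] by (metis ennreal_minus ennreal_add_diff_cancel_right ennreal_neq_top infinity_ennreal_def)
  qed
  have off2: "(\<integral>\<^sup>+i. ennreal (pmf J (i, j)) * indicator (- {j}) i \<partial>count_space UNIV) = ennreal (pmf b j - m j)" (is "?o = _") for j
  proof -
    have "?o + ennreal (m j) = (\<integral>\<^sup>+i. ennreal (pmf J (i, j)) * indicator (- {j}) i + ennreal (m j) * indicator {j} i \<partial>count_space UNIV)"
      by (subst nn_integral_add) auto
    also have "\<dots> = (\<integral>\<^sup>+i. ennreal (pmf J (i, j)) \<partial>count_space UNIV)"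
      by (intro nn_integral_cong) (auto simp: Jd m_def split: split_indicator)
    also have "\<dots> = ennreal (pmf b j)" by (rule ms2)
    finally show ?thesis using m0[of j] by (metis ennreal_minus ennreal_add_diff_cancel_right ennreal_neq_top infinity_ennreal_def)
  qed
  let ?N = "\<lambda>i j. ennreal (pmf J (i, j)) * indicator (- {i}) j"
  have N': "?N i j = ennreal (pmf J (i, j)) * indicator (- {j}) i" for i j
    by (auto split: split_indicator)
  have "(\<integral>\<^sup>+z. c z \<partial>\<pi>) = (\<integral>\<^sup>+z. \<integral>\<^sup>+w. c w \<partial>R z \<partial>measure_pmf J)"
    unfolding \<pi>_def by (rule nn_integral_bind[OF c Rm])
  also have "\<dots> \<le> (\<integral>\<^sup>+z. (if fst z = snd z then T (fst z) else G (fst z) + G (snd z)) \<partial>measure_pmf J)"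
    by (intro nn_integral_mono_AE, subst AE_measure_pmf_iff, intro ballI)
      (metis cost prod.collapse)
  also have "\<dots> = (\<integral>\<^sup>+i. \<integral>\<^sup>+j. ennreal (pmf J (i, j)) * (if i = j then T i else G i + G j) \<partial>count_space UNIV \<partial>count_space UNIV)"
    by (simp add: nn_integral_measure_pmf nn_integral_fst_count_space[symmetric] cong: if_cong)
  also have "\<dots> = (\<integral>\<^sup>+i. \<integral>\<^sup>+j. (ennreal (m i) * T i * indicator {i} j + G i * ?N i j) + G j * ?N i j \<partial>count_space UNIV \<partial>count_space UNIV)"
    by (intro nn_integral_cong) (auto simp: Jd m_def field_simps split: split_indicator)
  also have "\<dots> = (\<integral>\<^sup>+i. (ennreal (m i) * T i + G i * ennreal (pmf a i - m i)) + (\<integral>\<^sup>+j. G j * ?N i j \<partial>count_space UNIV) \<partial>count_space UNIV)"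
    by (intro nn_integral_cong) (simp add: nn_integral_add nn_integral_cmult off1 nn_integral_indicator_singleton)
  also have "\<dots> = (\<integral>\<^sup>+i. ennreal (m i) * T i + G i * ennreal (pmf a i - m i) \<partial>count_space UNIV)
      + (\<integral>\<^sup>+i. \<integral>\<^sup>+j. G j * ?N i j \<partial>count_space UNIV \<partial>count_space UNIV)"
    by (rule nn_integral_add) auto
  also have "(\<integral>\<^sup>+i. \<integral>\<^sup>+j. G j * ?N i j \<partial>count_space UNIV \<partial>count_space UNIV)
      = (\<integral>\<^sup>+j. \<integral>\<^sup>+i. G j * ?N i j \<partial>count_space UNIV \<partial>count_space UNIV)"
    by (rule nn_integral_count_space_nn_integral) auto
  also have "\<dots> = (\<integral>\<^sup>+j. G j * ennreal (pmf b j - m j) \<partial>count_space UNIV)"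
    unfolding N' by (simp add: nn_integral_cmult off2)
  also have "(\<integral>\<^sup>+i. ennreal (m i) * T i + G i * ennreal (pmf a i - m i) \<partial>count_space UNIV) + \<dots>
      = (\<integral>\<^sup>+i. ennreal (m i) * T i + (G i * ennreal (pmf a i - m i) + G i * ennreal (pmf b i - m i)) \<partial>count_space UNIV)"
    by (subst nn_integral_add[symmetric]) (auto simp: add.assoc)
  also have "\<dots> = (\<integral>\<^sup>+i. ennreal (m i) * T i + G i * ennreal \<bar>pmf a i - pmf b i\<bar> \<partial>count_space UNIV)"
    by (intro nn_integral_cong)
      (auto simp: distrib_left[symmetric] ennreal_plus[symmetric] m_def simp del: ennreal_plus split: split_min)
  also have "\<dots> = (\<integral>\<^sup>+i. ennreal (m i) * T i \<partial>count_space UNIV) + (\<integral>\<^sup>+i. G i * ennreal \<bar>pmf a i - pmf b i\<bar> \<partial>count_space UNIV)"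
    by (rule nn_integral_add) auto
  finally show ?thesis
    using \<open>\<pi> \<in> couplings \<mu> \<nu>\<close> unfolding transport_le_def m_def a b K_def by blast
qed

section \<open>Coupling through a refining sequence of partitions\<close>

lemma measure_cond_measure:
  assumes \<mu>: "\<mu> \<in> space (prob_algebra borel)" and A: "A \<in> sets borel" and B: "B \<in> sets borel"
    and pos: "measure \<mu> A \<noteq> 0"
  shows "measure (cond_measure \<mu> A) B = measure \<mu> (A \<inter> B) / measure \<mu> A"
proof -
  interpret prob_space \<mu> using \<mu> by (simp add: space_prob_algebra)
  have S[simp]: "sets \<mu> = sets borel" using \<mu> by (simp add: space_prob_algebra)
  have "cond_measure \<mu> A = uniform_measure \<mu> A" using pos by (simp add: cond_measure_def)
  then show ?thesis using measure_uniform_measure[of \<mu> A B] pos A B by (simp add: emeasure_eq_measure)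
qed

lemma cond_measure_cond_measure:
  assumes \<mu>: "\<mu> \<in> space (prob_algebra borel)" and A: "A \<in> sets borel" and B: "B \<in> sets borel"
    and sub: "B \<subseteq> A" and pos: "measure \<mu> B \<noteq> 0"
  shows "cond_measure (cond_measure \<mu> A) B = cond_measure \<mu> B"
proof -
  interpret prob_space \<mu> using \<mu> by (simp add: space_prob_algebra)
  have S[simp]: "sets \<mu> = sets borel" using \<mu> by (simp add: space_prob_algebra)
  have "measure \<mu> B \<le> measure \<mu> A" using A sub by (intro finite_measure_mono) auto
  moreover have "0 < measure \<mu> B" using pos measure_nonneg[of \<mu> B] by linarith
  ultimately have pA: "0 < measure \<mu> A" "0 < measure \<mu> B" by linarith+
  then have posA: "measure \<mu> A \<noteq> 0" by simp
  have c: "measure (cond_measure \<mu> A) B = measure \<mu> B / measure \<mu> A"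
    using measure_cond_measure[OF \<mu> A B posA] sub by (simp add: Int_absorb1)
  show ?thesis
  proof (rule measure_eqI)
    have p: "cond_measure \<mu> A \<in> space (prob_algebra borel)" "cond_measure \<mu> B \<in> space (prob_algebra borel)"
      "cond_measure (cond_measure \<mu> A) B \<in> space (prob_algebra borel)"
      by (intro cond_measure_prob \<mu>)+
    then show "sets (cond_measure (cond_measure \<mu> A) B) = sets (cond_measure \<mu> B)"
      by (simp add: space_prob_algebra)
    fix C assume "C \<in> sets (cond_measure (cond_measure \<mu> A) B)"
    then have C: "C \<in> sets borel" using p by (simp add: space_prob_algebra)
    have "measure (cond_measure (cond_measure \<mu> A) B) C = measure (cond_measure \<mu> B) C"
      using measure_cond_measure[OF p(1) B C] measure_cond_measure[OF \<mu> B C pos]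
        measure_cond_measure[OF \<mu> A sets.Int[OF B C] posA] c pA sub
      by (simp add: Int_absorb1 Int_assoc[symmetric])
    then show "emeasure (cond_measure (cond_measure \<mu> A) B) C = emeasure (cond_measure \<mu> B) C"
      using p by (simp add: space_prob_algebra finite_measure.emeasure_eq_measure prob_space.finite_measure)
  qed
qed

text \<open>The elementary inequality behind the passage from conditional to unconditional discrepancies: rescaling
by different totals \<open>X\<close> and \<open>Y\<close> is charged to \<open>\<bar>X - Y\<bar>\<close> with weights that sum to one over the children of a cell.\<close>

lemma min_rescaled_diff_le:
  fixes x y X Y :: real
  assumes "0 < X" "0 < Y" "0 \<le> x" "0 \<le> y"
  shows "min X Y * \<bar>x / X - y / Y\<bar> \<le> \<bar>x - y\<bar> + \<bar>X - Y\<bar> * (if X \<le> Y then y / Y else x / X)"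
proof (cases "X \<le> Y")
  case True
  have "min X Y * \<bar>x / X - y / Y\<bar> = \<bar>X * (x / X - y / Y)\<bar>"
    using assms True by (simp add: abs_mult)
  also have "X * (x / X - y / Y) = (x - y) + (Y - X) * (y / Y)"
    using assms by (simp add: field_simps)
  also have "\<bar>\<dots>\<bar> \<le> \<bar>x - y\<bar> + \<bar>(Y - X) * (y / Y)\<bar>" by (rule abs_triangle_ineq)
  also have "\<bar>(Y - X) * (y / Y)\<bar> = \<bar>X - Y\<bar> * (y / Y)" using assms by (simp add: abs_mult abs_minus_commute)
  finally show ?thesis using True by simp
next
  case False
  have "min X Y * \<bar>x / X - y / Y\<bar> = \<bar>Y * (x / X - y / Y)\<bar>"
    using assms False by (simp add: abs_mult)
  also have "Y * (x / X - y / Y) = (x - y) + (Y - X) * (x / X)"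
    using assms by (simp add: field_simps)
  also have "\<bar>\<dots>\<bar> \<le> \<bar>x - y\<bar> + \<bar>(Y - X) * (x / X)\<bar>" by (rule abs_triangle_ineq)
  also have "\<bar>(Y - X) * (x / X)\<bar> = \<bar>X - Y\<bar> * (x / X)" using assms by (simp add: abs_mult abs_minus_commute)
  finally show ?thesis using False by simp
qed

lemma min_mult_rescaled_min_le:
  fixes x y X Y :: real
  assumes "0 < X" "0 < Y" "0 \<le> x" "0 \<le> y"
  shows "min X Y * min (x / X) (y / Y) \<le> min x y"
proof -
  have "min X Y * min (x / X) (y / Y) \<le> X * (x / X)" "min X Y * min (x / X) (y / Y) \<le> Y * (y / Y)"
    using assms by (intro mult_mono; auto simp: min_def)+
  then show ?thesis using assms by simp
qed

lemma prob_split_index: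
  fixes \<kappa> :: "'a::euclidean_space \<Rightarrow> 'i::countable"
  assumes \<mu>: "\<mu> \<in> space (prob_algebra borel)" and \<kappa>: "\<kappa> \<in> borel \<rightarrow>\<^sub>M count_space UNIV" and A: "A \<in> sets borel"
  shows "ennreal (measure \<mu> A) = (\<integral>\<^sup>+i. ennreal (measure \<mu> (\<kappa> -` {i} \<inter> A)) \<partial>count_space UNIV)"
proof -
  interpret prob_space \<mu> using \<mu> by (simp add: space_prob_algebra)
  have S[simp]: "sets \<mu> = sets borel" using \<mu> by (simp add: space_prob_algebra)
  show ?thesis using emeasure_split_index[OF S \<kappa> A] by (simp add: emeasure_eq_measure)
qed

text \<open>After multiplication with the common mass of a cell \<open>C\<close>, the discrepancy of the conditional laws
on the children of \<open>C\<close> is controlled by the unconditional discrepancies on the children. The factor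
\<open>2\<close> does not accumulate over scales because at every scale it is the original measures that are conditioned.\<close>

lemma sum_rescaled_diff_le:
  fixes \<mu> \<nu> :: "'a::euclidean_space measure" and \<kappa> :: "'a \<Rightarrow> 'i::countable"
  assumes \<mu>: "\<mu> \<in> space (prob_algebra borel)" and \<nu>: "\<nu> \<in> space (prob_algebra borel)"
    and \<kappa>: "\<kappa> \<in> borel \<rightarrow>\<^sub>M count_space UNIV" and C: "C \<in> sets borel"
    and pos: "measure \<mu> C \<noteq> 0" "measure \<nu> C \<noteq> 0"
  shows "ennreal (min (measure \<mu> C) (measure \<nu> C)) *
      (\<integral>\<^sup>+i. ennreal \<bar>measure (cond_measure \<mu> C) (\<kappa> -` {i}) - measure (cond_measure \<nu> C) (\<kappa> -` {i})\<bar> \<partial>count_space UNIV)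
    \<le> 2 * (\<integral>\<^sup>+i. ennreal \<bar>measure \<mu> (C \<inter> \<kappa> -` {i}) - measure \<nu> (C \<inter> \<kappa> -` {i})\<bar> \<partial>count_space UNIV)"
    (is "ennreal ?m * ?L \<le> 2 * ?R")
proof -
  define X where "X = measure \<mu> C"
  define Y where "Y = measure \<nu> C"
  define x where "x i = measure \<mu> (C \<inter> \<kappa> -` {i})" for i
  define y where "y i = measure \<nu> (C \<inter> \<kappa> -` {i})" for i
  have XY: "0 < X" "0 < Y" using pos measure_nonneg[of \<mu> C] measure_nonneg[of \<nu> C]
    unfolding X_def Y_def by linarith+
  have xy: "0 \<le> x i" "0 \<le> y i" for i by (auto simp: x_def y_def)
  have sx: "(\<integral>\<^sup>+i. ennreal (x i) \<partial>count_space UNIV) = ennreal X"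
    using prob_split_index[OF \<mu> \<kappa> C] by (simp add: X_def x_def Int_commute)
  have sy: "(\<integral>\<^sup>+i. ennreal (y i) \<partial>count_space UNIV) = ennreal Y"
    using prob_split_index[OF \<nu> \<kappa> C] by (simp add: Y_def y_def Int_commute)
  have dX: "ennreal X \<le> (\<integral>\<^sup>+i. ennreal \<bar>x i - y i\<bar> \<partial>count_space UNIV) + ennreal Y"
    unfolding sx[symmetric] sy[symmetric]
    by (subst nn_integral_add[symmetric])
      (auto intro!: nn_integral_mono simp: ennreal_plus[symmetric] xy simp del: ennreal_plus)
  have dY: "ennreal Y \<le> (\<integral>\<^sup>+i. ennreal \<bar>x i - y i\<bar> \<partial>count_space UNIV) + ennreal X"
    unfolding sx[symmetric] sy[symmetric]
    by (subst nn_integral_add[symmetric])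
      (auto intro!: nn_integral_mono simp: ennreal_plus[symmetric] xy simp del: ennreal_plus)
  have d: "ennreal \<bar>X - Y\<bar> \<le> (\<integral>\<^sup>+i. ennreal \<bar>x i - y i\<bar> \<partial>count_space UNIV)"
  proof (cases "X \<le> Y")
    case True
    then have "ennreal \<bar>X - Y\<bar> = ennreal Y - ennreal X" using XY by (simp add: ennreal_minus)
    then show ?thesis using dY by (simp add: ennreal_minus_le_iff add.commute)
  next
    case False
    then have "ennreal \<bar>X - Y\<bar> = ennreal X - ennreal Y" using XY by (simp add: ennreal_minus)
    then show ?thesis using dX by (simp add: ennreal_minus_le_iff add.commute)
  qed
  define z where "z i = (if X \<le> Y then y i / Y else x i / X)" for i
  have z0: "0 \<le> z i" for i using xy XY by (auto simp: z_def)
  have sz: "(\<integral>\<^sup>+i. ennreal (z i) \<partial>count_space UNIV) = 1"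
  proof (cases "X \<le> Y")
    case True
    then have "(\<integral>\<^sup>+i. ennreal (z i) \<partial>count_space UNIV) = (\<integral>\<^sup>+i. ennreal (1 / Y) * ennreal (y i) \<partial>count_space UNIV)"
      using XY xy by (intro nn_integral_cong) (simp add: z_def ennreal_mult[symmetric])
    then show ?thesis using XY by (simp add: nn_integral_cmult sy ennreal_mult[symmetric])
  next
    case False
    then have "(\<integral>\<^sup>+i. ennreal (z i) \<partial>count_space UNIV) = (\<integral>\<^sup>+i. ennreal (1 / X) * ennreal (x i) \<partial>count_space UNIV)"
      using XY xy by (intro nn_integral_cong) (simp add: z_def ennreal_mult[symmetric])
    then show ?thesis using XY by (simp add: nn_integral_cmult sx ennreal_mult[symmetric])
  qed
  have K: "\<kappa> -` {i} \<in> sets borel" for i using \<kappa> by measurable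
  have "ennreal ?m * ?L = (\<integral>\<^sup>+i. ennreal (min X Y * \<bar>x i / X - y i / Y\<bar>) \<partial>count_space UNIV)"
    unfolding X_def Y_def x_def y_def
    by (subst nn_integral_cmult[symmetric])
      (auto intro!: nn_integral_cong simp: ennreal_mult[symmetric] measure_cond_measure[OF \<mu> C K pos(1)] measure_cond_measure[OF \<nu> C K pos(2)])
  also have "\<dots> \<le> (\<integral>\<^sup>+i. ennreal \<bar>x i - y i\<bar> + ennreal \<bar>X - Y\<bar> * ennreal (z i) \<partial>count_space UNIV)"
    using min_rescaled_diff_le[OF XY xy(1) xy(2)] z0
    by (intro nn_integral_mono) (simp add: ennreal_mult[symmetric] ennreal_plus[symmetric] z_def del: ennreal_plus)
  also have "\<dots> = ?R + ennreal \<bar>X - Y\<bar>"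
    by (subst nn_integral_add) (auto simp: nn_integral_cmult sz x_def y_def)
  also have "\<dots> \<le> ?R + ?R" using d unfolding x_def y_def by (intro add_left_mono) auto
  finally show ?thesis by (simp add: mult_2)
qed

text \<open>Iteration of \<open>glue_couplings\<close> down a refining sequence of partitions with indices \<open>\<kappa> l x\<close>. The weight
\<open>w l i\<close> dominates the cost inside the cell \<open>i\<close> of level \<open>l\<close> and takes the same value on its children.
The induction runs over the number \<open>L\<close> of levels that are still refined and proves, for each cell, a bound
on (common mass) times (cost between the conditional laws). In this homogeneous form the bounds
of the children enter the bound \<open>V\<close> of the parent additively, so that summing \<open>V\<close> over all cells of a level splits off
the discrepancies of one level after the other. The last
summand pays for the mass that stays together through all \<open>L\<close> levels.\<close>

lemma multiscale_coupling:
  fixes \<mu> \<nu> :: "'a::euclidean_space measure" and \<kappa> :: "nat \<Rightarrow> 'a \<Rightarrow> 'i::countable"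
    and c :: "'a \<times> 'a \<Rightarrow> ennreal" and w :: "nat \<Rightarrow> 'i \<Rightarrow> ennreal"
  assumes \<mu>: "\<mu> \<in> space (prob_algebra borel)" and \<nu>: "\<nu> \<in> space (prob_algebra borel)"
    and \<kappa>: "\<And>l. \<kappa> l \<in> borel \<rightarrow>\<^sub>M count_space UNIV"
    and refine: "\<And>l x y. \<kappa> (Suc l) x = \<kappa> (Suc l) y \<Longrightarrow> \<kappa> l x = \<kappa> l y"
    and c: "c \<in> borel_measurable (borel \<Otimes>\<^sub>M borel)"
    and w: "\<And>l x. w l (\<kappa> (Suc l) x) = w l (\<kappa> l x)"
    and near: "\<And>l x y. \<kappa> l x = \<kappa> l y \<Longrightarrow> c (x, y) \<le> w l (\<kappa> l x)"
    and far: "\<And>x y. c (x, y) \<le> w 0 (\<kappa> 0 x) + w 0 (\<kappa> 0 y)"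
  defines "\<Delta> \<equiv> \<lambda>l i. ennreal \<bar>measure \<mu> (\<kappa> l -` {i}) - measure \<nu> (\<kappa> l -` {i})\<bar>"
    and "m \<equiv> \<lambda>l i. ennreal (min (measure \<mu> (\<kappa> l -` {i})) (measure \<nu> (\<kappa> l -` {i})))"
  shows "transport_le c \<mu> \<nu>
    ((\<integral>\<^sup>+i. w 0 i * \<Delta> 0 i \<partial>count_space UNIV)
     + (\<Sum>k<L. 2 * (\<integral>\<^sup>+i. w k i * \<Delta> (Suc k) i \<partial>count_space UNIV))
     + (\<integral>\<^sup>+i. w L i * m L i \<partial>count_space UNIV))"
proof -
  define K where "K l i = \<kappa> l -` {i}" for l i
  have K[measurable]: "K l i \<in> sets borel" for l i using \<kappa> unfolding K_def by measurable
  \<comment> \<open>the parent of a cell; its value at the index of an empty cell does not matter\<close>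
  define par where "par l j = \<kappa> l (SOME x. \<kappa> (Suc l) x = j)" for l j
  have par: "par l (\<kappa> (Suc l) x) = \<kappa> l x" for l x
    unfolding par_def using someI[of "\<lambda>y. \<kappa> (Suc l) y = \<kappa> (Suc l) x" x] by (blast intro: refine)
  have child: "K l i \<inter> K (Suc l) j = (if par l j = i then K (Suc l) j else {})" for l i j
    using par by (auto simp: K_def)
  have wpar: "w l (par l j) = w l j" if "K (Suc l) j \<noteq> {}" for l j
    using that par w by (auto simp: K_def)
  define V where "V = rec_nat (\<lambda>l i. w l i * m l i)
    (\<lambda>_ v l i. \<integral>\<^sup>+j. indicator {i} (par l j) * (2 * (w l j * \<Delta> (Suc l) j) + v (Suc l) j) \<partial>count_space UNIV)"
  have V0: "V 0 l i = w l i * m l i" for l i by (simp add: V_def)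
  have VS: "V (Suc L) l i = (\<integral>\<^sup>+j. indicator {i} (par l j) * (2 * (w l j * \<Delta> (Suc l) j) + V L (Suc l) j) \<partial>count_space UNIV)"
    for L l i by (simp add: V_def)
  have tot: "(\<integral>\<^sup>+i. V L l i \<partial>count_space UNIV)
    = (\<Sum>k<L. 2 * (\<integral>\<^sup>+i. w (l + k) i * \<Delta> (Suc (l + k)) i \<partial>count_space UNIV))
      + (\<integral>\<^sup>+i. w (l + L) i * m (l + L) i \<partial>count_space UNIV)" for L l
  proof (induction L arbitrary: l)
    case 0
    show ?case by (simp add: V0)
  next
    case (Suc L)
    have "(\<integral>\<^sup>+i. V (Suc L) l i \<partial>count_space UNIV)
      = (\<integral>\<^sup>+j. \<integral>\<^sup>+i. indicator {i} (par l j) * (2 * (w l j * \<Delta> (Suc l) j) + V L (Suc l) j) \<partial>count_space UNIV \<partial>count_space UNIV)"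
      unfolding VS by (rule nn_integral_count_space_nn_integral) auto
    also have "\<dots> = (\<integral>\<^sup>+j. 2 * (w l j * \<Delta> (Suc l) j) + V L (Suc l) j \<partial>count_space UNIV)"
    proof (intro nn_integral_cong)
      fix j
      have "(\<integral>\<^sup>+i. indicator {i} (par l j) * z \<partial>count_space UNIV) = z" for z :: ennreal
      proof -
        have "(\<integral>\<^sup>+i. indicator {i} (par l j) * z \<partial>count_space UNIV) = (\<integral>\<^sup>+i. z * indicator {par l j} i \<partial>count_space UNIV)"
          by (intro nn_integral_cong) (auto split: split_indicator)
        then show ?thesis by (simp add: nn_integral_indicator_singleton)
      qed
      then show "(\<integral>\<^sup>+i. indicator {i} (par l j) * (2 * (w l j * \<Delta> (Suc l) j) + V L (Suc l) j) \<partial>count_space UNIV)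
          = 2 * (w l j * \<Delta> (Suc l) j) + V L (Suc l) j" .
    qed
    also have "\<dots> = 2 * (\<integral>\<^sup>+j. w l j * \<Delta> (Suc l) j \<partial>count_space UNIV) + (\<integral>\<^sup>+j. V L (Suc l) j \<partial>count_space UNIV)"
      by (simp add: nn_integral_add nn_integral_cmult)
    finally show ?case unfolding Suc by (simp add: sum.lessThan_Suc_shift add.assoc del: sum.lessThan_Suc)
  qed
  have cell: "\<exists>T. transport_le c (cond_measure \<mu> (K l i)) (cond_measure \<nu> (K l i)) T \<and> m l i * T \<le> V L l i"
    if pos: "measure \<mu> (K l i) \<noteq> 0" "measure \<nu> (K l i) \<noteq> 0" for L l i
    using pos
  proof (induction L arbitrary: l i)
    case 0
    note c\<mu> = cond_measure_prob[OF \<mu>] and c\<nu> = cond_measure_prob[OF \<nu>]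
    let ?\<pi> = "cond_measure \<mu> (K l i) \<Otimes>\<^sub>M cond_measure \<nu> (K l i)"
    have "AE z in ?\<pi>. fst z \<in> K l i \<and> snd z \<in> K l i"
      using AE_cond_measure[OF \<mu> K 0(1)] AE_cond_measure[OF \<nu> K 0(2)]
      by (intro AE_couplings[OF product_coupling(1)[OF c\<mu> c\<nu>]]) auto
    then have "(\<integral>\<^sup>+z. c z \<partial>?\<pi>) \<le> (\<integral>\<^sup>+z. w l i \<partial>?\<pi>)"
    proof (intro nn_integral_mono_AE, eventually_elim)
      fix z assume "fst z \<in> K l i \<and> snd z \<in> K l i"
      then show "c z \<le> w l i" using near[of l "fst z" "snd z"] by (simp add: K_def)
    qed
    also have "\<dots> = w l i"
      using product_coupling(2)[OF c\<mu> c\<nu>, of "K l i" "K l i"]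
      by (simp add: space_prob_algebra prob_space.emeasure_space_1)
    finally have "transport_le c (cond_measure \<mu> (K l i)) (cond_measure \<nu> (K l i)) (w l i)"
      using product_coupling(1)[OF c\<mu> c\<nu>] unfolding transport_le_def by blast
    then show ?case by (intro exI[of _ "w l i"]) (simp add: V0 mult.commute)
  next
    case (Suc L)
    define X where "X = measure \<mu> (K l i)"
    define Y where "Y = measure \<nu> (K l i)"
    have XY: "0 < X" "0 < Y"
      using Suc.prems measure_nonneg[of \<mu> "K l i"] measure_nonneg[of \<nu> "K l i"] unfolding X_def Y_def by linarith+
    define \<mu>' where "\<mu>' = cond_measure \<mu> (K l i)"
    define \<nu>' where "\<nu>' = cond_measure \<nu> (K l i)"
    have \<mu>': "\<mu>' \<in> space (prob_algebra borel)" and \<nu>': "\<nu>' \<in> space (prob_algebra borel)"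
      unfolding \<mu>'_def \<nu>'_def by (intro cond_measure_prob \<mu> \<nu>)+
    have mm: "measure \<mu>' (K (Suc l) j) = (if par l j = i then measure \<mu> (K (Suc l) j) / X else 0)"
      "measure \<nu>' (K (Suc l) j) = (if par l j = i then measure \<nu> (K (Suc l) j) / Y else 0)" for j
      unfolding \<mu>'_def \<nu>'_def using measure_cond_measure[OF \<mu> K K Suc.prems(1), of "Suc l" j]
        measure_cond_measure[OF \<nu> K K Suc.prems(2), of "Suc l" j] by (simp_all add: child X_def Y_def)
    define good where "good j \<longleftrightarrow> par l j = i \<and> measure \<mu> (K (Suc l) j) \<noteq> 0 \<and> measure \<nu> (K (Suc l) j) \<noteq> 0" for j
    have "\<exists>T. transport_le c (cond_measure \<mu> (K (Suc l) j)) (cond_measure \<nu> (K (Suc l) j)) T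
        \<and> m (Suc l) j * T \<le> V L (Suc l) j" if "good j" for j
      using Suc.IH that unfolding good_def by blast
    then obtain S where S: "\<And>j. good j \<Longrightarrow> transport_le c (cond_measure \<mu> (K (Suc l) j)) (cond_measure \<nu> (K (Suc l) j)) (S j)"
        "\<And>j. good j \<Longrightarrow> m (Suc l) j * S j \<le> V L (Suc l) j" by metis
    \<comment> \<open>cells outside the parent are null for the conditional laws, so an infinite price costs nothing there\<close>
    define G where "G j = (if par l j = i then w l i else \<top>)" for j
    let ?M = "\<lambda>j. ennreal (min (measure \<mu>' (K (Suc l) j)) (measure \<nu>' (K (Suc l) j)))"
    let ?D = "\<lambda>j. ennreal \<bar>measure \<mu>' (K (Suc l) j) - measure \<nu>' (K (Suc l) j)\<bar>"
    have tr: "transport_le c \<mu>' \<nu>' ((\<integral>\<^sup>+j. ?M j * S j \<partial>count_space UNIV) + (\<integral>\<^sup>+j. G j * ?D j \<partial>count_space UNIV))"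
      unfolding K_def
    proof (rule glue_couplings[OF \<mu>' \<nu>' \<kappa> c], fold K_def)
      fix j assume "measure \<mu>' (K (Suc l) j) \<noteq> 0" "measure \<nu>' (K (Suc l) j) \<noteq> 0"
      then have g: "good j" using XY unfolding mm good_def by (auto split: if_splits)
      then have "K (Suc l) j \<subseteq> K l i" using child[of l i j] by (auto simp: good_def)
      then have "cond_measure \<mu>' (K (Suc l) j) = cond_measure \<mu> (K (Suc l) j)"
        "cond_measure \<nu>' (K (Suc l) j) = cond_measure \<nu> (K (Suc l) j)"
        using g unfolding \<mu>'_def \<nu>'_def good_def
        by (auto intro!: cond_measure_cond_measure \<mu> \<nu> K)
      then show "transport_le c (cond_measure \<mu>' (K (Suc l) j)) (cond_measure \<nu>' (K (Suc l) j)) (S j)"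
        using S(1)[OF g] by simp
    next
      fix x y assume "\<kappa> (Suc l) x \<noteq> \<kappa> (Suc l) y"
      show "c (x, y) \<le> G (\<kappa> (Suc l) x) + G (\<kappa> (Suc l) y)"
      proof (cases "\<kappa> l x = i \<and> \<kappa> l y = i")
        case True
        then have "c (x, y) \<le> w l i" using near[of l x y] by simp
        also have "\<dots> \<le> w l i + w l i" by simp
        finally show ?thesis using True by (simp add: G_def par)
      qed (auto simp: G_def par)
    qed
    have mXY: "m l i = ennreal (min X Y)" by (simp add: m_def X_def Y_def K_def)
    have 1: "m l i * (\<integral>\<^sup>+j. ?M j * S j \<partial>count_space UNIV)
        \<le> (\<integral>\<^sup>+j. indicator {i} (par l j) * V L (Suc l) j \<partial>count_space UNIV)"
    proof (subst nn_integral_cmult[symmetric], simp, intro nn_integral_mono)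
      fix j
      show "m l i * (?M j * S j) \<le> indicator {i} (par l j) * V L (Suc l) j"
      proof (cases "good j")
        case True
        have "min X Y * min (measure \<mu> (K (Suc l) j) / X) (measure \<nu> (K (Suc l) j) / Y)
            \<le> min (measure \<mu> (K (Suc l) j)) (measure \<nu> (K (Suc l) j))"
          using XY by (rule min_mult_rescaled_min_le) auto
        moreover have "?M j = ennreal (min (measure \<mu> (K (Suc l) j) / X) (measure \<nu> (K (Suc l) j) / Y))"
          using True by (simp add: mm good_def)
        moreover have "m (Suc l) j = ennreal (min (measure \<mu> (K (Suc l) j)) (measure \<nu> (K (Suc l) j)))"
          by (simp add: m_def K_def)
        moreover have "0 \<le> min X Y" "0 \<le> min (measure \<mu> (K (Suc l) j) / X) (measure \<nu> (K (Suc l) j) / Y)"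
          using XY by auto
        ultimately have "m l i * ?M j \<le> m (Suc l) j"
          unfolding mXY by (simp only: ennreal_mult[symmetric] ennreal_leI)
        then have "m l i * ?M j * S j \<le> m (Suc l) j * S j" by (rule mult_right_mono) simp
        also have "\<dots> \<le> V L (Suc l) j" by (rule S(2)[OF True])
        finally show ?thesis using True by (simp add: good_def mult.assoc)
      next
        case False
        then have "measure \<mu>' (K (Suc l) j) = 0 \<or> measure \<nu>' (K (Suc l) j) = 0"
          by (auto simp: mm good_def)
        then have "min (measure \<mu>' (K (Suc l) j)) (measure \<nu>' (K (Suc l) j)) = 0"
          using measure_nonneg[of \<mu>' "K (Suc l) j"] measure_nonneg[of \<nu>' "K (Suc l) j"] by linarith
        then have "?M j = 0" by simp
        then show ?thesis by simp
      qed
    qed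
    have D: "?D j = indicator {i} (par l j) * ?D j" for j by (auto simp: mm split: split_indicator)
    have 2: "m l i * (\<integral>\<^sup>+j. G j * ?D j \<partial>count_space UNIV)
        \<le> (\<integral>\<^sup>+j. indicator {i} (par l j) * (2 * (w l j * \<Delta> (Suc l) j)) \<partial>count_space UNIV)"
    proof -
      have "(\<integral>\<^sup>+j. G j * ?D j \<partial>count_space UNIV) = (\<integral>\<^sup>+j. w l i * ?D j \<partial>count_space UNIV)"
        by (intro nn_integral_cong) (auto simp: G_def mm)
      then have "m l i * (\<integral>\<^sup>+j. G j * ?D j \<partial>count_space UNIV) = w l i * (ennreal (min X Y) * (\<integral>\<^sup>+j. ?D j \<partial>count_space UNIV))"
        by (simp add: nn_integral_cmult mXY ac_simps)
      also have "\<dots> \<le> w l i * (2 * (\<integral>\<^sup>+j. ennreal \<bar>measure \<mu> (K l i \<inter> K (Suc l) j) - measure \<nu> (K l i \<inter> K (Suc l) j)\<bar> \<partial>count_space UNIV))"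
        unfolding X_def Y_def \<mu>'_def \<nu>'_def K_def[of "Suc l"]
        by (intro mult_left_mono sum_rescaled_diff_le \<mu> \<nu> \<kappa> K Suc.prems) auto
      also have "\<dots> = (\<integral>\<^sup>+j. w l i * (2 * ennreal \<bar>measure \<mu> (K l i \<inter> K (Suc l) j) - measure \<nu> (K l i \<inter> K (Suc l) j)\<bar>) \<partial>count_space UNIV)"
        by (simp add: nn_integral_cmult)
      also have "\<dots> \<le> (\<integral>\<^sup>+j. indicator {i} (par l j) * (2 * (w l j * \<Delta> (Suc l) j)) \<partial>count_space UNIV)"
      proof (intro nn_integral_mono)
        fix j
        show "w l i * (2 * ennreal \<bar>measure \<mu> (K l i \<inter> K (Suc l) j) - measure \<nu> (K l i \<inter> K (Suc l) j)\<bar>)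
            \<le> indicator {i} (par l j) * (2 * (w l j * \<Delta> (Suc l) j))"
          using wpar[of l j] by (cases "K (Suc l) j = {}") (auto simp: child \<Delta>_def K_def[symmetric] ac_simps)
      qed
      finally show ?thesis .
    qed
    have "m l i * ((\<integral>\<^sup>+j. ?M j * S j \<partial>count_space UNIV) + (\<integral>\<^sup>+j. G j * ?D j \<partial>count_space UNIV))
        \<le> (\<integral>\<^sup>+j. indicator {i} (par l j) * V L (Suc l) j \<partial>count_space UNIV)
          + (\<integral>\<^sup>+j. indicator {i} (par l j) * (2 * (w l j * \<Delta> (Suc l) j)) \<partial>count_space UNIV)"
      unfolding distrib_left by (rule add_mono[OF 1 2])
    also have "\<dots> = V (Suc L) l i"
      unfolding VS by (subst nn_integral_add[symmetric]) (auto simp: distrib_left add.commute)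
    finally show ?case using tr unfolding \<mu>'_def \<nu>'_def by blast
  qed
  define good where "good i \<longleftrightarrow> measure \<mu> (K 0 i) \<noteq> 0 \<and> measure \<nu> (K 0 i) \<noteq> 0" for i
  have "\<exists>T. transport_le c (cond_measure \<mu> (K 0 i)) (cond_measure \<nu> (K 0 i)) T \<and> m 0 i * T \<le> V L 0 i"
    if "good i" for i using cell[of 0 i L] that by (simp add: good_def)
  then obtain S where S: "\<And>i. good i \<Longrightarrow> transport_le c (cond_measure \<mu> (K 0 i)) (cond_measure \<nu> (K 0 i)) (S i)"
      "\<And>i. good i \<Longrightarrow> m 0 i * S i \<le> V L 0 i" by metis
  have tr: "transport_le c \<mu> \<nu> ((\<integral>\<^sup>+i. m 0 i * S i \<partial>count_space UNIV) + (\<integral>\<^sup>+i. w 0 i * \<Delta> 0 i \<partial>count_space UNIV))"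
    unfolding m_def \<Delta>_def
    by (rule glue_couplings[OF \<mu> \<nu> \<kappa> c]) (auto intro!: far S(1)[unfolded K_def] simp: good_def K_def)
  have "(\<integral>\<^sup>+i. m 0 i * S i \<partial>count_space UNIV) \<le> (\<integral>\<^sup>+i. V L 0 i \<partial>count_space UNIV)"
  proof (intro nn_integral_mono)
    fix i
    show "m 0 i * S i \<le> V L 0 i"
    proof (cases "good i")
      case False
      then have "min (measure \<mu> (K 0 i)) (measure \<nu> (K 0 i)) = 0"
        using measure_nonneg[of \<mu> "K 0 i"] measure_nonneg[of \<nu> "K 0 i"] unfolding good_def by linarith
      then have "m 0 i = 0" by (simp add: m_def K_def)
      then show ?thesis by simp
    qed (rule S(2))
  qed
  then have "(\<integral>\<^sup>+i. m 0 i * S i \<partial>count_space UNIV) + (\<integral>\<^sup>+i. w 0 i * \<Delta> 0 i \<partial>count_space UNIV)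
    \<le> (\<integral>\<^sup>+i. V L 0 i \<partial>count_space UNIV) + (\<integral>\<^sup>+i. w 0 i * \<Delta> 0 i \<partial>count_space UNIV)"
    by (rule add_right_mono)
  from transport_le_mono[OF tr this] show ?thesis unfolding tot by (simp add: ac_simps)
qed

section \<open>Dyadic cells and the transport bound\<close>

definition shell :: "'a::euclidean_space \<Rightarrow> nat" where
  "shell x = (LEAST n. norm x < 2 ^ n)"

definition basis_list :: "'a::euclidean_space list" where
  "basis_list = (SOME bs. set bs = Basis \<and> distinct bs)"

text \<open>The cell of \<open>x\<close> at level \<open>l\<close>: its shell \<open>n\<close> and the integer coordinates of the dyadic cube that contains
\<open>x\<close> after the shell has been mapped affinely into the open unit cube. At level \<open>0\<close> the cell is the whole shell.
A list of integers is used for the coordinates so that the indices form a countable type.\<close>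

definition dyadic :: "nat \<Rightarrow> 'a::euclidean_space \<Rightarrow> nat \<times> int list" where
  "dyadic l x = (shell x, map (\<lambda>b. \<lfloor>2 ^ l * ((x \<bullet> b) / 2 ^ Suc (shell x) + 1 / 2)\<rfloor>) basis_list)"

lemma basis_list: "set (basis_list :: 'a::euclidean_space list) = Basis" "distinct (basis_list :: 'a list)"
proof -
  obtain bs :: "'a list" where "set bs = Basis \<and> distinct bs"
    using finite_distinct_list[OF finite_Basis] by metis
  then have "set (basis_list :: 'a list) = Basis \<and> distinct (basis_list :: 'a list)"
    unfolding basis_list_def by (rule someI)
  then show "set (basis_list :: 'a list) = Basis" "distinct (basis_list :: 'a list)" by auto
qed

lemma length_basis_list: "length (basis_list :: 'a::euclidean_space list) = DIM('a)"
  using distinct_card[of "basis_list :: 'a list"] by (simp add: basis_list)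

lemma norm_less_shell: "norm x < 2 ^ shell x"
proof -
  have "\<exists>n. norm x < 2 ^ n" by (rule real_arch_pow) simp
  then show ?thesis unfolding shell_def by (rule LeastI_ex)
qed

lemma shell_le_norm: "0 < shell x \<Longrightarrow> 2 ^ (shell x - 1) \<le> norm x"
  using not_less_Least[of "shell x - 1" "\<lambda>n. norm x < 2 ^ n"] unfolding shell_def[symmetric] by force

lemma coordinate_in_unit:
  assumes "b \<in> Basis"
  shows "0 < (x \<bullet> b) / 2 ^ Suc (shell x) + 1 / 2" "(x \<bullet> b) / 2 ^ Suc (shell x) + 1 / 2 < 1"
proof -
  have "\<bar>x \<bullet> b\<bar> < 2 ^ shell x" using Basis_le_norm[OF assms, of x] norm_less_shell[of x] by linarith
  then have "\<bar>x \<bullet> b\<bar> / 2 ^ Suc (shell x) < 1 / 2" by (simp add: divide_simps)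
  then have "\<bar>(x \<bullet> b) / 2 ^ Suc (shell x)\<bar> < 1 / 2" by simp
  then show "0 < (x \<bullet> b) / 2 ^ Suc (shell x) + 1 / 2" "(x \<bullet> b) / 2 ^ Suc (shell x) + 1 / 2 < 1"
    unfolding abs_less_iff by linarith+
qed

text \<open>Halving a real number halves its integer part, so the cubes of level \<open>Suc l\<close> refine those of level \<open>l\<close>.\<close>

lemma dyadic_refine:
  fixes x y :: "'a::euclidean_space"
  assumes "dyadic (Suc l) x = dyadic (Suc l) y" shows "dyadic l x = dyadic l y"
proof -
  have half: "\<lfloor>2 ^ l * u\<rfloor> = \<lfloor>2 ^ Suc l * u\<rfloor> div 2" for u :: real
    using floor_divide_real_eq_div[of 2 "2 ^ Suc l * u"] by simp
  show ?thesis using assms unfolding dyadic_def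
    by (auto simp: half map_eq_conv simp del: power_Suc)
qed

lemma measurable_map_list:
  assumes f: "\<And>b. b \<in> set bs \<Longrightarrow> f b \<in> M \<rightarrow>\<^sub>M count_space UNIV"
  shows "(\<lambda>x. map (\<lambda>b. f b x :: int) bs) \<in> M \<rightarrow>\<^sub>M count_space UNIV"
  using f
proof (induction bs)
  case (Cons b bs)
  have "f b \<in> M \<rightarrow>\<^sub>M count_space UNIV" using Cons by auto
  moreover have "(\<lambda>x. map (\<lambda>b. f b x) bs) \<in> M \<rightarrow>\<^sub>M count_space UNIV" using Cons by auto
  from this have "(\<lambda>x. i # map (\<lambda>b. f b x) bs) \<in> M \<rightarrow>\<^sub>M count_space UNIV" for i
    by (rule measurable_compose) simp
  ultimately have "(\<lambda>x. f b x # map (\<lambda>b. f b x) bs) \<in> M \<rightarrow>\<^sub>M count_space UNIV"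
    by (intro measurable_compose_countable[where f="\<lambda>i x. i # map (\<lambda>b. f b x) bs" and g="f b"])
  then show ?case by simp
qed simp

lemma measurable_shell[measurable]: "shell \<in> borel \<rightarrow>\<^sub>M count_space UNIV"
  unfolding shell_def by measurable

lemma measurable_dyadic[measurable]: "(dyadic l :: 'a::euclidean_space \<Rightarrow> _) \<in> borel \<rightarrow>\<^sub>M count_space UNIV"
proof -
  have "(\<lambda>x::'a. (\<lambda>n x. (n, map (\<lambda>b. \<lfloor>2 ^ l * ((x \<bullet> b) / 2 ^ Suc n + 1 / 2)\<rfloor>) basis_list)) (shell x) x)
      \<in> borel \<rightarrow>\<^sub>M count_space UNIV"
  proof (rule measurable_compose_countable[where g=shell and
      f="\<lambda>n x. (n, map (\<lambda>b. \<lfloor>2 ^ l * ((x \<bullet> b) / 2 ^ Suc n + 1 / 2)\<rfloor>) basis_list)"])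
    fix n :: nat
    have "(\<lambda>x::'a. map (\<lambda>b. \<lfloor>2 ^ l * ((x \<bullet> b) / 2 ^ Suc n + 1 / 2)\<rfloor>) basis_list) \<in> borel \<rightarrow>\<^sub>M count_space UNIV"
      by (rule measurable_map_list) measurable
    then show "(\<lambda>x::'a. (n, map (\<lambda>b. \<lfloor>2 ^ l * ((x \<bullet> b) / 2 ^ Suc n + 1 / 2)\<rfloor>) basis_list)) \<in> borel \<rightarrow>\<^sub>M count_space UNIV"
      by (rule measurable_compose) simp
  qed measurable
  then show ?thesis unfolding dyadic_def .
qed

lemma dyadic_range:
  "snd (dyadic l (x::'a::euclidean_space)) \<in> {is. set is \<subseteq> {0..<2 ^ l} \<and> length is = DIM('a)}"
proof -
  have "0 \<le> \<lfloor>2 ^ l * ((x \<bullet> b) / 2 ^ Suc (shell x) + 1 / 2)\<rfloor> \<and>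
    \<lfloor>2 ^ l * ((x \<bullet> b) / 2 ^ Suc (shell x) + 1 / 2)\<rfloor> < 2 ^ l" if b: "b \<in> Basis" for b
  proof -
    let ?u = "(x \<bullet> b) / 2 ^ Suc (shell x) + 1 / 2"
    have "0 \<le> 2 ^ l * ?u" "2 ^ l * ?u < 2 ^ l * 1"
      using coordinate_in_unit[OF b, of x] by (intro mult_nonneg_nonneg mult_strict_left_mono; simp)+
    then show ?thesis by (simp add: floor_less_iff del: power_Suc)
  qed
  then show ?thesis by (auto simp: dyadic_def length_basis_list basis_list simp del: power_Suc)
qed

lemma card_dyadic_range:
  "finite {is :: int list. set is \<subseteq> {0..<2 ^ l} \<and> length is = d}"
  "card {is :: int list. set is \<subseteq> {0..<2 ^ l} \<and> length is = d} = (2 ^ l) ^ d"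
proof -
  have "card {0..<2 ^ l :: int} = 2 ^ l" by (simp add: nat_power_eq)
  then show "card {is :: int list. set is \<subseteq> {0..<2 ^ l} \<and> length is = d} = (2 ^ l) ^ d"
    by (simp only: card_lists_length_eq finite_atLeastLessThan_int)
qed (simp add: finite_lists_length_eq)

lemma dyadic_diameter:
  fixes x y :: "'a::euclidean_space"
  assumes "dyadic l x = dyadic l y"
  shows "norm (x - y) \<le> 2 * DIM('a) * 2 ^ shell x / 2 ^ l"
proof -
  have s: "shell y = shell x" using assms by (simp add: dyadic_def)
  have "\<bar>(x - y) \<bullet> b\<bar> \<le> 2 * 2 ^ shell x / 2 ^ l" if b: "b \<in> Basis" for b
  proof -
    let ?f = "\<lambda>x. 2 ^ l * ((x \<bullet> b) / 2 ^ Suc (shell x) + 1 / 2)"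
    have "\<lfloor>?f x\<rfloor> = \<lfloor>?f y\<rfloor>"
      using assms b unfolding dyadic_def by (auto simp: basis_list simp del: power_Suc)
    then have "\<bar>?f x - ?f y\<bar> < 1" by linarith
    also have "?f x - ?f y = 2 ^ l / 2 ^ Suc (shell x) * ((x - y) \<bullet> b)"
      by (simp add: s inner_diff_left field_simps)
    finally have "2 ^ l / 2 ^ Suc (shell x) * \<bar>(x - y) \<bullet> b\<bar> < 1" by (simp add: abs_mult)
    then show ?thesis by (simp add: field_simps)
  qed
  then have "(\<Sum>b\<in>Basis. \<bar>(x - y) \<bullet> b\<bar>) \<le> of_nat DIM('a) * (2 * 2 ^ shell x / 2 ^ l)"
    by (rule sum_bounded_above)
  also have "\<dots> = 2 * DIM('a) * 2 ^ shell x / 2 ^ l" by simp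
  finally show ?thesis using norm_le_l1[of "x - y"] by (rule order_trans[rotated])
qed

text \<open>An upper bound for the \<open>p\<close>-th power of the diameter of a cell of level \<open>l\<close> in shell \<open>n\<close>, in dimension \<open>d\<close>.\<close>

definition dyadic_cost :: "real \<Rightarrow> real \<Rightarrow> nat \<Rightarrow> nat \<Rightarrow> real" where
  "dyadic_cost d p l n = (2 * d * 2 ^ n / 2 ^ l) powr p"

lemma dyadic_cost_Suc:
  assumes "0 \<le> d" shows "dyadic_cost d p l n = 2 powr p * dyadic_cost d p (Suc l) n"
proof -
  have "2 * d * 2 ^ n / 2 ^ l = 2 * (2 * d * 2 ^ n / 2 ^ Suc l)" by simp
  then have "dyadic_cost d p l n = (2 * (2 * d * 2 ^ n / 2 ^ Suc l)) powr p"
    unfolding dyadic_cost_def by (rule arg_cong)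
  also have "\<dots> = 2 powr p * dyadic_cost d p (Suc l) n"
    unfolding dyadic_cost_def by (rule powr_mult)
  finally show ?thesis .
qed

lemma dyadic_cost_level:
  assumes "0 \<le> d" shows "dyadic_cost d p l n = (1 / 2 powr p) ^ l * dyadic_cost d p 0 n"
proof (induction l)
  case (Suc l)
  have "dyadic_cost d p (Suc l) n = (1 / 2 powr p) * dyadic_cost d p l n"
    using dyadic_cost_Suc[OF assms, of p l n] by simp
  then show ?case using Suc by simp
qed simp

text \<open>Instance of \<open>multiscale_coupling\<close> for dyadic cells. The mass that stays together through \<open>L\<close> levels costs
at most \<open>2 powr (- p * L)\<close> times a constant that involves the \<open>p\<close>-th moment of \<open>\<nu>\<close>, and disappears as \<open>L\<close> grows. Shifting the level of the cost
by one against the level of the discrepancy produces the factor \<open>2 powr p\<close>.\<close>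

lemma wasserstein_dyadic_bound:
  fixes \<mu> \<nu> :: "'a::euclidean_space measure"
  assumes \<mu>: "\<mu> \<in> space (prob_algebra borel)" and \<nu>: "\<nu> \<in> space (prob_algebra borel)"
    and p: "0 < p" and mom: "moment p \<nu> < \<infinity>"
  defines "d \<equiv> real DIM('a)"
  shows "ennpowr (wasserstein p \<mu> \<nu>) p
    \<le> ennreal (2 * 2 powr p) * (\<Sum>l. \<integral>\<^sup>+i. ennreal (dyadic_cost d p l (fst i)) *
        ennreal \<bar>measure \<mu> (dyadic l -` {i}) - measure \<nu> (dyadic l -` {i})\<bar> \<partial>count_space UNIV)"
proof -
  have d: "1 \<le> d" unfolding d_def using DIM_positive[where 'a='a] by linarith
  define w where "w l i = ennreal (dyadic_cost d p l (fst i))" for l and i :: "nat \<times> int list"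
  define c where "c = (\<lambda>(x, y). ennreal (norm (x - y :: 'a) powr p))"
  define \<Delta> where "\<Delta> l i = ennreal \<bar>measure \<mu> (dyadic l -` {i}) - measure \<nu> (dyadic l -` {i})\<bar>" for l i
  define A where "A = (\<Sum>l. \<integral>\<^sup>+i. w l i * \<Delta> l i \<partial>count_space UNIV)"
  define F where "F = (\<integral>\<^sup>+x. ennreal (dyadic_cost d p 0 (shell x)) \<partial>\<nu>)"
  interpret \<nu>: prob_space \<nu> using \<nu> by (simp add: space_prob_algebra)
  have S[measurable_cong, simp]: "sets \<nu> = sets borel" using \<nu> by (simp add: space_prob_algebra)
  have cm: "c \<in> borel_measurable (borel \<Otimes>\<^sub>M borel)" unfolding c_def by measurable
  have wS: "w l i = ennreal (2 powr p) * w (Suc l) i" for l i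
    unfolding w_def using d by (subst dyadic_cost_Suc) (auto simp: ennreal_mult[symmetric] dyadic_cost_def)
  have bound: "ennpowr (wasserstein p \<mu> \<nu>) p \<le> ennreal (2 * 2 powr p) * A + ennreal ((1 / 2 powr p) ^ L) * F" for L
  proof -
    have "transport_le c \<mu> \<nu>
      ((\<integral>\<^sup>+i. w 0 i * \<Delta> 0 i \<partial>count_space UNIV)
     + (\<Sum>k<L. 2 * (\<integral>\<^sup>+i. w k i * \<Delta> (Suc k) i \<partial>count_space UNIV))
     + (\<integral>\<^sup>+i. w L i * ennreal (min (measure \<mu> (dyadic L -` {i})) (measure \<nu> (dyadic L -` {i}))) \<partial>count_space UNIV))"
      unfolding \<Delta>_def
    proof (rule multiscale_coupling[OF \<mu> \<nu> _ _ cm])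
      fix l and x y :: 'a assume e: "dyadic l x = dyadic l y"
      have "norm (x - y) powr p \<le> (2 * d * 2 ^ shell x / 2 ^ l) powr p"
        using dyadic_diameter[OF e] p by (intro powr_mono2) (auto simp: d_def)
      then show "c (x, y) \<le> w l (dyadic l x)"
        by (simp add: c_def w_def dyadic_cost_def dyadic_def ennreal_leI)
    next
      fix x y :: 'a
      have far: "norm (x - y) powr p \<le> (2 * d * 2 ^ n) powr p" if "norm x \<le> 2 ^ n" "norm y \<le> 2 ^ n" for n
      proof -
        have "norm (x - y) \<le> 2 * 2 ^ n" using norm_triangle_ineq4[of x y] that by linarith
        also have "\<dots> \<le> 2 * d * 2 ^ n" using d by (intro mult_right_mono) auto
        finally show ?thesis using p by (intro powr_mono2) auto
      qed
      show "c (x, y) \<le> w 0 (dyadic 0 x) + w 0 (dyadic 0 y)"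
      proof (cases "shell x \<le> shell y")
        case True
        then have "(2::real) ^ shell x \<le> 2 ^ shell y" by simp
        then have "c (x, y) \<le> w 0 (dyadic 0 y)"
          using far[of "shell y", OF less_imp_le less_imp_le, OF less_le_trans[OF norm_less_shell] less_le_trans[OF norm_less_shell]]
          by (simp add: c_def w_def dyadic_cost_def dyadic_def ennreal_leI)
        then show ?thesis by (simp add: add_increasing)
      next
        case False
        then have "(2::real) ^ shell y \<le> 2 ^ shell x" by simp
        then have "c (x, y) \<le> w 0 (dyadic 0 x)"
          using far[of "shell x", OF less_imp_le less_imp_le, OF less_le_trans[OF norm_less_shell] less_le_trans[OF norm_less_shell]]
          by (simp add: c_def w_def dyadic_cost_def dyadic_def ennreal_leI)
        then show ?thesis by (simp add: add_increasing2)
      qed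
    next
      show "dyadic l \<in> borel \<rightarrow>\<^sub>M count_space UNIV" for l :: nat by (rule measurable_dyadic)
      show "dyadic l x = dyadic l y" if "dyadic (Suc l) x = dyadic (Suc l) y" for l and x y :: 'a
        using that by (rule dyadic_refine)
      show "w l (dyadic (Suc l) x) = w l (dyadic l x)" for l x
        unfolding w_def dyadic_def by simp
    qed
    then have "ennpowr (wasserstein p \<mu> \<nu>) p \<le> (\<integral>\<^sup>+i. w 0 i * \<Delta> 0 i \<partial>count_space UNIV)
     + (\<Sum>k<L. 2 * (\<integral>\<^sup>+i. w k i * \<Delta> (Suc k) i \<partial>count_space UNIV))
     + (\<integral>\<^sup>+i. w L i * ennreal (min (measure \<mu> (dyadic L -` {i})) (measure \<nu> (dyadic L -` {i}))) \<partial>count_space UNIV)"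
      unfolding c_def by (rule wasserstein_power_le[OF p])
    also have "(\<integral>\<^sup>+i. w 0 i * \<Delta> 0 i \<partial>count_space UNIV) + (\<Sum>k<L. 2 * (\<integral>\<^sup>+i. w k i * \<Delta> (Suc k) i \<partial>count_space UNIV))
      \<le> ennreal (2 * 2 powr p) * A"
    proof -
      have 1: "(1::ennreal) \<le> ennreal (2 * 2 powr p)"
        using p ge_one_powr_ge_zero[of 2 p] by (simp add: ennreal_le_iff flip: ennreal_1)
      have "2 * (\<integral>\<^sup>+i. w k i * \<Delta> (Suc k) i \<partial>count_space UNIV)
          = ennreal (2 * 2 powr p) * (\<integral>\<^sup>+i. w (Suc k) i * \<Delta> (Suc k) i \<partial>count_space UNIV)" for k
        unfolding wS[of k] by (simp add: mult.assoc nn_integral_cmult ennreal_mult)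
      then have "(\<integral>\<^sup>+i. w 0 i * \<Delta> 0 i \<partial>count_space UNIV) + (\<Sum>k<L. 2 * (\<integral>\<^sup>+i. w k i * \<Delta> (Suc k) i \<partial>count_space UNIV))
        \<le> ennreal (2 * 2 powr p) * (\<integral>\<^sup>+i. w 0 i * \<Delta> 0 i \<partial>count_space UNIV)
          + (\<Sum>k<L. ennreal (2 * 2 powr p) * (\<integral>\<^sup>+i. w (Suc k) i * \<Delta> (Suc k) i \<partial>count_space UNIV))"
        using mult_right_mono[OF 1] by (intro add_mono) auto
      also have "\<dots> = ennreal (2 * 2 powr p) * (\<Sum>k<Suc L. \<integral>\<^sup>+i. w k i * \<Delta> k i \<partial>count_space UNIV)"
        by (simp add: sum.lessThan_Suc_shift sum_distrib_left distrib_left del: sum.lessThan_Suc)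
      also have "\<dots> \<le> ennreal (2 * 2 powr p) * A"
        unfolding A_def by (intro mult_left_mono sum_le_suminf) auto
      finally show ?thesis .
    qed
    also have "(\<integral>\<^sup>+i. w L i * ennreal (min (measure \<mu> (dyadic L -` {i})) (measure \<nu> (dyadic L -` {i}))) \<partial>count_space UNIV)
      \<le> (\<integral>\<^sup>+i. w L i * ennreal (measure \<nu> (dyadic L -` {i})) \<partial>count_space UNIV)"
      by (intro nn_integral_mono mult_left_mono ennreal_leI) auto
    also have "\<dots> = (\<integral>\<^sup>+i. \<integral>\<^sup>+x. w L i * indicator (dyadic L -` {i}) x \<partial>\<nu> \<partial>count_space UNIV)"
      by (intro nn_integral_cong) (simp add: nn_integral_cmult \<nu>.emeasure_eq_measure)
    also have "\<dots> = (\<integral>\<^sup>+x. \<integral>\<^sup>+i. w L i * indicator (dyadic L -` {i}) x \<partial>count_space UNIV \<partial>\<nu>)"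
      by (rule nn_integral_count_space_nn_integral[symmetric]) auto
    also have "\<dots> = (\<integral>\<^sup>+x. w L (dyadic L x) \<partial>\<nu>)"
    proof (intro nn_integral_cong)
      fix x
      have "(\<integral>\<^sup>+i. w L i * indicator (dyadic L -` {i}) x \<partial>count_space UNIV)
        = (\<integral>\<^sup>+i. w L i * indicator {dyadic L x} i \<partial>count_space UNIV)"
        by (intro nn_integral_cong) (auto split: split_indicator)
      then show "(\<integral>\<^sup>+i. w L i * indicator (dyadic L -` {i}) x \<partial>count_space UNIV) = w L (dyadic L x)"
        by (simp add: nn_integral_indicator_singleton)
    qed
    also have "\<dots> = (\<integral>\<^sup>+x. ennreal ((1 / 2 powr p) ^ L) * ennreal (dyadic_cost d p 0 (shell x)) \<partial>\<nu>)"
    proof (intro nn_integral_cong)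
      fix x :: 'a
      show "w L (dyadic L x) = ennreal ((1 / 2 powr p) ^ L) * ennreal (dyadic_cost d p 0 (shell x))"
        unfolding w_def dyadic_def fst_conv
        using d by (subst dyadic_cost_level) (auto simp: ennreal_mult dyadic_cost_def)
    qed
    also have "\<dots> = ennreal ((1 / 2 powr p) ^ L) * F"
      unfolding F_def by (rule nn_integral_cmult) measurable
    finally show ?thesis by (simp add: add_mono)
  qed
  have "F < \<infinity>"
  proof -
    have "F \<le> (\<integral>\<^sup>+x. ennreal ((2 * d) powr p) + ennreal ((4 * d) powr p) * ennreal (norm x powr p) \<partial>\<nu>)"
      unfolding F_def
    proof (intro nn_integral_mono)
      fix x :: 'a
      have "(2 * d * 2 ^ shell x) powr p \<le> (2 * d) powr p + (4 * d) powr p * norm x powr p"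
      proof (cases "shell x = 0")
        case False
        have "(2::real) ^ shell x = 2 * 2 ^ (shell x - 1)" using False by (simp add: power_eq_if)
        also have "\<dots> \<le> 2 * norm x" using shell_le_norm[of x] False by simp
        finally have "2 * d * 2 ^ shell x \<le> 4 * d * norm x" using d by (simp add: mult_ac)
        then have "(2 * d * 2 ^ shell x) powr p \<le> (4 * d * norm x) powr p"
          using p d by (intro powr_mono2) auto
        also have "\<dots> = (4 * d) powr p * norm x powr p" using d by (simp add: powr_mult)
        finally show ?thesis by (simp add: add_increasing)
      qed auto
      then show "ennreal (dyadic_cost d p 0 (shell x)) \<le> ennreal ((2 * d) powr p) + ennreal ((4 * d) powr p) * ennreal (norm x powr p)"
        by (simp add: dyadic_cost_def ennreal_plus[symmetric] ennreal_mult[symmetric] ennreal_leI del: ennreal_plus)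
    qed
    also have "\<dots> = ennreal ((2 * d) powr p) + ennreal ((4 * d) powr p) * moment p \<nu>"
      by (simp add: nn_integral_add nn_integral_cmult moment_def \<nu>.emeasure_space_1)
    also have "\<dots> < \<infinity>" using mom by (simp add: ennreal_mult_less_top)
    finally show ?thesis .
  qed
  then obtain f where f: "F = ennreal f" "0 \<le> f" using less_top_ennreal[of F] by auto
  have "(\<lambda>L. (1 / 2 powr p) ^ L * f) \<longlonglongrightarrow> 0 * f"
    using p by (intro tendsto_mult LIMSEQ_power_zero tendsto_const) auto
  then have "(\<lambda>L. ennreal ((1 / 2 powr p) ^ L * f)) \<longlonglongrightarrow> ennreal (0 * f)"
    by (rule tendsto_ennrealI)
  then have "(\<lambda>L. ennreal (2 * 2 powr p) * A + ennreal ((1 / 2 powr p) ^ L) * F) \<longlonglongrightarrow> ennreal (2 * 2 powr p) * A + 0"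
    using f by (intro tendsto_add tendsto_const) (simp add: ennreal_mult[symmetric])
  then have "ennpowr (wasserstein p \<mu> \<nu>) p \<le> ennreal (2 * 2 powr p) * A + 0"
    by (rule LIMSEQ_le_const) (use bound in auto)
  then show ?thesis by (simp add: A_def w_def \<Delta>_def)
qed

section \<open>Size of the double series over shells and scales\<close>

lemma powr_neg_less_one: "0 < w \<Longrightarrow> 2 powr (- w) < (1::real)"
  using powr_less_mono[of "-w" 0 "2::real"] by simp

lemma powr_collect:
  "0 < \<tau> \<Longrightarrow> (2 powr a) powr c * (\<tau> * 2 powr b) powr e = \<tau> powr e * (2::real) powr (a * c + b * e)"
  by (simp only: powr_mult powr_powr powr_add ac_simps)

lemma suminf_powr_geometric:
  assumes w: "0 < (w::real)"
  shows "(\<Sum>n. ennreal (2 powr (- w * real n))) = ennreal (1 / (1 - 2 powr (- w)))"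
proof -
  have e: "2 powr (- w * real n) = (2 powr (- w)) ^ n" for n
  proof -
    have "2 powr (- w * real n) = (2 powr (- w)) powr real n" by (simp add: powr_powr)
    then show ?thesis by (simp add: powr_realpow)
  qed
  have "(\<lambda>n. (2 powr (- w)) ^ n) sums (1 / (1 - 2 powr (- w)))"
    using powr_neg_less_one[OF w] by (intro geometric_sums) simp
  then show ?thesis unfolding e by (intro suminf_ennreal_eq) auto
qed

lemma suminf_peak_le:
  assumes w: "0 < (w::real)"
  shows "(\<Sum>n. ennreal (2 powr (- w * \<bar>real n - x\<bar>))) \<le> ennreal (2 / (1 - 2 powr (- w)))"
proof -
  define N where "N = nat \<lceil>max x 0\<rceil>"
  have N: "x \<le> real N" "\<And>n. n < N \<Longrightarrow> real n + 1 \<le> real N \<and> real N < x + 1"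
    unfolding N_def by linarith+
  have "(\<Sum>n<N. ennreal (2 powr (- w * \<bar>real n - x\<bar>))) \<le> (\<Sum>n<N. ennreal (2 powr (- w * real (N - Suc n))))"
  proof (intro sum_mono ennreal_leI powr_mono)
    fix n assume "n \<in> {..<N}"
    then have "real (N - Suc n) \<le> \<bar>real n - x\<bar>" using N(2)[of n] by (simp add: of_nat_diff)
    then show "- w * \<bar>real n - x\<bar> \<le> - w * real (N - Suc n)" using w by simp
  qed simp
  also have "\<dots> = (\<Sum>n<N. ennreal (2 powr (- w * real n)))"
    by (rule sum.nat_diff_reindex)
  also have "\<dots> \<le> (\<Sum>n. ennreal (2 powr (- w * real n)))" by (intro sum_le_suminf) auto
  finally have left: "(\<Sum>n<N. ennreal (2 powr (- w * \<bar>real n - x\<bar>))) \<le> (\<Sum>n. ennreal (2 powr (- w * real n)))" .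
  have right: "(\<Sum>n. ennreal (2 powr (- w * \<bar>real (n + N) - x\<bar>))) \<le> (\<Sum>n. ennreal (2 powr (- w * real n)))"
  proof (intro suminf_le ennreal_leI powr_mono)
    fix n show "- w * \<bar>real (n + N) - x\<bar> \<le> - w * real n" using w N(1) by simp
  qed auto
  have "(\<Sum>n. ennreal (2 powr (- w * \<bar>real n - x\<bar>)))
      = (\<Sum>n. ennreal (2 powr (- w * \<bar>real (n + N) - x\<bar>))) + (\<Sum>n<N. ennreal (2 powr (- w * \<bar>real n - x\<bar>)))"
    by (rule suminf_offset) simp
  also have "\<dots> \<le> ennreal (1 / (1 - 2 powr (- w))) + ennreal (1 / (1 - 2 powr (- w)))"
    using add_mono[OF right left] unfolding suminf_powr_geometric[OF w] .
  also have "\<dots> = ennreal (1 / (1 - 2 powr (- w)) + 1 / (1 - 2 powr (- w)))"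
    using powr_neg_less_one[OF w] by (intro ennreal_plus[symmetric]) auto
  finally show ?thesis by simp
qed

text \<open>The minimum of a decreasing and an increasing geometric sequence is largest where they cross, at
the real number \<open>x\<close>, and decays geometrically on both sides; so its sum is of the order of the value \<open>Y\<close> at the
crossing.\<close>

lemma suminf_crossing_le:
  fixes u v A B :: real
  assumes u: "0 < u" and v: "0 < v" and A: "0 < A" and B: "0 < B"
  shows "(\<Sum>n. ennreal (min (A * 2 powr (- v * real n)) (B * 2 powr (u * real n))))
    \<le> ennreal (2 / (1 - 2 powr (- min u v)) * (A powr (u / (u + v)) * B powr (v / (u + v))))"
proof -
  define x where "x = log 2 (A / B) / (u + v)"
  define Y where "Y = A powr (u / (u + v)) * B powr (v / (u + v))"
  define w where "w = min u v"
  have w: "0 < w" using u v by (simp add: w_def)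
  have uv: "u / (u + v) + v / (u + v) = 1" using u v by (simp add: add_divide_distrib[symmetric])
  have "log 2 Y = u / (u + v) * log 2 A + v / (u + v) * log 2 B"
    unfolding Y_def using A B by (simp add: log_mult log_powr)
  then have l: "log 2 Y = (u * log 2 A + v * log 2 B) / (u + v)" by (simp add: add_divide_distrib)
  have Y: "0 < Y" using A B by (simp add: Y_def)
  have xl: "x = (log 2 A - log 2 B) / (u + v)" unfolding x_def using A B by (simp add: log_divide)
  have 1: "A * 2 powr (- v * x) = Y"
  proof -
    have "log 2 A - v * x = log 2 Y" unfolding xl l using u v by (simp add: field_simps)
    then have "2 powr (log 2 A + (- v * x)) = 2 powr (log 2 Y)" by simp
    then show ?thesis unfolding powr_add using A Y by simp
  qed
  have 2: "B * 2 powr (u * x) = Y"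
  proof -
    have "log 2 B + u * x = log 2 Y" unfolding xl l using u v by (simp add: field_simps)
    then have "2 powr (log 2 B + u * x) = 2 powr (log 2 Y)" by simp
    then show ?thesis unfolding powr_add using B Y by simp
  qed
  have "min (A * 2 powr (- v * real n)) (B * 2 powr (u * real n)) \<le> Y * 2 powr (- w * \<bar>real n - x\<bar>)" for n
  proof (cases "x \<le> real n")
    case True
    have "A * 2 powr (- v * real n) = Y * 2 powr (- v * (real n - x))"
      unfolding 1[symmetric] by (simp add: mult.assoc powr_add[symmetric] algebra_simps)
    also have "\<dots> \<le> Y * 2 powr (- w * \<bar>real n - x\<bar>)"
      using True Y by (intro mult_left_mono powr_mono) (auto simp: w_def intro!: mult_right_mono)
    finally show ?thesis by linarith
  next
    case False
    have "B * 2 powr (u * real n) = Y * 2 powr (- u * (x - real n))"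
      unfolding 2[symmetric] by (simp add: mult.assoc powr_add[symmetric] algebra_simps)
    also have "\<dots> \<le> Y * 2 powr (- w * \<bar>real n - x\<bar>)"
    proof -
      have "w * (x - real n) \<le> u * (x - real n)" using False by (intro mult_right_mono) (auto simp: w_def)
      then show ?thesis using False Y by (intro mult_left_mono powr_mono) auto
    qed
    finally show ?thesis by linarith
  qed
  then have "(\<Sum>n. ennreal (min (A * 2 powr (- v * real n)) (B * 2 powr (u * real n))))
      \<le> (\<Sum>n. ennreal Y * ennreal (2 powr (- w * \<bar>real n - x\<bar>)))"
    using Y by (intro suminf_le) (auto simp: ennreal_mult[symmetric] intro!: ennreal_leI)
  also have "\<dots> = ennreal Y * (\<Sum>n. ennreal (2 powr (- w * \<bar>real n - x\<bar>)))"
    by simp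
  also have "\<dots> \<le> ennreal Y * ennreal (2 / (1 - 2 powr (- w)))"
    by (intro mult_left_mono suminf_peak_le w) auto
  also have "\<dots> = ennreal (2 / (1 - 2 powr (- w)) * Y)"
    using Y powr_neg_less_one[OF w] by (simp add: ennreal_mult[symmetric] mult.commute)
  finally show ?thesis by (simp add: Y_def w_def)
qed

lemma suminf_swap_ennreal: "(\<Sum>n. \<Sum>l. f n l :: ennreal) = (\<Sum>l. \<Sum>n. f n l)" 
  unfolding nn_integral_count_space_nat[symmetric]
  by (rule nn_integral_count_space_nn_integral) auto

text \<open>Contribution of shell \<open>n\<close> and scale \<open>l\<close> to the expected transport cost: the trivial bound against the variance
bound.\<close>

definition scale_term :: "real \<Rightarrow> real \<Rightarrow> real \<Rightarrow> real \<Rightarrow> real \<Rightarrow> nat \<Rightarrow> nat \<Rightarrow> real" where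
  "scale_term p q b D \<tau> n l = min (2 powr (- (q - p) * n - p * l)) (\<tau> * 2 powr ((p - b) * n + (D - p) * l))"

text \<open>For fixed \<open>l\<close> the two bounds cross in \<open>n\<close>. The value at the crossing decays in \<open>l\<close> by the last assumption, so
summing over shells first avoids any logarithm, also for \<open>p = D\<close>.\<close>

lemma scale_series_balanced:
  fixes p q b D :: real
  assumes "p < q" "b < p" "D * (q - p) < p * (q - b)"
  obtains K where "0 < K" "\<And>\<tau>. 0 < \<tau> \<Longrightarrow>
    (\<Sum>n. \<Sum>l. ennreal (scale_term p q b D \<tau> n l)) \<le> ennreal (K * \<tau> powr ((q - p) / (q - b)))"
proof -
  define u where "u = p - b"
  define v where "v = q - p"
  define k where "k = (p * u - (D - p) * v) / (u + v)"
  define C where "C = 2 / (1 - 2 powr (- min u v))"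
  have u: "0 < u" "0 < v" and uv: "u + v = q - b" using assms by (auto simp: u_def v_def)
  have k: "0 < k" unfolding k_def using u assms by (intro divide_pos_pos) (auto simp: u_def v_def algebra_simps)
  have C: "0 < C" unfolding C_def using powr_neg_less_one[of "min u v"] u by auto
  have "(\<Sum>n. \<Sum>l. ennreal (scale_term p q b D \<tau> n l)) \<le> ennreal (C * (1 / (1 - 2 powr (- k))) * \<tau> powr (v / (u + v)))"
    if \<tau>: "0 < \<tau>" for \<tau>
  proof -
    have "(\<Sum>n. ennreal (scale_term p q b D \<tau> n l))
        \<le> ennreal (C * \<tau> powr (v / (u + v))) * ennreal (2 powr (- k * real l))" for l
    proof -
      have "(\<Sum>n. ennreal (scale_term p q b D \<tau> n l))
        = (\<Sum>n. ennreal (min (2 powr (- p * l) * 2 powr (- v * real n)) ((\<tau> * 2 powr ((D - p) * l)) * 2 powr (u * real n))))"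
        by (simp add: scale_term_def u_def v_def powr_add[symmetric] mult.assoc algebra_simps)
      also have "\<dots> \<le> ennreal (C * ((2 powr (- p * l)) powr (u / (u + v)) * (\<tau> * 2 powr ((D - p) * l)) powr (v / (u + v))))"
        unfolding C_def using u \<tau> by (intro suminf_crossing_le) auto
      also have "(2 powr (- p * l)) powr (u / (u + v)) * (\<tau> * 2 powr ((D - p) * l)) powr (v / (u + v))
          = \<tau> powr (v / (u + v)) * 2 powr (- k * real l)"
      proof -
        have "- p * l * (u / (u + v)) + (D - p) * l * (v / (u + v)) = - k * l"
          by (simp add: k_def add_divide_distrib diff_divide_distrib algebra_simps)
        then show ?thesis by (simp only: powr_collect[OF \<tau>])
      qed
      finally show ?thesis using C by (simp add: ennreal_mult[symmetric] mult_ac)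
    qed
    then have "(\<Sum>n. \<Sum>l. ennreal (scale_term p q b D \<tau> n l))
        \<le> (\<Sum>l. ennreal (C * \<tau> powr (v / (u + v))) * ennreal (2 powr (- k * real l)))"
      unfolding suminf_swap_ennreal[of "\<lambda>n l. ennreal (scale_term p q b D \<tau> n l)"] by (intro suminf_le) auto
    also have "\<dots> = ennreal (C * \<tau> powr (v / (u + v))) * ennreal (1 / (1 - 2 powr (- k)))"
      unfolding ennreal_suminf_cmult suminf_powr_geometric[OF k] ..
    also have "\<dots> = ennreal (C * (1 / (1 - 2 powr (- k))) * \<tau> powr (v / (u + v)))"
      using C powr_neg_less_one[OF k] by (simp add: ennreal_mult[symmetric] mult_ac)
    finally show ?thesis .
  qed
  moreover have "(q - p) / (q - b) = v / (u + v)" unfolding uv by (simp only: v_def)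
  ultimately show ?thesis using C powr_neg_less_one[OF k]
    by (intro that[of "C * (1 / (1 - 2 powr (- k)))"]) auto
qed

text \<open>For fixed \<open>n\<close> the two bounds cross in \<open>l\<close>, and by the last assumption the value at the crossing decays in \<open>n\<close>.\<close>

lemma scale_series_coarse:
  fixes p q b D :: real
  assumes "0 < p" "p < D" "p * (D + q - b) < D * q"
  obtains K where "0 < K" "\<And>\<tau>. 0 < \<tau> \<Longrightarrow>
    (\<Sum>n. \<Sum>l. ennreal (scale_term p q b D \<tau> n l)) \<le> ennreal (K * \<tau> powr (p / D))"
proof -
  define u where "u = D - p"
  define k where "k = ((q - p) * u - (p - b) * p) / D"
  define C where "C = 2 / (1 - 2 powr (- min u p))"
  have u: "0 < u" "0 < D" and uv: "u + p = D" using assms by (auto simp: u_def)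
  have k: "0 < k" unfolding k_def using u assms by (intro divide_pos_pos) (auto simp: u_def algebra_simps)
  have C: "0 < C" unfolding C_def using powr_neg_less_one[of "min u p"] u assms by auto
  have "(\<Sum>n. \<Sum>l. ennreal (scale_term p q b D \<tau> n l)) \<le> ennreal (C * (1 / (1 - 2 powr (- k))) * \<tau> powr (p / D))"
    if \<tau>: "0 < \<tau>" for \<tau>
  proof -
    have "(\<Sum>l. ennreal (scale_term p q b D \<tau> n l))
        \<le> ennreal (C * \<tau> powr (p / D)) * ennreal (2 powr (- k * real n))" for n
    proof -
      have "(\<Sum>l. ennreal (scale_term p q b D \<tau> n l))
        = (\<Sum>l. ennreal (min (2 powr (- (q - p) * n) * 2 powr (- p * real l)) ((\<tau> * 2 powr ((p - b) * n)) * 2 powr (u * real l))))"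
        by (simp add: scale_term_def u_def powr_add[symmetric] mult.assoc algebra_simps)
      also have "\<dots> \<le> ennreal (C * ((2 powr (- (q - p) * n)) powr (u / (u + p)) * (\<tau> * 2 powr ((p - b) * n)) powr (p / (u + p))))"
        unfolding C_def using u \<tau> assms by (intro suminf_crossing_le) auto
      also have "(2 powr (- (q - p) * n)) powr (u / (u + p)) * (\<tau> * 2 powr ((p - b) * n)) powr (p / (u + p))
          = \<tau> powr (p / D) * 2 powr (- k * real n)"
      proof -
        have "- (q - p) * n * (u / D) + (p - b) * n * (p / D) = - k * n"
          by (simp add: k_def add_divide_distrib diff_divide_distrib algebra_simps)
        then show ?thesis by (simp only: powr_collect[OF \<tau>] uv)
      qed
      finally show ?thesis using C by (simp add: ennreal_mult[symmetric] mult_ac)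
    qed
    then have "(\<Sum>n. \<Sum>l. ennreal (scale_term p q b D \<tau> n l))
        \<le> (\<Sum>n. ennreal (C * \<tau> powr (p / D)) * ennreal (2 powr (- k * real n)))"
      by (intro suminf_le) auto
    also have "\<dots> = ennreal (C * \<tau> powr (p / D)) * ennreal (1 / (1 - 2 powr (- k)))"
      unfolding ennreal_suminf_cmult suminf_powr_geometric[OF k] ..
    also have "\<dots> = ennreal (C * (1 / (1 - 2 powr (- k))) * \<tau> powr (p / D))"
      using C powr_neg_less_one[OF k] by (simp add: ennreal_mult[symmetric] mult_ac)
    finally show ?thesis .
  qed
  then show ?thesis using C powr_neg_less_one[OF k]
    by (intro that[of "C * (1 / (1 - 2 powr (- k)))"]) auto
qed

text \<open>The variance bound alone is summable in both variables.\<close>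

lemma scale_series_fine:
  fixes p q b D :: real
  assumes "D < p" "p < b"
  obtains K where "0 < K" "\<And>\<tau>. 0 < \<tau> \<Longrightarrow>
    (\<Sum>n. \<Sum>l. ennreal (scale_term p q b D \<tau> n l)) \<le> ennreal (K * \<tau>)"
proof -
  define G where "G w = 1 / (1 - 2 powr (- w))" for w :: real
  have G: "0 < G w" if "0 < w" for w using powr_neg_less_one[OF that] by (simp add: G_def)
  have pos: "0 < b - p" "0 < p - D" using assms by auto
  have "(\<Sum>n. \<Sum>l. ennreal (scale_term p q b D \<tau> n l)) \<le> ennreal (G (b - p) * G (p - D) * \<tau>)" if \<tau>: "0 < \<tau>" for \<tau>
  proof -
    have "ennreal (scale_term p q b D \<tau> n l)
        \<le> ennreal \<tau> * ennreal (2 powr (- (b - p) * real n)) * ennreal (2 powr (- (p - D) * real l))" for n l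
    proof -
      have "scale_term p q b D \<tau> n l \<le> \<tau> * 2 powr (- (b - p) * real n) * 2 powr (- (p - D) * real l)"
        unfolding scale_term_def by (rule min.coboundedI2) (simp add: powr_add[symmetric] algebra_simps)
      then show ?thesis using \<tau> by (simp add: ennreal_mult[symmetric] ennreal_leI)
    qed
    then have "(\<Sum>n. \<Sum>l. ennreal (scale_term p q b D \<tau> n l))
        \<le> (\<Sum>n. \<Sum>l. ennreal \<tau> * ennreal (2 powr (- (b - p) * real n)) * ennreal (2 powr (- (p - D) * real l)))"
      by (intro suminf_le) auto
    also have "\<dots> = ennreal \<tau> * ennreal (G (b - p)) * ennreal (G (p - D))"
      unfolding ennreal_suminf_cmult ennreal_suminf_multc suminf_powr_geometric[OF pos(1)] suminf_powr_geometric[OF pos(2)] G_def ..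
    also have "\<dots> = ennreal (G (b - p) * G (p - D) * \<tau>)"
      using \<tau> G[OF pos(1)] G[OF pos(2)] by (simp add: ennreal_mult[symmetric] mult_ac)
    finally show ?thesis .
  qed
  then show ?thesis using G pos by (intro that[of "G (b - p) * G (p - D)"]) auto
qed

text \<open>About \<open>log 2 (1 / y) / p\<close> terms are cut off at \<open>y\<close>; the remaining ones are geometric.\<close>

lemma suminf_min_powr_le:
  assumes p: "0 < (p::real)" and y: "0 < y"
  shows "(\<Sum>l. ennreal (min (2 powr (- p * real l)) y))
    \<le> ennreal (y * (max 0 (log 2 (1 / y) / p) + 1 + 1 / (1 - 2 powr (- p))))"
proof -
  define x where "x = max 0 (log 2 (1 / y) / p)"
  define N where "N = nat \<lceil>x\<rceil>"
  have N: "x \<le> real N" "real N \<le> x + 1" by (auto simp: N_def x_def)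
  have "log 2 (1 / y) / p \<le> real N" using N(1) by (simp add: x_def)
  then have "- p * real N \<le> log 2 y" using p y by (simp add: log_divide field_simps)
  then have yN: "2 powr (- p * real N) \<le> y" using y by (subst (asm) le_log_iff) auto
  have "(\<Sum>l. ennreal (min (2 powr (- p * real l)) y))
      = (\<Sum>l. ennreal (min (2 powr (- p * real (l + N))) y)) + (\<Sum>l<N. ennreal (min (2 powr (- p * real l)) y))"
    by (rule suminf_offset) simp
  also have "\<dots> \<le> (\<Sum>l. ennreal y * ennreal (2 powr (- p * real l))) + (\<Sum>l<N. ennreal y)"
  proof (intro add_mono suminf_le sum_mono ennreal_leI)
    fix l
    have "2 powr (- p * real (l + N)) = 2 powr (- p * real N) * 2 powr (- p * real l)"
      by (simp add: powr_add[symmetric] algebra_simps)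
    also have "\<dots> \<le> y * 2 powr (- p * real l)" using yN by (intro mult_right_mono) auto
    finally show "ennreal (min (2 powr (- p * real (l + N))) y) \<le> ennreal y * ennreal (2 powr (- p * real l))"
      using y by (simp add: ennreal_mult[symmetric] ennreal_leI)
  qed auto
  also have "\<dots> = ennreal (y * (1 / (1 - 2 powr (- p)))) + ennreal (real N * y)"
    unfolding ennreal_suminf_cmult suminf_powr_geometric[OF p] using y powr_neg_less_one[OF p]
    by (simp add: ennreal_mult[symmetric] ennreal_of_nat_eq_real_of_nat)
  also have "\<dots> = ennreal (y * (1 / (1 - 2 powr (- p))) + real N * y)"
    using y powr_neg_less_one[OF p] by (intro ennreal_plus[symmetric]) auto
  also have "\<dots> \<le> ennreal (y * (x + 1 + 1 / (1 - 2 powr (- p))))"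
    using mult_left_mono[OF N(2), of y] y by (intro ennreal_leI) (simp add: algebra_simps)
  finally show ?thesis by (simp add: x_def)
qed

text \<open>At \<open>p = D\<close> the variance bound is constant in the scale \<open>l\<close>, so the scales up to the crossing all contribute
equally. The lower bound \<open>t0\<close> keeps \<open>ln (1 + t)\<close> away from zero.\<close>

lemma scale_series_critical:
  fixes p q b t0 :: real
  assumes "0 < p" "p < b" "b \<le> q" "0 < t0"
  obtains K where "0 < K" "\<And>t. t0 \<le> t \<Longrightarrow>
    (\<Sum>n. \<Sum>l. ennreal (scale_term p q b p (t powr (- (1 / 2))) n l)) \<le> ennreal (K * (t powr (- (1 / 2)) * ln (1 + t)))"
proof -
  define G where "G w = 1 / (1 - 2 powr (- w))" for w :: real
  have G: "0 < G w" if "0 < w" for w using powr_neg_less_one[OF that] by (simp add: G_def)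
  have pos: "0 < b - p" using assms by auto
  define c1 where "c1 = 1 / (2 * p * ln 2)"
  define c2 where "c2 = (1 + G p) / ln (1 + t0)"
  have c: "0 < c1" "0 < c2" using assms G[of p] by (auto simp: c1_def c2_def intro!: divide_pos_pos)
  have "(\<Sum>n. \<Sum>l. ennreal (scale_term p q b p (t powr (- (1 / 2))) n l))
      \<le> ennreal (G (b - p) * (c1 + c2) * (t powr (- (1 / 2)) * ln (1 + t)))" if t: "t0 \<le> t" for t
  proof -
    define \<tau> where "\<tau> = t powr (- (1 / 2))"
    have t0: "0 < t" using t assms by simp
    then have \<tau>: "0 < \<tau>" by (simp add: \<tau>_def)
    have "ennreal (scale_term p q b p \<tau> n l)
        \<le> ennreal (2 powr (- (b - p) * real n)) * ennreal (min (2 powr (- p * real l)) \<tau>)" for n l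
    proof -
      have "2 powr (- (q - p) * real n - p * real l) \<le> 2 powr (- (b - p) * real n) * 2 powr (- p * real l)"
        unfolding powr_add[symmetric] using assms
        by (intro powr_mono) (auto simp: algebra_simps mult_right_mono)
      then have 1: "scale_term p q b p \<tau> n l \<le> 2 powr (- (b - p) * real n) * 2 powr (- p * real l)"
        unfolding scale_term_def by (rule min.coboundedI1)
      have 2: "scale_term p q b p \<tau> n l \<le> 2 powr (- (b - p) * real n) * \<tau>"
        unfolding scale_term_def by (rule min.coboundedI2) (simp add: algebra_simps)
      have "scale_term p q b p \<tau> n l \<le> 2 powr (- (b - p) * real n) * min (2 powr (- p * real l)) \<tau>"
        using 1 2 by (simp only: min_def split: if_split) blast
      then show ?thesis using \<tau> by (simp add: ennreal_mult[symmetric] ennreal_leI)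
    qed
    then have "(\<Sum>n. \<Sum>l. ennreal (scale_term p q b p \<tau> n l))
        \<le> (\<Sum>n. \<Sum>l. ennreal (2 powr (- (b - p) * real n)) * ennreal (min (2 powr (- p * real l)) \<tau>))"
      by (intro suminf_le) auto
    also have "\<dots> = ennreal (G (b - p)) * (\<Sum>l. ennreal (min (2 powr (- p * real l)) \<tau>))"
      unfolding ennreal_suminf_cmult ennreal_suminf_multc suminf_powr_geometric[OF pos] G_def ..
    also have "\<dots> \<le> ennreal (G (b - p)) * ennreal (\<tau> * ((c1 + c2) * ln (1 + t)))"
    proof -
      have "log 2 (1 / \<tau>) / p = c1 * ln t"
        using t0 assms by (simp add: \<tau>_def log_def ln_div ln_powr c1_def)
      also have "\<dots> \<le> c1 * ln (1 + t)" using t0 c by (intro mult_left_mono) auto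
      finally have 1: "max 0 (log 2 (1 / \<tau>) / p) \<le> c1 * ln (1 + t)" using t0 c by simp
      have "ln (1 + t0) \<le> ln (1 + t)" "0 < ln (1 + t0)" using t assms by auto
      then have "1 + G p \<le> c2 * ln (1 + t)"
        using G[of p] assms mult_left_mono[of "ln (1 + t0)" "ln (1 + t)" "1 + G p"] by (simp add: c2_def field_simps)
      then have "\<tau> * (max 0 (log 2 (1 / \<tau>) / p) + 1 + 1 / (1 - 2 powr (- p))) \<le> \<tau> * ((c1 + c2) * ln (1 + t))"
        using 1 \<tau> by (intro mult_left_mono) (auto simp: G_def algebra_simps)
      then show ?thesis
        by (intro mult_left_mono order_trans[OF suminf_min_powr_le[OF assms(1) \<tau>]]) (auto intro: ennreal_leI)
    qed
    also have "\<dots> = ennreal (G (b - p) * (c1 + c2) * (\<tau> * ln (1 + t)))"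
      using G[OF pos] \<tau> c t0 by (simp add: ennreal_mult[symmetric] mult_ac)
    finally show ?thesis by (simp add: \<tau>_def)
  qed
  then show ?thesis using c G[OF pos] by (intro that[of "G (b - p) * (c1 + c2)"]) auto
qed

section \<open>From discrepancies of cells to expected transport cost\<close>

text \<open>Jensen's inequality for the concave function \<open>x powr \<beta>\<close>, from the inequality between weighted means.\<close>

lemma sum_powr_le_card_powr:
  fixes a :: "'i \<Rightarrow> real"
  assumes F: "finite F" and a: "\<And>i. i \<in> F \<Longrightarrow> 0 \<le> a i" and b: "0 < \<beta>" "\<beta> < 1"
  shows "(\<Sum>i\<in>F. a i powr \<beta>) \<le> real (card F) powr (1 - \<beta>) * (\<Sum>i\<in>F. a i) powr \<beta>"
proof (cases "(\<Sum>i\<in>F. a i) = 0")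
  case True
  then have "\<forall>i\<in>F. a i = 0" using sum_nonneg_eq_0_iff[OF F a] by auto
  then show ?thesis by simp
next
  case False
  define S where "S = (\<Sum>i\<in>F. a i)"
  define N where "N = real (card F)"
  have "0 \<le> S" unfolding S_def by (rule sum_nonneg) (rule a)
  then have S: "0 < S" using False by (simp add: S_def)
  have "F \<noteq> {}" using False by auto
  then have N: "0 < N" using F by (simp add: N_def card_gt_0_iff)
  have "(a i * (N / S)) powr \<beta> \<le> \<beta> * (a i * (N / S)) + (1 - \<beta>)" if i: "i \<in> F" for i
  proof (cases "a i = 0")
    case False
    then have "0 < a i" using a[OF i] by simp
    then show ?thesis using Youngs_inequality_0[of \<beta> "1 - \<beta>" "a i * (N / S)" 1] b S N by simp
  qed (use b in simp)
  then have "(\<Sum>i\<in>F. (a i * (N / S)) powr \<beta>) \<le> (\<Sum>i\<in>F. \<beta> * (a i * (N / S)) + (1 - \<beta>))"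
    by (rule sum_mono)
  also have "\<dots> = \<beta> * (S * (N / S)) + N * (1 - \<beta>)"
    by (simp add: sum.distrib sum_distrib_left[symmetric] sum_distrib_right[symmetric] S_def N_def sum_divide_distrib[symmetric])
  also have "\<dots> = N" using S by (simp add: algebra_simps)
  also have "(\<Sum>i\<in>F. (a i * (N / S)) powr \<beta>) = (\<Sum>i\<in>F. a i powr \<beta>) * (N / S) powr \<beta>"
    by (simp only: sum_distrib_right powr_mult)
  finally have "(\<Sum>i\<in>F. a i powr \<beta>) \<le> N / (N / S) powr \<beta>"
    using N S by (simp add: pos_le_divide_eq)
  also have "\<dots> = N powr (1 - \<beta>) * S powr \<beta>"
    using N S by (simp add: powr_divide powr_diff)
  finally show ?thesis by (simp add: S_def N_def)
qed

text \<open>Markov's inequality for the moment of order \<open>q\<close>; the factor \<open>2 powr q\<close> comes from the inner radius \<open>2 ^ (n - 1)\<close> of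
the shell.\<close>

lemma shell_mass_le:
  fixes \<pi> :: "'a::euclidean_space measure"
  assumes \<pi>: "\<pi> \<in> space (prob_algebra borel)" and q: "0 < q"
    and Q: "moment q \<pi> \<le> ennreal Q" "1 \<le> Q"
  shows "measure \<pi> (shell -` {n}) \<le> 2 powr q * Q * 2 powr (- q * n)"
proof -
  interpret prob_space \<pi> using \<pi> by (simp add: space_prob_algebra)
  have S[measurable_cong, simp]: "sets \<pi> = sets borel" using \<pi> by (simp add: space_prob_algebra)
  show ?thesis
  proof (cases "n = 0")
    case True
    have "1 * 1 \<le> 2 powr q * Q" using q Q ge_one_powr_ge_zero[of 2 q] by (intro mult_mono) auto
    then have "1 \<le> 2 powr q * Q * 2 powr (- q * n)" using True by simp
    then show ?thesis using prob_le_1[of "shell -` {n}"] by linarith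
  next
    case False
    have "ennreal (2 powr (q * (real n - 1))) * emeasure \<pi> (shell -` {n})
        = (\<integral>\<^sup>+x. ennreal (2 powr (q * (real n - 1))) * indicator (shell -` {n}) x \<partial>\<pi>)"
      by (simp add: nn_integral_cmult)
    also have "\<dots> \<le> moment q \<pi>"
      unfolding moment_def
    proof (intro nn_integral_mono)
      fix x :: 'a
      show "ennreal (2 powr (q * (real n - 1))) * indicator (shell -` {n}) x \<le> ennreal (norm x powr q)"
      proof (cases "shell x = n")
        case True
        then have "2 ^ (n - 1) \<le> norm x" using shell_le_norm[of x] False by simp
        then have "(2 powr (real n - 1)) powr q \<le> norm x powr q"
          using q False by (intro powr_mono2) (auto simp: powr_realpow[symmetric] of_nat_diff)
        then show ?thesis using True by (simp add: powr_powr mult.commute ennreal_leI)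
      qed simp
    qed
    also have "\<dots> \<le> ennreal Q" by (rule Q)
    finally have "2 powr (q * (real n - 1)) * measure \<pi> (shell -` {n}) \<le> Q"
      using Q by (simp add: emeasure_eq_measure ennreal_mult[symmetric])
    then have "2 powr (q - q * n) * (2 powr (q * (real n - 1)) * measure \<pi> (shell -` {n})) \<le> 2 powr (q - q * n) * Q"
      by (intro mult_left_mono) auto
    moreover have "2 powr (q - q * n) * 2 powr (q * (real n - 1)) = 1"
      by (simp add: powr_add[symmetric] algebra_simps)
    ultimately have "measure \<pi> (shell -` {n}) \<le> 2 powr (q - q * n) * Q"
      by (simp only: mult.assoc[symmetric] mult_1)
    also have "2 powr (q - q * n) = 2 powr q * 2 powr (- q * n)"
      by (simp add: powr_add[symmetric])
    finally show ?thesis by (simp only: ac_simps)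
  qed
qed

lemma borel_measurable_countable_sum:
  fixes f :: "'i::countable \<Rightarrow> 'x \<Rightarrow> ennreal"
  assumes [measurable]: "\<And>i. f i \<in> borel_measurable M"
  shows "(\<lambda>x. \<integral>\<^sup>+i. f i x \<partial>count_space UNIV) \<in> borel_measurable M"
proof -
  interpret sigma_finite_measure "count_space (UNIV :: 'i set)" by (rule sigma_finite_measure_count_space)
  have "(\<lambda>z. f (snd z) (fst z)) \<in> borel_measurable (M \<Otimes>\<^sub>M count_space UNIV)"
    by (rule measurable_compose_countable[where f="\<lambda>i z. f i (fst z)" and g=snd]) auto
  then have "(\<lambda>(x, i). f i x) \<in> borel_measurable (M \<Otimes>\<^sub>M count_space UNIV)"
    by (simp add: split_beta)
  then show ?thesis by (rule borel_measurable_nn_integral)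
qed

text \<open>A random measure that satisfies the discrepancy estimate \<open>A\<close> is close to \<open>\<nu>\<close> on average. In each shell the sum over the
cells of level \<open>l\<close> is bounded by the mass of the shell or, by concavity, by the number \<open>2 ^ (d * l)\<close> of cells to
the power \<open>1 - \<beta>\<close> times a power of that mass.\<close>

lemma expected_wasserstein_le:
  fixes N :: "'w \<Rightarrow> 'a::euclidean_space measure" and \<nu> \<pi> :: "'a measure"
  assumes N: "\<And>\<omega>. \<omega> \<in> space M \<Longrightarrow> N \<omega> \<in> space (prob_algebra borel)"
    and Nm[measurable]: "\<And>A. A \<in> sets borel \<Longrightarrow> (\<lambda>\<omega>. measure (N \<omega>) A) \<in> borel_measurable M"
    and \<nu>: "\<nu> \<in> space (prob_algebra borel)" and p: "0 < p" and mom: "moment p \<nu> < \<infinity>"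
    and \<pi>: "\<pi> \<in> space (prob_algebra borel)" and q: "0 < q"
    and Q: "moment q \<pi> \<le> ennreal Q" "1 \<le> Q"
    and C0: "0 < C0" and \<tau>: "0 < \<tau>" and \<beta>: "0 < \<beta>" "\<beta> < 1"
    and A: "\<And>A. A \<in> sets borel \<Longrightarrow> (\<integral>\<^sup>+\<omega>. ennreal \<bar>measure (N \<omega>) A - measure \<nu> A\<bar> \<partial>M)
      \<le> ennreal (C0 * min (measure \<pi> A) (measure \<pi> A powr \<beta> * \<tau>))"
  defines "d \<equiv> real DIM('a)"
  shows "(\<integral>\<^sup>+\<omega>. ennpowr (wasserstein p (N \<omega>) \<nu>) p \<partial>M)
    \<le> ennreal (2 * 2 powr p * (2 * d) powr p * C0 * 2 powr q * Q) *
      (\<Sum>n. \<Sum>l. ennreal (scale_term p q (q * \<beta>) (d * (1 - \<beta>)) \<tau> n l))"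
proof -
  interpret \<pi>: prob_space \<pi> using \<pi> by (simp add: space_prob_algebra)
  have S[measurable_cong, simp]: "sets \<pi> = sets borel" using \<pi> by (simp add: space_prob_algebra)
  have d: "1 \<le> d" unfolding d_def using DIM_positive[where 'a='a] by linarith
  define K where "K l i = (dyadic l -` {i} :: 'a set)" for l i
  have K[measurable]: "K l i \<in> sets borel" for l i unfolding K_def by measurable
  define w where "w l i = ennreal (dyadic_cost d p l (fst i))" for l and i :: "nat \<times> int list"
  define g where "g l i = min (measure \<pi> (K l i)) (measure \<pi> (K l i) powr \<beta> * \<tau>)" for l i
  have g0: "0 \<le> g l i" for l i using \<tau> by (simp add: g_def)
  define F where "F l = {is :: int list. set is \<subseteq> {0..<2 ^ l} \<and> length is = DIM('a)}" for l :: nat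
  have F: "finite (F l)" "real (card (F l)) = 2 powr (d * l)" for l
    unfolding F_def by (simp_all add: card_dyadic_range d_def powr_realpow[symmetric] powr_powr mult.commute)
  have KF: "K l (n, f) = {}" if "f \<notin> F l" for l n f
  proof (rule ccontr)
    assume "K l (n, f) \<noteq> {}"
    then obtain x :: 'a where "dyadic l x = (n, f)" by (auto simp: K_def)
    then show False using dyadic_range[of l x] that by (simp add: F_def)
  qed
  have "(\<integral>\<^sup>+\<omega>. ennpowr (wasserstein p (N \<omega>) \<nu>) p \<partial>M)
    \<le> (\<integral>\<^sup>+\<omega>. ennreal (2 * 2 powr p) * (\<Sum>l. \<integral>\<^sup>+i. w l i *
        ennreal \<bar>measure (N \<omega>) (K l i) - measure \<nu> (K l i)\<bar> \<partial>count_space UNIV) \<partial>M)"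
    unfolding w_def K_def d_def
    by (intro nn_integral_mono wasserstein_dyadic_bound N \<nu> p mom)
  also have "\<dots> = ennreal (2 * 2 powr p) * (\<Sum>l. \<integral>\<^sup>+\<omega>. \<integral>\<^sup>+i. w l i *
        ennreal \<bar>measure (N \<omega>) (K l i) - measure \<nu> (K l i)\<bar> \<partial>count_space UNIV \<partial>M)"
    by (subst nn_integral_cmult; (subst nn_integral_suminf)?)
      (auto intro!: borel_measurable_countable_sum borel_measurable_suminf_order)
  also have "\<dots> = ennreal (2 * 2 powr p) * (\<Sum>l. \<integral>\<^sup>+i. w l i *
        (\<integral>\<^sup>+\<omega>. ennreal \<bar>measure (N \<omega>) (K l i) - measure \<nu> (K l i)\<bar> \<partial>M) \<partial>count_space UNIV)"
    by (subst nn_integral_count_space_nn_integral) (auto simp: nn_integral_cmult)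
  also have "\<dots> \<le> ennreal (2 * 2 powr p) * (\<Sum>l. \<integral>\<^sup>+i. w l i * ennreal (C0 * g l i) \<partial>count_space UNIV)"
    unfolding g_def by (intro mult_left_mono suminf_le nn_integral_mono A) auto
  also have "\<dots> = ennreal (2 * 2 powr p) * (\<Sum>l. \<Sum>n. \<integral>\<^sup>+f. w l (n, f) * ennreal (C0 * g l (n, f)) \<partial>count_space UNIV)"
    by (simp add: nn_integral_fst_count_space[symmetric] nn_integral_count_space_nat)
  also have "\<dots> \<le> ennreal (2 * 2 powr p) * (\<Sum>l. \<Sum>n. ennreal ((2 * d) powr p * C0 * 2 powr q * Q) * 
      ennreal (scale_term p q (q * \<beta>) (d * (1 - \<beta>)) \<tau> n l))"
  proof (intro mult_left_mono suminf_le)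
    fix l n :: nat
    define B where "B = measure \<pi> (shell -` {n} :: 'a set)"
    define s where "s = 2 powr q * Q"
    define X where "X = 2 powr (d * (1 - \<beta>) * l)"
    have "1 * 1 \<le> s" unfolding s_def using q Q ge_one_powr_ge_zero[of 2 q] by (intro mult_mono) auto
    then have s: "1 \<le> s" by simp
    have B: "B \<le> s * 2 powr (- q * n)" unfolding B_def s_def by (rule shell_mass_le[OF \<pi> q Q])
    have B0: "0 \<le> B" by (simp add: B_def)
    have KB: "(\<Sum>f\<in>F l. measure \<pi> (K l (n, f))) \<le> B"
    proof -
      have "(\<Sum>f\<in>F l. measure \<pi> (K l (n, f))) = measure \<pi> (\<Union>f\<in>F l. K l (n, f))"
        by (rule \<pi>.finite_measure_finite_Union[symmetric]) (auto simp: F disjoint_family_on_def K_def)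
      also have "\<dots> \<le> B" unfolding B_def
        by (intro \<pi>.finite_measure_mono) (auto simp: K_def dyadic_def)
      finally show ?thesis .
    qed
    have "(\<Sum>f\<in>F l. g l (n, f)) \<le> (\<Sum>f\<in>F l. measure \<pi> (K l (n, f)))"
      unfolding g_def by (intro sum_mono) auto
    then have 1: "(\<Sum>f\<in>F l. g l (n, f)) \<le> s * 2 powr (- q * n)" using KB B by linarith
    have "(\<Sum>f\<in>F l. g l (n, f)) \<le> (\<Sum>f\<in>F l. measure \<pi> (K l (n, f)) powr \<beta> * \<tau>)"
      unfolding g_def by (intro sum_mono) auto
    also have "\<dots> = (\<Sum>f\<in>F l. measure \<pi> (K l (n, f)) powr \<beta>) * \<tau>" by (simp add: sum_distrib_right)
    also have "\<dots> \<le> (real (card (F l)) powr (1 - \<beta>) * (\<Sum>f\<in>F l. measure \<pi> (K l (n, f))) powr \<beta>) * \<tau>"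
      using \<tau> \<beta> F by (intro mult_right_mono sum_powr_le_card_powr) auto
    also have "\<dots> \<le> (X * (s * 2 powr (- q * n)) powr \<beta>) * \<tau>"
    proof -
      have "(\<Sum>f\<in>F l. measure \<pi> (K l (n, f))) powr \<beta> \<le> (s * 2 powr (- q * n)) powr \<beta>"
        using KB B \<beta> by (intro powr_mono2) (auto intro: sum_nonneg)
      moreover have "real (card (F l)) powr (1 - \<beta>) = X"
        unfolding F X_def by (simp add: powr_powr mult_ac)
      ultimately show ?thesis using \<tau> by (intro mult_right_mono mult_mono) (auto simp: X_def)
    qed
    also have "\<dots> \<le> (X * (s * 2 powr (- (q * \<beta>) * n))) * \<tau>"
    proof -
      have "s powr \<beta> \<le> s powr 1" using s \<beta> by (intro powr_mono) auto
      then have "s powr \<beta> * 2 powr (- q * n * \<beta>) \<le> s * 2 powr (- q * n * \<beta>)"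
        using s by (intro mult_right_mono) auto
      then have "(s * 2 powr (- q * n)) powr \<beta> \<le> s * 2 powr (- (q * \<beta>) * n)"
        by (simp add: powr_mult powr_powr mult_ac)
      then show ?thesis using \<tau> by (intro mult_right_mono mult_left_mono) (auto simp: X_def)
    qed
    finally have 2: "(\<Sum>f\<in>F l. g l (n, f)) \<le> s * (X * 2 powr (- (q * \<beta>) * n) * \<tau>)" by (simp add: mult_ac)
    have c: "dyadic_cost d p l n = (2 * d) powr p * 2 powr (p * n - p * l)"
    proof -
      have "2 * d * 2 ^ n / 2 ^ l = (2 * d) * 2 powr (real n - real l)"
        by (simp add: powr_diff powr_realpow)
      then show ?thesis unfolding dyadic_cost_def by (simp add: powr_mult powr_powr algebra_simps)
    qed
    have "dyadic_cost d p l n * (C0 * (\<Sum>f\<in>F l. g l (n, f)))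
        \<le> (2 * d) powr p * 2 powr (p * n - p * l) * (C0 * (s * min (2 powr (- q * n)) (X * 2 powr (- (q * \<beta>) * n) * \<tau>)))"
      unfolding c
    proof (intro mult_left_mono)
      show "(\<Sum>f\<in>F l. g l (n, f)) \<le> s * min (2 powr (- q * n)) (X * 2 powr (- (q * \<beta>) * n) * \<tau>)"
        using 1 2 by (auto simp: min_def)
    qed (use C0 in auto)
    also have "\<dots> = (2 * d) powr p * C0 * 2 powr q * Q *
        (2 powr (p * n - p * l) * min (2 powr (- q * n)) (X * 2 powr (- (q * \<beta>) * n) * \<tau>))"
      by (simp add: s_def mult_ac)
    also have "2 powr (p * n - p * l) * min (2 powr (- q * n)) (X * 2 powr (- (q * \<beta>) * n) * \<tau>)
        = scale_term p q (q * \<beta>) (d * (1 - \<beta>)) \<tau> n l"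
    proof -
      have "2 powr (p * n - p * l) * min (2 powr (- q * n)) (X * 2 powr (- (q * \<beta>) * n) * \<tau>)
        = min (2 powr (p * n - p * l) * 2 powr (- q * n)) (\<tau> * (2 powr (p * n - p * l) * X * 2 powr (- (q * \<beta>) * n)))"
        by (simp add: min_mult_distrib_left mult_ac)
      also have "2 powr (p * n - p * l) * 2 powr (- q * n) = 2 powr (- (q - p) * n - p * l)"
        by (simp add: powr_add[symmetric] algebra_simps)
      also have "2 powr (p * n - p * l) * X * 2 powr (- (q * \<beta>) * n) = 2 powr ((p - q * \<beta>) * n + (d * (1 - \<beta>) - p) * l)"
        unfolding X_def powr_add[symmetric] by (simp add: algebra_simps)
      finally show ?thesis by (simp add: scale_term_def)
    qed
    finally have real_bound: "dyadic_cost d p l n * (C0 * (\<Sum>f\<in>F l. g l (n, f)))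
        \<le> (2 * d) powr p * C0 * 2 powr q * Q * scale_term p q (q * \<beta>) (d * (1 - \<beta>)) \<tau> n l" .
    have "(\<integral>\<^sup>+f. w l (n, f) * ennreal (C0 * g l (n, f)) \<partial>count_space UNIV)
        = (\<integral>\<^sup>+f. w l (n, f) * ennreal (C0 * g l (n, f)) * indicator (F l) f \<partial>count_space UNIV)"
      using KF \<beta> by (intro nn_integral_cong) (auto simp: g_def split: split_indicator)
    also have "\<dots> = (\<integral>\<^sup>+f. w l (n, f) * ennreal (C0 * g l (n, f)) \<partial>count_space (F l))"
      by (subst nn_integral_restrict_space[symmetric]) (auto simp: restrict_count_space)
    also have "\<dots> = (\<Sum>f\<in>F l. ennreal (dyadic_cost d p l n * (C0 * g l (n, f))))"
      using F C0 g0 by (simp add: nn_integral_count_space_finite w_def ennreal_mult[symmetric] dyadic_cost_def)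
    also have "\<dots> = ennreal (dyadic_cost d p l n * (C0 * (\<Sum>f\<in>F l. g l (n, f))))"
      using C0 g0 by (subst sum_ennreal) (auto simp: sum_distrib_left dyadic_cost_def)
    also have "\<dots> \<le> ennreal ((2 * d) powr p * C0 * 2 powr q * Q * scale_term p q (q * \<beta>) (d * (1 - \<beta>)) \<tau> n l)"
      by (intro ennreal_leI real_bound)
    also have "\<dots> = ennreal ((2 * d) powr p * C0 * 2 powr q * Q) * ennreal (scale_term p q (q * \<beta>) (d * (1 - \<beta>)) \<tau> n l)"
      using C0 Q \<tau> by (intro ennreal_mult) (auto simp: scale_term_def)
    finally show "(\<integral>\<^sup>+f. w l (n, f) * ennreal (C0 * g l (n, f)) \<partial>count_space UNIV)
      \<le> ennreal ((2 * d) powr p * C0 * 2 powr q * Q) * ennreal (scale_term p q (q * \<beta>) (d * (1 - \<beta>)) \<tau> n l)" .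
  qed auto
  also have "\<dots> = ennreal (2 * 2 powr p * (2 * d) powr p * C0 * 2 powr q * Q) *
      (\<Sum>n. \<Sum>l. ennreal (scale_term p q (q * \<beta>) (d * (1 - \<beta>)) \<tau> n l))"
    using C0 Q
    by (simp add: suminf_swap_ennreal[of "\<lambda>l n. ennreal (scale_term p q (q * \<beta>) (d * (1 - \<beta>)) \<tau> n l)"]
        mult.assoc[symmetric] ennreal_mult[symmetric])
  finally show ?thesis .
qed

section \<open>Regularization turns Wasserstein decay into decay in total variation\<close>

lemma prob_algebra_simps:
  assumes "\<mu> \<in> space (prob_algebra (borel :: 'a::euclidean_space measure))"
  shows "prob_space \<mu>" "sets \<mu> = sets borel" "space \<mu> = UNIV"
  using assms sets_eq_imp_space_eq[of \<mu> borel] by (auto simp: space_prob_algebra)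

lemma prob_integrable_bounded:
  fixes f :: "'a::euclidean_space \<Rightarrow> real"
  assumes \<mu>: "\<mu> \<in> space (prob_algebra borel)" and f: "f \<in> borel_measurable borel" and B: "\<And>x. \<bar>f x\<bar> \<le> B"
  shows "integrable \<mu> f" "\<bar>\<integral>x. f x \<partial>\<mu>\<bar> \<le> B"
proof -
  interpret prob_space \<mu> by (rule prob_algebra_simps[OF \<mu>])
  have S[measurable_cong]: "sets \<mu> = sets borel" by (rule prob_algebra_simps[OF \<mu>])
  show i: "integrable \<mu> f" using f B by (intro integrable_const_bound[where B=B]) (auto simp: measurable_cong_sets[OF S refl])
  have "\<bar>\<integral>x. f x \<partial>\<mu>\<bar> \<le> (\<integral>x. \<bar>f x\<bar> \<partial>\<mu>)" by (rule integral_abs_bound)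
  also have "\<dots> \<le> (\<integral>x. B \<partial>\<mu>)" using i B by (intro integral_mono) auto
  finally show "\<bar>\<integral>x. f x \<partial>\<mu>\<bar> \<le> B" by (simp add: prob_space)
qed

lemma integral_bind_bounded:
  fixes f :: "'a::euclidean_space \<Rightarrow> real" and \<mu> :: "'a measure"
  assumes \<mu>: "\<mu> \<in> space (prob_algebra borel)" and K: "K \<in> borel \<rightarrow>\<^sub>M prob_algebra (borel :: 'a measure)"
    and f[measurable]: "f \<in> borel_measurable borel" and B: "\<And>x. \<bar>f x\<bar> \<le> B"
  shows "(\<integral>x. f x \<partial>(\<mu> \<bind> K)) = (\<integral>x. (\<integral>y. f y \<partial>K x) \<partial>\<mu>)"
    and "(\<lambda>x. \<integral>y. f y \<partial>K x) \<in> borel_measurable borel"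
proof -
  interpret prob_space \<mu> by (rule prob_algebra_simps[OF \<mu>])
  have S[measurable_cong]: "sets \<mu> = sets borel" by (rule prob_algebra_simps[OF \<mu>])
  have K': "K \<in> \<mu> \<rightarrow>\<^sub>M prob_algebra borel" using K by (simp add: measurable_cong_sets[OF S refl])
  have Kx: "K x \<in> space (prob_algebra borel)" for x using measurable_space[OF K] by simp
  have b: "\<mu> \<bind> K \<in> space (prob_algebra borel)"
    using prob_space_bind'[OF \<mu> K] sets_bind'[OF \<mu> K] by (simp add: space_prob_algebra)
  show m: "(\<lambda>x. \<integral>y. f y \<partial>K x) \<in> borel_measurable borel"
    using measurable_compose[OF measurable_prob_algebraD[OF K] integral_measurable_subprob_algebra[OF f]] by simp
  have shift: "ennreal ((\<integral>x. f x \<partial>\<eta>) + B) = (\<integral>\<^sup>+x. ennreal (f x + B) \<partial>\<eta>)"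
    if l: "\<eta> \<in> space (prob_algebra borel)" for \<eta> :: "'a measure"
  proof -
    interpret l: prob_space \<eta> by (rule prob_algebra_simps[OF l])
    have i: "integrable \<eta> f" by (rule prob_integrable_bounded[OF l f B])
    have "(\<integral>\<^sup>+x. ennreal (f x + B) \<partial>\<eta>) = ennreal (\<integral>x. f x + B \<partial>\<eta>)"
      using i B by (intro nn_integral_eq_integral) (auto simp: abs_le_iff add_nonneg_nonneg intro!: AE_I2, smt (verit))
    then show ?thesis using i by (simp add: l.prob_space)
  qed
  have bd: "\<bar>\<integral>y. f y \<partial>K x\<bar> \<le> B" for x by (rule prob_integrable_bounded[OF Kx f B])
  have im: "integrable \<mu> (\<lambda>x. \<integral>y. f y \<partial>K x)" by (rule prob_integrable_bounded[OF \<mu> m bd])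
  have "ennreal ((\<integral>x. f x \<partial>(\<mu> \<bind> K)) + B) = (\<integral>\<^sup>+x. ennreal (f x + B) \<partial>(\<mu> \<bind> K))" by (rule shift[OF b])
  also have "\<dots> = (\<integral>\<^sup>+x. (\<integral>\<^sup>+y. ennreal (f y + B) \<partial>K x) \<partial>\<mu>)"
    by (rule nn_integral_bind[OF _ measurable_prob_algebraD[OF K']]) measurable
  also have "\<dots> = (\<integral>\<^sup>+x. ennreal ((\<integral>y. f y \<partial>K x) + B) \<partial>\<mu>)" by (simp add: shift[OF Kx])
  also have "\<dots> = ennreal (\<integral>x. (\<integral>y. f y \<partial>K x) + B \<partial>\<mu>)"
    using im bd by (intro nn_integral_eq_integral) (auto intro!: AE_I2, smt (verit))
  also have "\<dots> = ennreal ((\<integral>x. (\<integral>y. f y \<partial>K x) \<partial>\<mu>) + B)" using im by (simp add: prob_space)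
  finally have e: "ennreal ((\<integral>x. f x \<partial>(\<mu> \<bind> K)) + B) = ennreal ((\<integral>x. (\<integral>y. f y \<partial>K x) \<partial>\<mu>) + B)" .
  have "0 \<le> (\<integral>x. f x \<partial>(\<mu> \<bind> K)) + B" "0 \<le> (\<integral>x. (\<integral>y. f y \<partial>K x) \<partial>\<mu>) + B"
    using prob_integrable_bounded(2)[OF b f B] prob_integrable_bounded(2)[OF \<mu> m bd] by linarith+
  then show "(\<integral>x. f x \<partial>(\<mu> \<bind> K)) = (\<integral>x. (\<integral>y. f y \<partial>K x) \<partial>\<mu>)" using e by simp
qed

lemma ennpowr_one: "ennpowr a 1 = a"
  by (simp add: ennpowr_def less_top)

text \<open>The easy half of Kantorovich duality: integrate \<open>g x - g y\<close> against couplings whose cost is within \<open>\<epsilon>\<close> of \<open>r\<close>.\<close>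

lemma integral_diff_le_wasserstein:
  fixes g :: "'a::euclidean_space \<Rightarrow> real"
  assumes \<mu>: "\<mu> \<in> space (prob_algebra borel)" and \<nu>: "\<nu> \<in> space (prob_algebra borel)"
    and g: "g \<in> borel_measurable borel" and B: "\<And>x. \<bar>g x\<bar> \<le> B"
    and L: "L-lipschitz_on UNIV g" and W: "wasserstein 1 \<mu> \<nu> \<le> ennreal r" and r: "0 \<le> r"
  shows "\<bar>(\<integral>x. g x \<partial>\<mu>) - (\<integral>x. g x \<partial>\<nu>)\<bar> \<le> L * r"
proof -
  have L0: "0 \<le> L" using L by (simp add: lipschitz_on_def)
  have "\<bar>(\<integral>x. g x \<partial>\<mu>) - (\<integral>x. g x \<partial>\<nu>)\<bar> \<le> L * (r + \<epsilon>)" if \<epsilon>: "0 < \<epsilon>" for \<epsilon>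
  proof -
    have "wasserstein 1 \<mu> \<nu> < ennreal (r + \<epsilon>)"
      using W r \<epsilon> by (rule_tac order_le_less_trans[OF W]) (simp add: ennreal_lessI)
    then obtain \<pi> where \<pi>: "\<pi> \<in> couplings \<mu> \<nu>"
        and "ennpowr (\<integral>\<^sup>+(x, y). ennreal (norm (x - y) powr 1) \<partial>\<pi>) (1 / 1) < ennreal (r + \<epsilon>)"
      unfolding wasserstein_def by (auto simp: INF_less_iff)
    then have c: "(\<integral>\<^sup>+z. ennreal (norm (fst z - snd z)) \<partial>\<pi>) \<le> ennreal (r + \<epsilon>)"
      by (simp add: ennpowr_one case_prod_unfold less_imp_le)
    interpret prob_space \<pi> using coupling_prob[OF \<mu> \<pi>] by (simp add: space_prob_algebra)
    have S[measurable_cong]: "sets \<pi> = sets (borel \<Otimes>\<^sub>M borel)"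
      and D: "\<mu> = distr \<pi> borel fst" "\<nu> = distr \<pi> borel snd" using \<pi> by (auto simp: couplings_def)
    note g[measurable]
    have i: "integrable \<pi> (\<lambda>z. g (fst z))" "integrable \<pi> (\<lambda>z. g (snd z))"
      using B by (auto intro!: integrable_const_bound[where B=B])
    have "(\<integral>x. g x \<partial>\<mu>) - (\<integral>x. g x \<partial>\<nu>) = (\<integral>z. g (fst z) - g (snd z) \<partial>\<pi>)"
      unfolding D using i by (simp add: integral_distr)
    then have "ennreal \<bar>(\<integral>x. g x \<partial>\<mu>) - (\<integral>x. g x \<partial>\<nu>)\<bar> \<le> (\<integral>\<^sup>+z. ennreal \<bar>g (fst z) - g (snd z)\<bar> \<partial>\<pi>)"
      using integral_norm_bound_ennreal[of \<pi> "\<lambda>z. g (fst z) - g (snd z)"] i by simp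
    also have "\<dots> \<le> (\<integral>\<^sup>+z. ennreal L * ennreal (norm (fst z - snd z)) \<partial>\<pi>)"
      using lipschitz_onD[OF L] L0 by (intro nn_integral_mono) (simp add: ennreal_mult[symmetric] dist_norm ennreal_leI)
    also have "\<dots> = ennreal L * (\<integral>\<^sup>+z. ennreal (norm (fst z - snd z)) \<partial>\<pi>)" by (rule nn_integral_cmult) measurable
    also have "\<dots> \<le> ennreal L * ennreal (r + \<epsilon>)" by (rule mult_left_mono[OF c]) simp
    also have "\<dots> = ennreal (L * (r + \<epsilon>))" using L0 r \<epsilon> by (simp add: ennreal_mult)
    finally show ?thesis using L0 r \<epsilon> by (simp add: ennreal_le_iff)
  qed
  note le = this
  show ?thesis
  proof (rule field_le_epsilon)
    fix \<delta> :: real assume \<delta>: "0 < \<delta>"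
    have "\<bar>(\<integral>x. g x \<partial>\<mu>) - (\<integral>x. g x \<partial>\<nu>)\<bar> \<le> L * (r + \<delta> / (L + 1))"
      \<comment> \<open>the denominator is \<open>L + 1\<close> because \<open>L\<close> may vanish\<close>
      using L0 \<delta> by (intro le) auto
    also have "\<dots> \<le> L * r + \<delta>"
    proof -
      have "L * \<delta> \<le> (L + 1) * \<delta>" using \<delta> by (simp add: algebra_simps)
      then have "L * (\<delta> / (L + 1)) \<le> \<delta>" using L0 by (simp add: divide_simps mult.commute)
      then show ?thesis by (simp add: distrib_left)
    qed
    finally show "\<bar>(\<integral>x. g x \<partial>\<mu>) - (\<integral>x. g x \<partial>\<nu>)\<bar> \<le> L * r + \<delta>" .
  qed
qed

lemma tv_norm_le:
  assumes "\<And>f :: 'a::euclidean_space \<Rightarrow> real. f \<in> borel_measurable borel \<Longrightarrow> (\<And>x. \<bar>f x\<bar> \<le> 1) \<Longrightarrow>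
    \<bar>(\<integral>x. f x \<partial>\<mu>) - (\<integral>x. f x \<partial>\<mu>')\<bar> \<le> B"
  shows "tv_norm \<mu> \<mu>' \<le> B"
proof -
  have "(\<lambda>_. 0) \<in> {f \<in> borel_measurable borel. \<forall>x::'a. \<bar>f x :: real\<bar> \<le> 1}" by simp
  then show ?thesis unfolding tv_norm_def using assms by (intro cSUP_least) blast+
qed

lemma integral_diff_le_tv_norm:
  fixes f :: "'a::euclidean_space \<Rightarrow> real"
  assumes \<mu>: "\<mu> \<in> space (prob_algebra borel)" and \<mu>': "\<mu>' \<in> space (prob_algebra borel)"
    and f: "f \<in> borel_measurable borel" "\<And>x. \<bar>f x\<bar> \<le> 1"
  shows "\<bar>(\<integral>x. f x \<partial>\<mu>) - (\<integral>x. f x \<partial>\<mu>')\<bar> \<le> tv_norm \<mu> \<mu>'"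
  unfolding tv_norm_def
proof (rule cSUP_upper[where f="\<lambda>f. \<bar>(\<integral>x. f x \<partial>\<mu>) - (\<integral>x. f x \<partial>\<mu>')\<bar>"])
  show "f \<in> {f \<in> borel_measurable borel. \<forall>x. \<bar>f x\<bar> \<le> 1}" using f by simp
  show "bdd_above ((\<lambda>f :: 'a \<Rightarrow> real. \<bar>(\<integral>x. f x \<partial>\<mu>) - (\<integral>x. f x \<partial>\<mu>')\<bar>) ` {f \<in> borel_measurable borel. \<forall>x. \<bar>f x\<bar> \<le> 1})"
  proof (rule bdd_aboveI2)
    fix f :: "'a \<Rightarrow> real" assume "f \<in> {f \<in> borel_measurable borel. \<forall>x. \<bar>f x\<bar> \<le> 1}"
    then have f: "f \<in> borel_measurable borel" "\<And>x. \<bar>f x\<bar> \<le> 1" by auto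
    show "\<bar>(\<integral>x. f x \<partial>\<mu>) - (\<integral>x. f x \<partial>\<mu>')\<bar> \<le> 2"
      using prob_integrable_bounded(2)[OF \<mu> f] prob_integrable_bounded(2)[OF \<mu>' f] by linarith
  qed
qed

locale regularizing_semigroup =
  fixes P :: "real \<Rightarrow> 'a::euclidean_space \<Rightarrow> 'a measure" and \<nu> :: "'a measure"
    and \<psi> :: "'a \<Rightarrow> real" and e :: "real \<Rightarrow> real" and \<theta>0 c :: real
  assumes semigroup: "markov_semigroup P"
    and invariant: "invariant_distribution P \<nu>"
    and \<theta>0: "0 < \<theta>0" and c: "0 < c"
    and smoothing: "\<And>g :: 'a \<Rightarrow> real. g \<in> borel_measurable borel \<Longrightarrow> bounded (range g) \<Longrightarrow>
           (c * (SUP x. \<bar>g x\<bar>))-lipschitz_on UNIV (\<lambda>x. \<integral>y. g y \<partial>P \<theta>0 x)"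
    and \<psi>[measurable]: "\<psi> \<in> borel_measurable borel" and \<psi>0: "\<And>x. 0 \<le> \<psi> x"
    and e: "set_integrable lborel {0..} e" and e0: "\<And>t. 0 \<le> t \<Longrightarrow> 0 \<le> e t"
    and wasserstein_decay: "\<And>t x. 0 \<le> t \<Longrightarrow> wasserstein 1 (P t x) \<nu> \<le> ennreal (\<psi> x * e t)"
begin

lemma P_kernel: "0 \<le> t \<Longrightarrow> P t \<in> borel \<rightarrow>\<^sub>M prob_algebra borel"
  using semigroup by (simp add: markov_semigroup_def)

lemma P_prob: "0 \<le> t \<Longrightarrow> P t x \<in> space (prob_algebra borel)"
  using measurable_space[OF P_kernel] by simp

lemma \<nu>_prob: "\<nu> \<in> space (prob_algebra borel)"
  using invariant by (simp add: invariant_distribution_def)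

abbreviation "\<phi> \<equiv> psi_tilde \<psi>"
abbreviation "et \<equiv> e_tilde \<theta>0 c e"

lemma \<phi>_measurable[measurable]: "\<phi> \<in> borel_measurable borel"
  unfolding psi_tilde_def by measurable

lemma \<phi>_ge: "1 \<le> \<phi> x" "\<psi> x \<le> \<phi> x" by (auto simp: psi_tilde_def)

lemma et_nonneg: "0 \<le> t \<Longrightarrow> 0 \<le> et t"
  using c e0 by (auto simp: e_tilde_def split: split_indicator)

lemma et_integrable: "set_integrable lborel {0..} et"
proof -
  have "integrable lborel (\<lambda>t. indicator {0..} (- \<theta>0 + 1 * t) *\<^sub>R e (- \<theta>0 + 1 * t))"
    using e unfolding set_integrable_def by (rule lborel_integrable_real_affine) simp
  then have "integrable lborel (\<lambda>t. 2 * indicator {0..\<theta>0} t + c * (indicator {0..} (- \<theta>0 + 1 * t) *\<^sub>R e (- \<theta>0 + 1 * t)))"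
    by (intro Bochner_Integration.integrable_add integrable_mult_right) (auto intro!: integrable_real_indicator simp: emeasure_lborel_Icc_eq)
  moreover have "indicator {0..} t *\<^sub>R et t = 2 * indicator {0..\<theta>0} t + c * (indicator {0..} (- \<theta>0 + 1 * t) *\<^sub>R e (- \<theta>0 + 1 * t))" for t
    using \<theta>0 by (auto simp: e_tilde_def split: split_indicator)
  ultimately show ?thesis unfolding set_integrable_def by simp
qed

text \<open>Before time \<open>\<theta>0\<close> the trivial bound \<open>2\<close> is used. Afterwards the last stretch of
length \<open>\<theta>0\<close> turns \<open>f\<close> into the function \<open>g\<close>, which is Lipschitz with constant \<open>c\<close>, and the Wasserstein decay at
time \<open>t - \<theta>0\<close> applies to \<open>g\<close>. The constant function \<open>2\<close> on the initial stretch and \<open>c\<close> times the shifted \<open>e\<close> make up \<open>e_tilde\<close>.\<close>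

lemma tv_decay:
  assumes t: "0 \<le> t" shows "tv_norm (P t x) \<nu> \<le> \<phi> x * et t"
proof (rule tv_norm_le)
  fix f :: "'a \<Rightarrow> real" assume f: "f \<in> borel_measurable borel" and f1: "\<And>x. \<bar>f x\<bar> \<le> 1"
  show "\<bar>(\<integral>x. f x \<partial>P t x) - (\<integral>x. f x \<partial>\<nu>)\<bar> \<le> \<phi> x * et t"
  proof (cases "t < \<theta>0")
    case True
    have "\<bar>(\<integral>x. f x \<partial>P t x) - (\<integral>x. f x \<partial>\<nu>)\<bar> \<le> 1 * 2"
      using prob_integrable_bounded(2)[OF P_prob[OF t] f f1, of x] prob_integrable_bounded(2)[OF \<nu>_prob f f1] by linarith
    also have "\<dots> \<le> \<phi> x * et t" using \<phi>_ge[of x] True by (intro mult_mono) (auto simp: e_tilde_def)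
    finally show ?thesis .
  next
    case False
    define r where "r = t - \<theta>0"
    have r: "0 \<le> r" using False by (simp add: r_def)
    have Pt: "P t x = P r x \<bind> P \<theta>0"
    proof -
      have "P (r + \<theta>0) x = P r x \<bind> P \<theta>0" using semigroup r \<theta>0 by (auto simp: markov_semigroup_def)
      then show ?thesis by (simp add: r_def)
    qed
    have inv: "\<nu> \<bind> P \<theta>0 = \<nu>" using invariant \<theta>0 by (auto simp: invariant_distribution_def)
    define g where "g = (\<lambda>x. \<integral>y. f y \<partial>P \<theta>0 x)"
    have K: "P \<theta>0 \<in> borel \<rightarrow>\<^sub>M prob_algebra borel" using P_kernel \<theta>0 by simp
    have g: "g \<in> borel_measurable borel" unfolding g_def by (rule integral_bind_bounded(2)[OF \<nu>_prob K f f1])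
    have g1: "\<bar>g x\<bar> \<le> 1" for x unfolding g_def using P_prob \<theta>0 by (intro prob_integrable_bounded f f1) auto
    have s: "(SUP x. \<bar>f x\<bar>) \<le> 1" using f1 by (intro cSUP_least) auto
    have "bounded (range f)" using f1 by (auto simp: bounded_iff intro!: exI[of _ 1])
    then have "(c * (SUP x. \<bar>f x\<bar>))-lipschitz_on UNIV g" unfolding g_def using smoothing f by blast
    then have L: "c-lipschitz_on UNIV g" by (rule lipschitz_on_le) (use mult_left_mono[OF s, of c] c in simp)
    have "\<bar>(\<integral>x. g x \<partial>P r x) - (\<integral>x. g x \<partial>\<nu>)\<bar> \<le> c * (\<psi> x * e r)"
      using \<psi>0 e0 r
      by (intro integral_diff_le_wasserstein[OF P_prob[OF r] \<nu>_prob g g1 L wasserstein_decay[OF r]]) auto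
    also have "(\<integral>x. g x \<partial>P r x) = (\<integral>x. f x \<partial>P t x)"
      unfolding Pt g_def by (rule integral_bind_bounded(1)[OF P_prob[OF r] K f f1, symmetric])
    also have "(\<integral>x. g x \<partial>\<nu>) = (\<integral>x. f x \<partial>\<nu>)"
      using integral_bind_bounded(1)[OF \<nu>_prob K f f1] unfolding inv g_def by simp
    also have "c * (\<psi> x * e r) \<le> \<phi> x * et t"
    proof -
      have "\<psi> x * (c * e r) \<le> \<phi> x * et t"
        using \<phi>_ge[of x] False c e0[OF r] \<psi>0[of x]
        by (intro mult_mono) (auto simp: e_tilde_def r_def split: split_indicator)
      then show ?thesis by (simp add: mult_ac)
    qed
    finally show ?thesis .
  qed
qed

lemma measure_decay:
  assumes t: "0 \<le> t" and A: "A \<in> sets borel"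
  shows "\<bar>measure (P t x) A - measure \<nu> A\<bar> \<le> \<phi> x * et t"
proof -
  have "\<bar>(\<integral>x. indicator A x \<partial>P t x) - (\<integral>x. indicator A x \<partial>\<nu>)\<bar> \<le> tv_norm (P t x) \<nu>"
    using A by (intro integral_diff_le_tv_norm P_prob t \<nu>_prob) (auto split: split_indicator)
  then show ?thesis using tv_decay[OF t, of x] A prob_algebra_simps(3)[OF P_prob[OF t, of x]] prob_algebra_simps(3)[OF \<nu>_prob]
    by simp
qed

text \<open>An integrable function on a half line cannot be bounded away from zero.\<close>

lemma et_arbitrarily_small:
  assumes \<delta>: "0 < \<delta>" shows "\<exists>t\<ge>0. et t < \<delta>"
proof (rule ccontr)
  assume n: "\<not> ?thesis"
  define I where "I = (\<integral>\<^sup>+t. ennreal (norm (indicator {0..} t *\<^sub>R et t)) \<partial>lborel)"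
  have "I < \<infinity>"
    using et_integrable unfolding set_integrable_def integrable_iff_bounded I_def by simp
  then obtain i where i: "I = ennreal i" "0 \<le> i" using less_top_ennreal[of I] by auto
  define r where "r = (i + 1) / \<delta>"
  have r: "0 \<le> r" "\<delta> * r = i + 1" using i \<delta> by (auto simp: r_def)
  have "ennreal (\<delta> * r) = (\<integral>\<^sup>+t. ennreal \<delta> * indicator {0..r} t \<partial>lborel)"
    using r(1) \<delta> by (simp add: nn_integral_cmult ennreal_mult)
  also have "\<dots> \<le> I"
    unfolding I_def
  proof (intro nn_integral_mono)
    fix t :: real
    show "ennreal \<delta> * indicator {0..r} t \<le> ennreal (norm (indicator {0..} t *\<^sub>R et t))"
      using n et_nonneg[of t] by (cases "t \<in> {0..r}") (auto intro!: ennreal_leI simp: not_less)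
  qed
  finally show False using i r by simp
qed

end

locale regularizing_semigroup_moments = regularizing_semigroup P \<nu> \<psi> e \<theta>0 c
  for P :: "real \<Rightarrow> 'a::euclidean_space \<Rightarrow> 'a measure" and \<nu> \<psi> e \<theta>0 c +
  fixes \<mu>0 :: "'a measure" and q :: real
  assumes q: "1 < q" and \<mu>0: "\<mu>0 \<in> space (prob_algebra borel)"
    and moments: "(SUP t\<in>{0..}. \<integral>\<^sup>+y. ennreal (\<psi> y powr q + norm y powr q) \<partial>(\<mu>0 \<bind> P t)) < \<infinity>"
begin

lemma \<mu>0P_prob: "0 \<le> t \<Longrightarrow> \<mu>0 \<bind> P t \<in> space (prob_algebra borel)"
  using prob_space_bind'[OF \<mu>0 P_kernel] sets_bind'[OF \<mu>0 P_kernel] by (simp add: space_prob_algebra)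

lemma \<mu>0P0: "\<mu>0 \<bind> P 0 = \<mu>0"
proof -
  have "P 0 = return borel" using semigroup by (auto simp: markov_semigroup_def)
  then show ?thesis using bind_return''[of \<mu>0 borel] prob_algebra_simps(2)[OF \<mu>0] by simp
qed

definition moment_sup :: ennreal where
  "moment_sup = (SUP t\<in>{0..}. \<integral>\<^sup>+y. ennreal (\<phi> y powr q + norm y powr q) \<partial>(\<mu>0 \<bind> P t))"

lemma moment_sup_finite: "moment_sup < \<infinity>"
proof -
  let ?R = "SUP t\<in>{0..}. \<integral>\<^sup>+y. ennreal (\<psi> y powr q + norm y powr q) \<partial>(\<mu>0 \<bind> P t)"
  have "moment_sup \<le> ?R + 1"
    unfolding moment_sup_def
  proof (rule SUP_least)
    fix t :: real assume t: "t \<in> {0..}"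
    interpret prob_space "\<mu>0 \<bind> P t" using \<mu>0P_prob[of t] t by (simp add: space_prob_algebra)
    have Sb[measurable_cong]: "sets (\<mu>0 \<bind> P t) = sets borel" using \<mu>0P_prob[of t] t by (simp add: space_prob_algebra)
    have "(\<integral>\<^sup>+y. ennreal (\<phi> y powr q + norm y powr q) \<partial>(\<mu>0 \<bind> P t))
      \<le> (\<integral>\<^sup>+y. ennreal (\<psi> y powr q + norm y powr q) + 1 \<partial>(\<mu>0 \<bind> P t))"
    proof (intro nn_integral_mono)
      fix y
      have "\<phi> y powr q \<le> \<psi> y powr q + 1" by (auto simp: psi_tilde_def max_def)
      then show "ennreal (\<phi> y powr q + norm y powr q) \<le> ennreal (\<psi> y powr q + norm y powr q) + 1"
        by (simp add: ennreal_plus[symmetric] ennreal_leI flip: ennreal_1 del: ennreal_plus)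
    qed
    also have "\<dots> = (\<integral>\<^sup>+y. ennreal (\<psi> y powr q + norm y powr q) \<partial>(\<mu>0 \<bind> P t)) + 1"
      by (subst nn_integral_add) (auto simp: emeasure_space_1)
    also have "\<dots> \<le> ?R + 1" by (intro add_right_mono SUP_upper t)
    finally show "(\<integral>\<^sup>+y. ennreal (\<phi> y powr q + norm y powr q) \<partial>(\<mu>0 \<bind> P t)) \<le> ?R + 1" .
  qed
  also have "\<dots> < \<infinity>" using moments by simp
  finally show ?thesis .
qed

lemma \<phi>_moment_le:
  assumes "0 \<le> t" shows "(\<integral>\<^sup>+y. ennreal (\<phi> y powr q) \<partial>(\<mu>0 \<bind> P t)) \<le> moment_sup"
proof -
  have "(\<integral>\<^sup>+y. ennreal (\<phi> y powr q) \<partial>(\<mu>0 \<bind> P t)) \<le> (\<integral>\<^sup>+y. ennreal (\<phi> y powr q + norm y powr q) \<partial>(\<mu>0 \<bind> P t))"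
    by (intro nn_integral_mono ennreal_leI) simp
  also have "\<dots> \<le> moment_sup" unfolding moment_sup_def using assms by (intro SUP_upper) simp
  finally show ?thesis .
qed

lemma moment_le:
  assumes "0 \<le> t" shows "moment q (\<mu>0 \<bind> P t) \<le> moment_sup"
proof -
  have "moment q (\<mu>0 \<bind> P t) \<le> (\<integral>\<^sup>+y. ennreal (\<phi> y powr q + norm y powr q) \<partial>(\<mu>0 \<bind> P t))"
    unfolding moment_def by (intro nn_integral_mono ennreal_leI) simp
  also have "\<dots> \<le> moment_sup" unfolding moment_sup_def using assms by (intro SUP_upper) simp
  finally show ?thesis .
qed

text \<open>The invariant law inherits the moments of \<open>\<mu>0 \<bind> P t\<close>: for bounded truncations of \<open>norm y powr q\<close> the
total variation bound, integrated over \<open>\<mu>0\<close>, brings the two integrals within distance one at a suitable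
time, and the truncation is removed by monotone convergence.\<close>

lemma \<nu>_moment_le: "moment q \<nu> \<le> moment_sup + 1"
proof -
  interpret \<nu>: prob_space \<nu> by (rule prob_algebra_simps[OF \<nu>_prob])
  have moment_sup\<nu>[measurable_cong]: "sets \<nu> = sets borel" by (rule prob_algebra_simps[OF \<nu>_prob])
  have S0[measurable_cong]: "sets \<mu>0 = sets borel" by (rule prob_algebra_simps[OF \<mu>0])
  interpret \<mu>0: prob_space \<mu>0 by (rule prob_algebra_simps[OF \<mu>0])
  define m where "m = (\<integral>\<^sup>+x. ennreal (\<phi> x) \<partial>\<mu>0)"
  have "m \<le> (\<integral>\<^sup>+x. ennreal (\<phi> x powr q) \<partial>(\<mu>0 \<bind> P 0))"
    unfolding m_def \<mu>0P0
  proof (intro nn_integral_mono ennreal_leI)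
    fix x have "\<phi> x powr 1 \<le> \<phi> x powr q" using q \<phi>_ge[of x] by (intro powr_mono) auto
    then show "\<phi> x \<le> \<phi> x powr q" using \<phi>_ge(1)[of x] by simp
  qed
  also have "\<dots> < \<infinity>" using \<phi>_moment_le[of 0] moment_sup_finite by (simp add: order_le_less_trans)
  finally obtain m' where m': "m = ennreal m'" "0 \<le> m'" using less_top_ennreal[of m] by auto
  have trunc: "(\<integral>\<^sup>+y. ennreal (min (norm y powr q) (real R)) \<partial>\<nu>) \<le> moment_sup + 1" for R :: nat
  proof -
    obtain t where t: "0 \<le> t" "et t < 1 / (real R * m' + 1)"
      using et_arbitrarily_small[of "1 / (real R * m' + 1)"] m' by (auto simp: add_nonneg_pos)
    define f where "f y = min (norm y powr q) (real R)" for y :: 'a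
    have f[measurable]: "f \<in> borel_measurable borel" unfolding f_def by measurable
    have f0: "0 \<le> f y" "f y \<le> R" for y by (auto simp: f_def)
    have "ennreal (\<integral>y. f y \<partial>\<nu>) \<le> (\<integral>\<^sup>+y. f y \<partial>P t x) + ennreal (real R * et t) * ennreal (\<phi> x)" for x
    proof -
      interpret Px: prob_space "P t x" by (rule prob_algebra_simps[OF P_prob[OF t(1)]])
      have SP[measurable_cong]: "sets (P t x) = sets borel" by (rule prob_algebra_simps[OF P_prob[OF t(1)]])
      have fb: "\<bar>f y\<bar> \<le> R" for y using f0[of y] by simp
      have "\<bar>(\<integral>y. f y / R \<partial>P t x) - (\<integral>y. f y / R \<partial>\<nu>)\<bar> \<le> tv_norm (P t x) \<nu>"
      proof (intro integral_diff_le_tv_norm P_prob t \<nu>_prob)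
        show "\<bar>f y / real R\<bar> \<le> 1" for y using f0[of y] by (cases "R = 0") (auto simp: field_simps)
      qed measurable
      also have "\<dots> \<le> \<phi> x * et t" by (rule tv_decay[OF t(1)])
      finally have "real R * \<bar>(\<integral>y. f y / R \<partial>P t x) - (\<integral>y. f y / R \<partial>\<nu>)\<bar> \<le> real R * (\<phi> x * et t)"
        by (intro mult_left_mono) auto
      moreover have "real R * \<bar>(\<integral>y. f y / R \<partial>P t x) - (\<integral>y. f y / R \<partial>\<nu>)\<bar> = \<bar>(\<integral>y. f y \<partial>P t x) - (\<integral>y. f y \<partial>\<nu>)\<bar>"
      proof (cases "R = 0")
        case True
        then have "f y = 0" for y using f0[of y] by simp
        then show ?thesis by simp
      next
        case False
        then show ?thesis by (simp add: diff_divide_distrib[symmetric])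
      qed
      ultimately have "\<bar>(\<integral>y. f y \<partial>P t x) - (\<integral>y. f y \<partial>\<nu>)\<bar> \<le> real R * (\<phi> x * et t)" by simp
      also have "\<dots> = real R * et t * \<phi> x" by (simp only: ac_simps)
      finally have "(\<integral>y. f y \<partial>\<nu>) \<le> (\<integral>y. f y \<partial>P t x) + real R * et t * \<phi> x" by linarith
      then have "ennreal (\<integral>y. f y \<partial>\<nu>) \<le> ennreal ((\<integral>y. f y \<partial>P t x) + real R * et t * \<phi> x)"
        by (rule ennreal_leI)
      also have "\<dots> = ennreal (\<integral>y. f y \<partial>P t x) + ennreal (real R * et t) * ennreal (\<phi> x)"
        using f0 \<phi>_ge(1)[of x] et_nonneg[OF t(1)]
        by (subst ennreal_plus) (auto intro!: integral_nonneg_AE AE_I2 simp: ennreal_mult[symmetric])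
      also have "ennreal (\<integral>y. f y \<partial>P t x) = (\<integral>\<^sup>+y. f y \<partial>P t x)"
        using f0 by (intro nn_integral_eq_integral[symmetric] prob_integrable_bounded(1)[OF P_prob[OF t(1)] f fb]) auto
      finally show ?thesis .
    qed
    then have "(\<integral>\<^sup>+x. ennreal (\<integral>y. f y \<partial>\<nu>) \<partial>\<mu>0)
        \<le> (\<integral>\<^sup>+x. (\<integral>\<^sup>+y. f y \<partial>P t x) + ennreal (real R * et t) * ennreal (\<phi> x) \<partial>\<mu>0)"
      by (intro nn_integral_mono)
    also have "\<dots> = (\<integral>\<^sup>+x. (\<integral>\<^sup>+y. f y \<partial>P t x) \<partial>\<mu>0) + ennreal (real R * et t) * m"
    proof -
      have "(\<lambda>x. \<integral>\<^sup>+y. f y \<partial>P t x) \<in> borel_measurable borel"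
        by (rule nn_integral_measurable_subprob_algebra2[where N=borel])
          (use measurable_prob_algebraD[OF P_kernel[OF t(1)]] in auto)
      then show ?thesis unfolding m_def
        by (subst nn_integral_add) (auto simp: nn_integral_cmult)
    qed
    also have "(\<integral>\<^sup>+x. (\<integral>\<^sup>+y. f y \<partial>P t x) \<partial>\<mu>0) = (\<integral>\<^sup>+y. f y \<partial>(\<mu>0 \<bind> P t))"
    proof (rule nn_integral_bind[symmetric])
      show "P t \<in> \<mu>0 \<rightarrow>\<^sub>M subprob_algebra borel"
        using measurable_prob_algebraD[OF P_kernel[OF t(1)]] by (simp add: measurable_cong_sets[OF S0 refl])
    qed measurable
    also have "\<dots> \<le> moment q (\<mu>0 \<bind> P t)"
      unfolding moment_def f_def by (intro nn_integral_mono ennreal_leI) simp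
    also have "\<dots> \<le> moment_sup" by (rule moment_le[OF t(1)])
    also have "ennreal (real R * et t) * m \<le> 1"
    proof -
      have "et t * (real R * m' + 1) \<le> 1" using t(2) m' by (simp add: pos_less_divide_eq add_nonneg_pos)
      moreover have "0 \<le> et t" by (rule et_nonneg[OF t(1)])
      ultimately have "real R * et t * m' \<le> 1" by (simp add: distrib_left mult_ac)
      then show ?thesis using m' et_nonneg[OF t(1)]
        by (simp add: ennreal_mult[symmetric] flip: ennreal_1)
    qed
    also have "(\<integral>\<^sup>+x. ennreal (\<integral>y. f y \<partial>\<nu>) \<partial>\<mu>0) = (\<integral>\<^sup>+y. f y \<partial>\<nu>)"
    proof -
      have "\<bar>f y\<bar> \<le> R" for y using f0[of y] by simp
      from prob_integrable_bounded(1)[OF \<nu>_prob f this] show ?thesis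
        using f0 by (subst nn_integral_eq_integral) (auto simp: \<mu>0.emeasure_space_1)
    qed
    finally show ?thesis by (simp add: f_def add_mono)
  qed
  have "moment q \<nu> = (\<integral>\<^sup>+y. (SUP R. ennreal (min (norm y powr q) (real R))) \<partial>\<nu>)"
    unfolding moment_def
  proof (intro nn_integral_cong antisym SUP_least)
    fix y :: 'a
    obtain R :: nat where "norm y powr q \<le> real R" using real_arch_simple by blast
    then show "ennreal (norm y powr q) \<le> (SUP R. ennreal (min (norm y powr q) (real R)))"
      by (intro SUP_upper2[of R]) auto
  qed (auto intro: ennreal_leI)
  also have "\<dots> = (SUP R. \<integral>\<^sup>+y. ennreal (min (norm y powr q) (real R)) \<partial>\<nu>)"
    by (rule nn_integral_monotone_convergence_SUP) (auto simp: incseq_def le_fun_def intro!: ennreal_leI)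
  also have "\<dots> \<le> moment_sup + 1" by (intro SUP_least trunc)
  finally show ?thesis .
qed

end

section \<open>Uniform times, right limits and half sums\<close>

lemma uniform_time_facts:
  assumes t: "0 < t"
  shows "space (uniform_time t) = {0..t}" "prob_space (uniform_time t)"
    and "(\<lambda>s. s) \<in> uniform_time t \<rightarrow>\<^sub>M borel"
    and "f \<in> borel_measurable borel \<Longrightarrow> (\<integral>\<^sup>+s. f s \<partial>uniform_time t) \<le> (\<integral>\<^sup>+s. f s \<partial>lborel) / ennreal t"
proof -
  let ?R = "restrict_space lborel {0..t}"
  have A: "{0..t} \<in> sets ?R" by (auto simp: sets_restrict_space)
  have e: "emeasure ?R {0..t} = ennreal t" using t by (simp add: emeasure_restrict_space)
  show "space (uniform_time t) = {0..t}" by (simp add: uniform_time_def)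
  show "prob_space (uniform_time t)"
    unfolding uniform_time_def using t by (intro prob_space_uniform_measure) (auto simp: e)
  have id: "(\<lambda>s. s) \<in> ?R \<rightarrow>\<^sub>M borel" by (rule measurable_restrict_space1) simp
  then show "(\<lambda>s. s) \<in> uniform_time t \<rightarrow>\<^sub>M borel"
    unfolding uniform_time_def by (simp add: measurable_cong_sets[OF sets_uniform_measure refl])
  assume f: "f \<in> borel_measurable borel"
  have fR: "f \<in> borel_measurable ?R" using measurable_compose[OF id f] by simp
  have "(\<integral>\<^sup>+s. f s \<partial>uniform_time t) = (\<integral>\<^sup>+s. f s * indicator {0..t} s \<partial>?R) / ennreal t"
    unfolding uniform_time_def by (simp add: nn_integral_uniform_measure[OF fR A] e)
  also have "\<dots> \<le> (\<integral>\<^sup>+s. f s \<partial>lborel) / ennreal t"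
  proof (rule divide_right_mono_ennreal)
    have "(\<integral>\<^sup>+s. f s * indicator {0..t} s \<partial>?R) = (\<integral>\<^sup>+s. f s * indicator {0..t} s * indicator {0..t} s \<partial>lborel)"
      by (rule nn_integral_restrict_space) simp
    also have "\<dots> \<le> (\<integral>\<^sup>+s. f s \<partial>lborel)" by (intro nn_integral_mono) (auto split: split_indicator)
    finally show "(\<integral>\<^sup>+s. f s * indicator {0..t} s \<partial>?R) \<le> (\<integral>\<^sup>+s. f s \<partial>lborel)" .
  qed
  finally show "(\<integral>\<^sup>+s. f s \<partial>uniform_time t) \<le> (\<integral>\<^sup>+s. f s \<partial>lborel) / ennreal t" .
qed

text \<open>Grid points strictly to the right of \<open>s\<close>. They reduce the measurability of a right-continuous process to
countably many of its variables.\<close>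

lemma right_approximation:
  fixes s :: real
  shows "filterlim (\<lambda>n. (of_int \<lfloor>real (Suc n) * s\<rfloor> + 1) / real (Suc n)) (at_right s) sequentially"
  unfolding filterlim_at
proof
  show "\<forall>\<^sub>F n in sequentially. (of_int \<lfloor>real (Suc n) * s\<rfloor> + 1) / real (Suc n) \<in> {s<..}
    \<and> (of_int \<lfloor>real (Suc n) * s\<rfloor> + 1) / real (Suc n) \<noteq> s"
  proof (rule always_eventually, rule allI)
    fix n
    have l: "real (Suc n) * s < of_int \<lfloor>real (Suc n) * s\<rfloor> + 1" by linarith
    then have "s < (of_int \<lfloor>real (Suc n) * s\<rfloor> + 1) / real (Suc n)"
      by (simp add: pos_less_divide_eq mult.commute del: of_nat_Suc)
    then show "(of_int \<lfloor>real (Suc n) * s\<rfloor> + 1) / real (Suc n) \<in> {s<..} \<and> (of_int \<lfloor>real (Suc n) * s\<rfloor> + 1) / real (Suc n) \<noteq> s"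
      by simp
  qed
next
  show "(\<lambda>n. (of_int \<lfloor>real (Suc n) * s\<rfloor> + 1) / real (Suc n)) \<longlonglongrightarrow> s"
  proof (rule tendsto_sandwich[OF _ _ tendsto_const LIMSEQ_inverse_real_of_nat_add])
    have "s \<le> (of_int \<lfloor>real (Suc n) * s\<rfloor> + 1) / real (Suc n)" for n
    proof -
      have "real (Suc n) * s \<le> of_int \<lfloor>real (Suc n) * s\<rfloor> + 1" by linarith
      then show ?thesis by (simp add: pos_le_divide_eq mult.commute del: of_nat_Suc)
    qed
    then show "\<forall>\<^sub>F n in sequentially. s \<le> (of_int \<lfloor>real (Suc n) * s\<rfloor> + 1) / real (Suc n)" by simp
    have "(of_int \<lfloor>real (Suc n) * s\<rfloor> + 1) / real (Suc n) \<le> s + inverse (real (Suc n))" for n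
    proof -
      have "of_int \<lfloor>real (Suc n) * s\<rfloor> + 1 \<le> real (Suc n) * s + 1" by linarith
      then have "(of_int \<lfloor>real (Suc n) * s\<rfloor> + 1) / real (Suc n) \<le> (real (Suc n) * s + 1) / real (Suc n)"
        by (rule divide_right_mono) simp
      also have "\<dots> = s + inverse (real (Suc n))" by (simp add: field_simps del: of_nat_Suc)
      finally show ?thesis .
    qed
    then show "\<forall>\<^sub>F n in sequentially. (of_int \<lfloor>real (Suc n) * s\<rfloor> + 1) / real (Suc n) \<le> s + inverse (real (Suc n))"
      by simp
  qed
qed

text \<open>The half sum is the law of a draw from \<open>\<mu>\<close> or \<open>\<nu>\<close> decided by a fair coin.\<close>

lemma half_sum_mixture:
  fixes \<mu> \<nu> :: "'a::euclidean_space measure"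
  assumes \<mu>: "\<mu> \<in> space (prob_algebra borel)" and \<nu>: "\<nu> \<in> space (prob_algebra borel)"
  shows "half_sum \<mu> \<nu> \<in> space (prob_algebra borel)"
    and "A \<in> sets borel \<Longrightarrow> measure (half_sum \<mu> \<nu>) A = (measure \<mu> A + measure \<nu> A) / 2"
    and "f \<in> borel_measurable borel \<Longrightarrow> (\<integral>\<^sup>+x. f x \<partial>half_sum \<mu> \<nu>) \<le> (\<integral>\<^sup>+x. f x \<partial>\<mu>) + (\<integral>\<^sup>+x. f x \<partial>\<nu>)"
proof -
  let ?K = "\<lambda>b. if b then \<mu> else \<nu>"
  let ?B = "measure_pmf (bernoulli_pmf (1 / 2))"
  interpret \<mu>: prob_space \<mu> by (rule prob_algebra_simps[OF \<mu>])
  interpret \<nu>: prob_space \<nu> by (rule prob_algebra_simps[OF \<nu>])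
  have Kp: "?K b \<in> space (prob_algebra borel)" for b using \<mu> \<nu> by simp
  have K: "?K \<in> ?B \<rightarrow>\<^sub>M subprob_algebra borel"
    using Kp by (auto simp: space_prob_algebra space_subprob_algebra prob_space_imp_subprob_space)
  have h: "x / 2 = x * ennreal (1 / 2)" for x :: ennreal
    using inverse_ennreal[of 2] by (simp add: divide_ennreal_def inverse_eq_divide)
  have mix: "(\<integral>\<^sup>+x. f x \<partial>(?B \<bind> ?K)) = ((\<integral>\<^sup>+x. f x \<partial>\<mu>) + (\<integral>\<^sup>+x. f x \<partial>\<nu>)) / 2"
    if "f \<in> borel_measurable borel" for f
  proof -
    show ?thesis
      by (subst nn_integral_bind[OF that K]) (simp add: h distrib_right)
  qed
  have e: "emeasure (?B \<bind> ?K) A = (emeasure \<mu> A + emeasure \<nu> A) / 2" if A: "A \<in> sets borel" for A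
  proof -
    have "emeasure (?B \<bind> ?K) A = (\<integral>\<^sup>+x. indicator A x \<partial>(?B \<bind> ?K))"
      using A by (subst nn_integral_indicator) (simp_all add: sets_bind[OF sets_kernel[OF K]])
    then show ?thesis using A mix[of "indicator A"] prob_algebra_simps(2)[OF \<mu>] prob_algebra_simps(2)[OF \<nu>] by simp
  qed
  have sB: "sets (?B \<bind> ?K) = sets borel" by (subst sets_bind[OF sets_kernel[OF K]]) auto
  have eq: "half_sum \<mu> \<nu> = ?B \<bind> ?K"
  proof (rule measure_eqI)
    show s: "sets (half_sum \<mu> \<nu>) = sets (?B \<bind> ?K)"
      unfolding sB half_sum_def by (simp add: sets.sigma_sets_eq[of borel, simplified])
    fix A assume "A \<in> sets (half_sum \<mu> \<nu>)"
    then have A: "A \<in> sets borel" unfolding s sB by simp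
    have "emeasure (half_sum \<mu> \<nu>) A = (emeasure \<mu> A + emeasure \<nu> A) / 2"
    proof (rule emeasure_measure_of[OF half_sum_def])
      show "countably_additive (sets (half_sum \<mu> \<nu>)) (\<lambda>A. (emeasure \<mu> A + emeasure \<nu> A) / 2)"
        unfolding countably_additive_def
      proof (intro allI impI)
        fix F :: "nat \<Rightarrow> 'a set" assume F: "range F \<subseteq> sets (half_sum \<mu> \<nu>)" "disjoint_family F" "\<Union> (range F) \<in> sets (half_sum \<mu> \<nu>)"
        then have Fb: "range F \<subseteq> sets borel" unfolding s sB by simp
        have "(\<Sum>i. (emeasure \<mu> (F i) + emeasure \<nu> (F i)) / 2) = (\<Sum>i. emeasure (?B \<bind> ?K) (F i))"
          using Fb by (intro suminf_cong) (auto simp: e)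
        also have "\<dots> = emeasure (?B \<bind> ?K) (\<Union> (range F))"
          using F by (intro suminf_emeasure) (auto simp: s)
        also have "\<dots> = (emeasure \<mu> (\<Union> (range F)) + emeasure \<nu> (\<Union> (range F))) / 2"
          using Fb by (intro e sets.countable_UN) auto
        finally show "(\<Sum>i. (emeasure \<mu> (F i) + emeasure \<nu> (F i)) / 2) = (emeasure \<mu> (\<Union> (range F)) + emeasure \<nu> (\<Union> (range F))) / 2" .
      qed
    qed (use A s in \<open>auto simp: positive_def half_sum_def\<close>)
    then show "emeasure (half_sum \<mu> \<nu>) A = emeasure (?B \<bind> ?K) A" using e[OF A] by simp
  qed
  have B1: "?B \<in> space (prob_algebra (count_space UNIV))" by (simp add: space_prob_algebra measure_pmf.prob_space_axioms)
  have B2: "?K \<in> count_space UNIV \<rightarrow>\<^sub>M prob_algebra borel" using Kp by simp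
  show "half_sum \<mu> \<nu> \<in> space (prob_algebra borel)"
    unfolding eq using prob_space_bind'[OF B1 B2] sB by (simp add: space_prob_algebra)
  show "measure (half_sum \<mu> \<nu>) A = (measure \<mu> A + measure \<nu> A) / 2" if A: "A \<in> sets borel"
  proof -
    have "emeasure (?B \<bind> ?K) A = ennreal (measure \<mu> A + measure \<nu> A) * ennreal (1 / 2)"
      unfolding e[OF A] h by (simp add: \<mu>.emeasure_eq_measure \<nu>.emeasure_eq_measure)
    also have "\<dots> = ennreal ((measure \<mu> A + measure \<nu> A) * (1 / 2))"
      by (rule ennreal_mult[symmetric]) auto
    finally show ?thesis unfolding eq by (simp add: measure_def[of "?B \<bind> ?K"])
  qed
  show "(\<integral>\<^sup>+x. f x \<partial>half_sum \<mu> \<nu>) \<le> (\<integral>\<^sup>+x. f x \<partial>\<mu>) + (\<integral>\<^sup>+x. f x \<partial>\<nu>)" if f: "f \<in> borel_measurable borel" for f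
  proof -
    have "ennreal (1 / 2) \<le> ennreal 1" by (rule ennreal_leI) simp
    then have "a * ennreal (1 / 2) \<le> a * ennreal 1" for a :: ennreal by (rule mult_left_mono) simp
    then show ?thesis unfolding eq mix[OF f] h by (simp only: ennreal_1 mult_1_right)
  qed
qed

section \<open>The Markov process and its occupation measures\<close>

locale ergodic_process = regularizing_semigroup_moments P \<nu> \<psi> e \<theta>0 c \<mu>0 q + prob_space M
  for P :: "real \<Rightarrow> 'a::euclidean_space \<Rightarrow> 'a measure" and \<nu> \<psi> e \<theta>0 c \<mu>0 q and M :: "'w measure" +
  fixes X :: "real \<Rightarrow> 'w \<Rightarrow> 'a"
  assumes process: "right_continuous_markov_process M X P \<mu>0"
begin

lemma X_measurable: "0 \<le> t \<Longrightarrow> X t \<in> borel_measurable M"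
  using process by (simp add: right_continuous_markov_process_def)

lemma X_jointly_measurable:
  assumes t: "0 < t"
  shows "(\<lambda>z. X (fst z) (snd z)) \<in> borel_measurable (uniform_time t \<Otimes>\<^sub>M M)"
proof (rule borel_measurable_LIMSEQ_metric)
  fix n
  have [measurable]: "fst \<in> borel_measurable (uniform_time t \<Otimes>\<^sub>M M)"
    by (rule measurable_compose[OF measurable_fst uniform_time_facts(3)[OF t]])
  have "(\<lambda>z. X (max 0 ((of_int k + 1) / real (Suc n))) (snd z)) \<in> borel_measurable (uniform_time t \<Otimes>\<^sub>M M)" for k :: int
    by (rule measurable_compose[OF measurable_snd X_measurable]) simp
  then show "(\<lambda>z. X (max 0 ((of_int \<lfloor>real (Suc n) * fst z\<rfloor> + 1) / real (Suc n))) (snd z))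
      \<in> borel_measurable (uniform_time t \<Otimes>\<^sub>M M)"
    by (rule measurable_compose_countable[where g="\<lambda>z. \<lfloor>real (Suc n) * fst z\<rfloor>" and
        f="\<lambda>k z. X (max 0 ((of_int k + 1) / real (Suc n))) (snd z)"]) measurable
next
  fix z assume "z \<in> space (uniform_time t \<Otimes>\<^sub>M M)"
  then have z: "0 \<le> fst z" "snd z \<in> space M" by (auto simp: space_pair_measure uniform_time_facts(1)[OF t])
  have "((\<lambda>s. X s (snd z)) \<longlongrightarrow> X (fst z) (snd z)) (at_right (fst z))"
    using process z by (auto simp: right_continuous_markov_process_def continuous_within)
  then have "(\<lambda>n. X ((of_int \<lfloor>real (Suc n) * fst z\<rfloor> + 1) / real (Suc n)) (snd z)) \<longlonglongrightarrow> X (fst z) (snd z)"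
    by (rule filterlim_compose[OF _ right_approximation])
  moreover have "max 0 ((of_int \<lfloor>real (Suc n) * fst z\<rfloor> + 1) / real (Suc n)) = (of_int \<lfloor>real (Suc n) * fst z\<rfloor> + 1) / real (Suc n)" for n
    using z by (intro max_absorb2 divide_nonneg_nonneg) auto
  ultimately show "(\<lambda>n. X (max 0 ((of_int \<lfloor>real (Suc n) * fst z\<rfloor> + 1) / real (Suc n))) (snd z)) \<longlonglongrightarrow> X (fst z) (snd z)"
    by simp
qed

lemma X_jointly_measurable':
  assumes t: "0 < t"
  shows "(\<lambda>z. X (snd z) (fst z)) \<in> borel_measurable (M \<Otimes>\<^sub>M uniform_time t)"
proof -
  have "(\<lambda>z. (\<lambda>z. X (fst z) (snd z)) (case z of (x, y) \<Rightarrow> (y, x))) \<in> borel_measurable (M \<Otimes>\<^sub>M uniform_time t)"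
    by (rule measurable_compose[OF measurable_pair_swap' X_jointly_measurable[OF t]])
  then show ?thesis by (simp add: case_prod_unfold)
qed

lemma path_measurable: "0 < t \<Longrightarrow> \<omega> \<in> space M \<Longrightarrow> (\<lambda>s. X s \<omega>) \<in> uniform_time t \<rightarrow>\<^sub>M borel"
  using measurable_compose[OF measurable_Pair2' X_jointly_measurable] by simp

lemma subalgebra_past: "0 \<le> s \<Longrightarrow> finite_measure_subalgebra M (past M X s)"
proof -
  assume s: "0 \<le> s"
  have "(\<Union>u\<in>{0..s}. {X u -` B \<inter> space M | B. B \<in> sets borel}) \<subseteq> sets M"
    using measurable_sets[OF X_measurable] by auto
  then have "subalgebra M (past M X s)"
    unfolding subalgebra_def past_def
    by (auto simp: sets_measure_of_conv space_measure_of_conv intro!: sets.sigma_sets_subset)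
  then show ?thesis by unfold_locales
qed

lemma X_adapted: "0 \<le> s \<Longrightarrow> X s \<in> borel_measurable (past M X s)"
proof (rule measurableI)
  assume s: "0 \<le> s"
  have sp: "space (past M X s) = space M" by (simp add: past_def space_measure_of_conv)
  show "X s \<omega> \<in> space borel" for \<omega> by simp
  fix A :: "'a set" assume A: "A \<in> sets borel"
  have "(\<Union>u\<in>{0..s}. {X u -` B \<inter> space M | B. B \<in> sets borel}) \<subseteq> Pow (space M)" by auto
  then show "X s -` A \<inter> space (past M X s) \<in> sets (past M X s)"
    unfolding sp unfolding past_def using A s by (auto simp: sets_measure_of intro!: sigma_sets.Basic bexI[of _ s] exI[of _ A])
qed

text \<open>The Markov property in the form in which it is used: the future indicator may be replaced by its
transition probability under the integral against a function of the present.\<close>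

lemma integral_past:
  assumes s: "0 \<le> s" and r: "0 \<le> r" and A: "A \<in> sets borel"
    and f: "f \<in> borel_measurable borel" and f1: "\<And>x. \<bar>f x\<bar> \<le> (1::real)"
  shows "(\<integral>\<omega>. f (X s \<omega>) * indicator A (X (s + r) \<omega>) \<partial>M) = (\<integral>\<omega>. f (X s \<omega>) * measure (P r (X s \<omega>)) A \<partial>M)"
proof -
  interpret F: finite_measure_subalgebra M "past M X s" by (rule subalgebra_past[OF s])
  note [measurable] = X_measurable[OF s] f A
  have [measurable]: "X (s + r) \<in> borel_measurable M" using s r by (intro X_measurable) simp
  have fF: "(\<lambda>\<omega>. f (X s \<omega>)) \<in> borel_measurable (past M X s)"
    by (rule measurable_compose[OF X_adapted[OF s] f])
  have Pm[measurable]: "(\<lambda>x. measure (P r x) A) \<in> borel_measurable borel"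
    by (rule measure_measurable_prob_algebra2[where N=borel]) (use P_kernel[OF r] A in auto)
  have i: "integrable M (\<lambda>\<omega>. f (X s \<omega>) * indicator A (X (s + r) \<omega>))"
    using f1 by (intro integrable_const_bound[where B=1]) (auto simp: abs_mult split: split_indicator)
  have "(\<integral>\<omega>. f (X s \<omega>) * indicator A (X (s + r) \<omega>) \<partial>M)
      = (\<integral>\<omega>. f (X s \<omega>) * real_cond_exp M (past M X s) (\<lambda>\<omega>. indicator A (X (s + r) \<omega>)) \<omega> \<partial>M)"
    by (rule F.real_cond_exp_intg(2)[OF i fF, symmetric]) measurable
  also have "\<dots> = (\<integral>\<omega>. f (X s \<omega>) * measure (P r (X s \<omega>)) A \<partial>M)"
  proof (rule integral_cong_AE)
    have "AE \<omega> in M. real_cond_exp M (past M X s) (\<lambda>\<omega>. indicator A (X (s + r) \<omega>)) \<omega> = measure (P r (X s \<omega>)) A"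
      using process s r A unfolding right_continuous_markov_process_def by blast
    then show "AE \<omega> in M. f (X s \<omega>) * real_cond_exp M (past M X s) (\<lambda>\<omega>. indicator A (X (s + r) \<omega>)) \<omega> = f (X s \<omega>) * measure (P r (X s \<omega>)) A"
      by eventually_elim simp
  qed measurable
  finally show ?thesis .
qed

text \<open>The Markov property from time \<open>0\<close>, integrated over the initial law.\<close>

lemma law_X:
  assumes t: "0 \<le> t" shows "distr M borel (X t) = \<mu>0 \<bind> P t"
proof (rule measure_eqI)
  have S: "sets (\<mu>0 \<bind> P t) = sets borel" using \<mu>0P_prob[OF t] by (simp add: space_prob_algebra)
  then show "sets (distr M borel (X t)) = sets (\<mu>0 \<bind> P t)" by simp
  fix A assume "A \<in> sets (distr M borel (X t))"
  then have A[measurable]: "A \<in> sets borel" by simp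
  note [measurable] = X_measurable[of 0, simplified] X_measurable[OF t]
  have D: "distr M borel (X 0) = \<mu>0" using process by (simp add: right_continuous_markov_process_def)
  have Pm: "(\<lambda>x. measure (P t x) A) \<in> borel_measurable borel"
    by (rule measure_measurable_prob_algebra2[where N=borel]) (use P_kernel[OF t] A in auto)
  have K: "P t \<in> \<mu>0 \<rightarrow>\<^sub>M subprob_algebra borel"
    using measurable_prob_algebraD[OF P_kernel[OF t]] by (simp add: measurable_cong_sets[OF prob_algebra_simps(2)[OF \<mu>0] refl])
  have p1: "measure (P t x) A \<le> 1" for x
    using prob_algebra_simps(1)[OF P_prob[OF t, of x]] by (simp add: prob_space.prob_le_1)
  have "emeasure (distr M borel (X t)) A = ennreal (\<integral>\<omega>. indicat_real A (X t \<omega>) \<partial>M)"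
  proof -
    have "(\<integral>\<omega>. indicat_real A (X t \<omega>) \<partial>M) = (\<integral>\<omega>. indicat_real (X t -` A \<inter> space M) \<omega> \<partial>M)"
      by (rule Bochner_Integration.integral_cong) (auto split: split_indicator)
    then show ?thesis by (simp add: emeasure_distr emeasure_eq_measure)
  qed
  also have "(\<integral>\<omega>. indicat_real A (X t \<omega>) \<partial>M) = (\<integral>\<omega>. measure (P t (X 0 \<omega>)) A \<partial>M)"
    using integral_past[of 0 t A "\<lambda>_. 1"] t A by simp
  also have "\<dots> = (\<integral>x. measure (P t x) A \<partial>\<mu>0)"
    unfolding D[symmetric] by (rule integral_distr[symmetric]) (use Pm in auto)
  also have "ennreal \<dots> = (\<integral>\<^sup>+x. ennreal (measure (P t x) A) \<partial>\<mu>0)"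
    using p1 by (intro nn_integral_eq_integral[symmetric] prob_integrable_bounded(1)[OF \<mu>0 Pm, of 1]) auto
  also have "\<dots> = (\<integral>\<^sup>+x. emeasure (P t x) A \<partial>\<mu>0)"
    using prob_algebra_simps(1)[OF P_prob[OF t]]
    by (intro nn_integral_cong) (simp add: finite_measure.emeasure_eq_measure prob_space.finite_measure)
  also have "\<dots> = emeasure (\<mu>0 \<bind> P t) A"
    using prob_algebra_simps(3)[OF \<mu>0] by (intro emeasure_bind[OF _ K A, symmetric]) simp
  finally show "emeasure (distr M borel (X t)) A = emeasure (\<mu>0 \<bind> P t) A" .
qed

lemma occupation_distr:
  assumes t: "0 < t" and \<omega>: "\<omega> \<in> space M"
  shows "occupation X t \<omega> = distr (uniform_time t) borel (\<lambda>s. X s \<omega>)"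
  unfolding occupation_def
  by (rule bind_return_distr') (use t path_measurable[OF t \<omega>] in \<open>auto simp: uniform_time_facts(1)[OF t]\<close>)

lemma occupation_prob:
  assumes t: "0 < t" and \<omega>: "\<omega> \<in> space M"
  shows "occupation X t \<omega> \<in> space (prob_algebra borel)"
  unfolding occupation_distr[OF assms] space_prob_algebra
  using prob_space.prob_space_distr[OF uniform_time_facts(2)[OF t] path_measurable[OF t \<omega>]] by simp

lemma measure_occupation:
  assumes t: "0 < t" and \<omega>: "\<omega> \<in> space M" and A: "A \<in> sets borel"
  shows "measure (occupation X t \<omega>) A = (\<integral>s. indicat_real A (X s \<omega>) \<partial>uniform_time t)"
proof -
  interpret U: prob_space "uniform_time t" by (rule uniform_time_facts(2)[OF t])
  have "(\<integral>s. indicat_real A (X s \<omega>) \<partial>uniform_time t) = (\<integral>s. indicat_real ((\<lambda>s. X s \<omega>) -` A \<inter> space (uniform_time t)) s \<partial>uniform_time t)"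
    by (rule Bochner_Integration.integral_cong) (auto split: split_indicator)
  then show ?thesis
    unfolding occupation_distr[OF t \<omega>] using A path_measurable[OF t \<omega>] by (simp add: measure_distr measurable_sets)
qed

lemma measurable_measure_occupation:
  assumes t: "0 < t" and A[measurable]: "A \<in> sets borel"
  shows "(\<lambda>\<omega>. measure (occupation X t \<omega>) A) \<in> borel_measurable M"
proof -
  interpret U: prob_space "uniform_time t" by (rule uniform_time_facts(2)[OF t])
  note [measurable] = X_jointly_measurable'[OF t]
  have "(\<lambda>\<omega>. \<integral>s. indicat_real A (X s \<omega>) \<partial>uniform_time t) \<in> borel_measurable M"
    by (rule U.borel_measurable_lebesgue_integral) (simp add: split_beta')
  then show ?thesis by (subst measurable_cong[OF measure_occupation[OF t _ A]])
qed

lemma law_kernel: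
  assumes t: "0 < t"
  shows "(\<lambda>s. distr M borel (X s)) \<in> uniform_time t \<rightarrow>\<^sub>M prob_algebra borel"
proof (rule measurable_prob_algebraI)
  show "prob_space (distr M borel (X s))" if "s \<in> space (uniform_time t)" for s
    using that uniform_time_facts(1)[OF t] by (intro prob_space_distr X_measurable) auto
  show "(\<lambda>s. distr M borel (X s)) \<in> uniform_time t \<rightarrow>\<^sub>M subprob_algebra borel"
    using X_jointly_measurable[OF t] by (intro measurable_distr2[where g="\<lambda>_. M" and M=M]) (auto simp: split_beta' space_subprob_algebra intro!: prob_space_imp_subprob_space prob_space_axioms)
qed

lemma uniform_time_prob_algebra: "0 < t \<Longrightarrow> uniform_time t \<in> space (prob_algebra (uniform_time t))"
  by (simp add: space_prob_algebra uniform_time_facts(2))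

lemma mean_occupation_prob:
  assumes t: "0 < t" shows "mean_occupation M X t \<in> space (prob_algebra borel)"
  unfolding mean_occupation_def
  using prob_space_bind'[OF uniform_time_prob_algebra[OF t] law_kernel[OF t]]
    sets_bind'[OF uniform_time_prob_algebra[OF t] law_kernel[OF t]] by (simp add: space_prob_algebra)

lemma nn_integral_mean_occupation:
  assumes t: "0 < t" and h: "h \<in> borel_measurable borel"
  shows "(\<integral>\<^sup>+x. h x \<partial>mean_occupation M X t) = (\<integral>\<^sup>+s. (\<integral>\<^sup>+\<omega>. h (X s \<omega>) \<partial>M) \<partial>uniform_time t)"
  unfolding mean_occupation_def nn_integral_bind[OF h measurable_prob_algebraD[OF law_kernel[OF t]]]
  using h uniform_time_facts(1)[OF t] by (intro nn_integral_cong nn_integral_distr X_measurable) auto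

lemma mean_occupation_le:
  assumes t: "0 < t" and h: "h \<in> borel_measurable borel"
    and b: "\<And>s. 0 \<le> s \<Longrightarrow> (\<integral>\<^sup>+x. h x \<partial>(\<mu>0 \<bind> P s)) \<le> b"
  shows "(\<integral>\<^sup>+x. h x \<partial>mean_occupation M X t) \<le> b"
proof -
  interpret U: prob_space "uniform_time t" by (rule uniform_time_facts(2)[OF t])
  have "(\<integral>\<^sup>+x. h x \<partial>mean_occupation M X t) = (\<integral>\<^sup>+s. (\<integral>\<^sup>+x. h x \<partial>(\<mu>0 \<bind> P s)) \<partial>uniform_time t)"
    unfolding nn_integral_mean_occupation[OF t h] using h uniform_time_facts(1)[OF t]
    by (intro nn_integral_cong) (simp add: law_X[symmetric] nn_integral_distr X_measurable)
  also have "\<dots> \<le> (\<integral>\<^sup>+s. b \<partial>uniform_time t)"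
    using b uniform_time_facts(1)[OF t] by (intro nn_integral_mono) auto
  finally show ?thesis by (simp add: U.emeasure_space_1)
qed

end

section \<open>Variance of the occupation measure of a set\<close>

context ergodic_process
begin

definition centered :: "'a set \<Rightarrow> 'a \<Rightarrow> real" where
  "centered A x = indicator A x - measure \<nu> A"

lemma centered_measurable[measurable]:
  assumes "A \<in> sets borel" shows "centered A \<in> borel_measurable borel"
proof -
  have "(\<lambda>x. indicator A x - measure \<nu> A) \<in> borel_measurable borel"
    using assms by (intro borel_measurable_diff borel_measurable_indicator borel_measurable_const)
  then show ?thesis unfolding centered_def .
qed

lemma centered_abs_le: "\<bar>centered A x\<bar> \<le> 1"
proof -
  have "measure \<nu> A \<le> 1" using prob_algebra_simps(1)[OF \<nu>_prob] by (rule prob_space.prob_le_1)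
  moreover have "0 \<le> measure \<nu> A" by simp
  moreover have "centered A x = 1 - measure \<nu> A \<or> centered A x = - measure \<nu> A"
    by (auto simp: centered_def split: split_indicator)
  ultimately show ?thesis by linarith
qed

definition weight :: "'a set \<Rightarrow> real \<Rightarrow> ennreal" where
  "weight A s = (\<integral>\<^sup>+\<omega>. ennreal (\<bar>centered A (X s \<omega>)\<bar> * \<phi> (X s \<omega>)) \<partial>M)"

text \<open>Conditioning on the past up to time \<open>s\<close> replaces the later factor by \<open>measure (P r (X s \<omega>)) A - measure \<nu> A\<close>,
which decays in \<open>r\<close> uniformly up to the factor \<open>\<phi> (X s \<omega>)\<close>.\<close>

lemma covariance_le:
  assumes s: "0 \<le> s" and r: "0 \<le> r" and A[measurable]: "A \<in> sets borel"
  shows "ennreal \<bar>\<integral>\<omega>. centered A (X s \<omega>) * centered A (X (s + r) \<omega>) \<partial>M\<bar> \<le> weight A s * ennreal (et r)"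
proof -
  note [measurable] = X_measurable[OF s]
  have [measurable]: "X (s + r) \<in> borel_measurable M" using s r by (intro X_measurable) simp
  have Pm[measurable]: "(\<lambda>x. measure (P r x) A) \<in> borel_measurable borel"
    by (rule measure_measurable_prob_algebra2[where N=borel]) (use P_kernel[OF r] A in auto)
  have P1: "measure (P r x) A \<le> 1" for x
    using prob_algebra_simps(1)[OF P_prob[OF r, of x]] by (rule prob_space.prob_le_1)
  have i: "integrable M (\<lambda>\<omega>. centered A (X s \<omega>) * indicat_real A (X (s + r) \<omega>))"
    "integrable M (\<lambda>\<omega>. centered A (X s \<omega>) * measure (P r (X s \<omega>)) A)"
    "integrable M (\<lambda>\<omega>. centered A (X s \<omega>))"
  proof -
    have "\<bar>centered A x * y\<bar> \<le> 1" if "\<bar>y\<bar> \<le> 1" for x y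
      using mult_mono[OF centered_abs_le that] by (simp add: abs_mult)
    then show "integrable M (\<lambda>\<omega>. centered A (X s \<omega>) * indicat_real A (X (s + r) \<omega>))"
      "integrable M (\<lambda>\<omega>. centered A (X s \<omega>) * measure (P r (X s \<omega>)) A)"
      using P1 by (auto intro!: integrable_const_bound[where B=1] split: split_indicator)
    show "integrable M (\<lambda>\<omega>. centered A (X s \<omega>))"
      using centered_abs_le by (auto intro!: integrable_const_bound[where B=1])
  qed
  have "(\<integral>\<omega>. centered A (X s \<omega>) * centered A (X (s + r) \<omega>) \<partial>M)
      = (\<integral>\<omega>. centered A (X s \<omega>) * indicat_real A (X (s + r) \<omega>) - centered A (X s \<omega>) * measure \<nu> A \<partial>M)"
    by (simp add: centered_def[of A "X (s + r) _"] right_diff_distrib)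
  also have "\<dots> = (\<integral>\<omega>. centered A (X s \<omega>) * indicat_real A (X (s + r) \<omega>) \<partial>M) - (\<integral>\<omega>. centered A (X s \<omega>) * measure \<nu> A \<partial>M)"
    using i by (intro Bochner_Integration.integral_diff) auto
  also have "(\<integral>\<omega>. centered A (X s \<omega>) * indicat_real A (X (s + r) \<omega>) \<partial>M) = (\<integral>\<omega>. centered A (X s \<omega>) * measure (P r (X s \<omega>)) A \<partial>M)"
    by (rule integral_past[OF s r A centered_measurable[OF A] centered_abs_le])
  also have "\<dots> - (\<integral>\<omega>. centered A (X s \<omega>) * measure \<nu> A \<partial>M)
      = (\<integral>\<omega>. centered A (X s \<omega>) * measure (P r (X s \<omega>)) A - centered A (X s \<omega>) * measure \<nu> A \<partial>M)"
    using i by (intro Bochner_Integration.integral_diff[symmetric]) auto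
  finally have "ennreal \<bar>\<integral>\<omega>. centered A (X s \<omega>) * centered A (X (s + r) \<omega>) \<partial>M\<bar>
      \<le> (\<integral>\<^sup>+\<omega>. ennreal \<bar>centered A (X s \<omega>) * measure (P r (X s \<omega>)) A - centered A (X s \<omega>) * measure \<nu> A\<bar> \<partial>M)"
    using integral_norm_bound_ennreal[of M "\<lambda>\<omega>. centered A (X s \<omega>) * measure (P r (X s \<omega>)) A - centered A (X s \<omega>) * measure \<nu> A"] i
    by simp
  also have "\<dots> \<le> (\<integral>\<^sup>+\<omega>. ennreal (\<bar>centered A (X s \<omega>)\<bar> * \<phi> (X s \<omega>)) * ennreal (et r) \<partial>M)"
  proof (intro nn_integral_mono)
    fix \<omega>
    have "\<bar>centered A (X s \<omega>) * measure (P r (X s \<omega>)) A - centered A (X s \<omega>) * measure \<nu> A\<bar>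
        = \<bar>centered A (X s \<omega>)\<bar> * \<bar>measure (P r (X s \<omega>)) A - measure \<nu> A\<bar>"
      by (simp add: right_diff_distrib[symmetric] abs_mult)
    also have "\<dots> \<le> \<bar>centered A (X s \<omega>)\<bar> * (\<phi> (X s \<omega>) * et r)"
      by (intro mult_left_mono measure_decay r A) simp
    finally show "ennreal \<bar>centered A (X s \<omega>) * measure (P r (X s \<omega>)) A - centered A (X s \<omega>) * measure \<nu> A\<bar>
        \<le> ennreal (\<bar>centered A (X s \<omega>)\<bar> * \<phi> (X s \<omega>)) * ennreal (et r)"
      using et_nonneg[OF r] \<phi>_ge(1)[of "X s \<omega>"] by (simp add: ennreal_mult[symmetric] ennreal_leI mult_ac)
  qed
  also have "\<dots> = weight A s * ennreal (et r)" unfolding weight_def by (rule nn_integral_multc) measurable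
  finally show ?thesis .
qed

definition deviation :: "real \<Rightarrow> 'a set \<Rightarrow> 'w \<Rightarrow> real" where
  "deviation t A \<omega> = measure (occupation X t \<omega>) A - measure \<nu> A"

lemma deviation_measurable: "0 < t \<Longrightarrow> A \<in> sets borel \<Longrightarrow> deviation t A \<in> borel_measurable M"
  unfolding deviation_def using measurable_measure_occupation by simp

lemma deviation_eq:
  assumes t: "0 < t" and \<omega>: "\<omega> \<in> space M" and A: "A \<in> sets borel"
  shows "deviation t A \<omega> = (\<integral>s. centered A (X s \<omega>) \<partial>uniform_time t)"
proof -
  interpret U: prob_space "uniform_time t" by (rule uniform_time_facts(2)[OF t])
  have "integrable (uniform_time t) (\<lambda>s. indicat_real A (X s \<omega>))"
    using measurable_compose[OF path_measurable[OF t \<omega>], of "indicat_real A"] A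
    by (intro U.integrable_const_bound[where B=1]) auto
  then show ?thesis
    unfolding deviation_def measure_occupation[OF assms] centered_def by (simp add: U.prob_space)
qed

lemma deviation_abs_le:
  assumes t: "0 < t" and \<omega>: "\<omega> \<in> space M"
  shows "\<bar>deviation t A \<omega>\<bar> \<le> 1"
proof -
  have "measure \<nu> A \<le> 1" using prob_algebra_simps(1)[OF \<nu>_prob] by (rule prob_space.prob_le_1)
  moreover have "measure (occupation X t \<omega>) A \<le> 1"
    using prob_algebra_simps(1)[OF occupation_prob[OF assms]] by (rule prob_space.prob_le_1)
  moreover have "0 \<le> measure \<nu> A" "0 \<le> measure (occupation X t \<omega>) A" by simp_all
  ultimately show ?thesis unfolding deviation_def by linarith
qed

text \<open>Fubini's theorem for one factor. Applied twice it expands the square of the deviation into covariances.\<close>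

lemma integral_mult_deviation_le:
  assumes t: "0 < t" and A[measurable]: "A \<in> sets borel"
    and Y[measurable]: "Y \<in> borel_measurable M" and Y1: "\<And>\<omega>. \<omega> \<in> space M \<Longrightarrow> \<bar>Y \<omega>\<bar> \<le> 1"
  shows "ennreal \<bar>\<integral>\<omega>. Y \<omega> * deviation t A \<omega> \<partial>M\<bar>
    \<le> (\<integral>\<^sup>+u. ennreal \<bar>\<integral>\<omega>. Y \<omega> * centered A (X u \<omega>) \<partial>M\<bar> \<partial>uniform_time t)"
proof -
  interpret U: prob_space "uniform_time t" by (rule uniform_time_facts(2)[OF t])
  interpret UM: pair_prob_space "uniform_time t" M ..
  note [measurable] = X_jointly_measurable[OF t]
  have i: "integrable (uniform_time t \<Otimes>\<^sub>M M) (\<lambda>(u, \<omega>). Y \<omega> * centered A (X u \<omega>))"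
  proof (rule UM.integrable_const_bound[where B=1])
    show "AE z in uniform_time t \<Otimes>\<^sub>M M. norm (case z of (u, \<omega>) \<Rightarrow> Y \<omega> * centered A (X u \<omega>)) \<le> 1"
    proof (rule AE_I2)
      fix z assume "z \<in> space (uniform_time t \<Otimes>\<^sub>M M)"
      then have "snd z \<in> space M" by (auto simp: space_pair_measure)
      then have "\<bar>Y (snd z)\<bar> * \<bar>centered A (X (fst z) (snd z))\<bar> \<le> 1 * 1"
        by (intro mult_mono Y1 centered_abs_le) auto
      then show "norm (case z of (u, \<omega>) \<Rightarrow> Y \<omega> * centered A (X u \<omega>)) \<le> 1" by (simp add: split_beta abs_mult)
    qed
  qed (simp add: split_beta')
  have "(\<integral>\<omega>. Y \<omega> * deviation t A \<omega> \<partial>M) = (\<integral>\<omega>. (\<integral>u. Y \<omega> * centered A (X u \<omega>) \<partial>uniform_time t) \<partial>M)"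
    by (intro Bochner_Integration.integral_cong) (simp_all add: deviation_eq[OF t _ A])
  also have "\<dots> = (\<integral>u. (\<integral>\<omega>. Y \<omega> * centered A (X u \<omega>) \<partial>M) \<partial>uniform_time t)"
    by (rule UM.Fubini_integral[OF i])
  finally show ?thesis
    using integral_norm_bound_ennreal[OF UM.integrable_fst'[OF i]] by simp
qed

definition total_decay :: ennreal where
  "total_decay = (\<integral>\<^sup>+r. ennreal (indicator {0..} r * et r) \<partial>lborel)"

lemma decay_measurable[measurable]: "(\<lambda>r. indicator {0..} r * et r) \<in> borel_measurable borel"
  using et_integrable unfolding set_integrable_def by (auto dest: borel_measurable_integrable)

lemma total_decay_finite: "total_decay < \<infinity>"
proof -
  have "integrable lborel (\<lambda>r. indicator {0..} r * et r)" using et_integrable by (simp add: set_integrable_def)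
  then have "(\<integral>\<^sup>+r. ennreal (norm (indicator {0..} r * et r)) \<partial>lborel) < \<infinity>" by (simp add: integrable_iff_bounded)
  moreover have "norm (indicator {0..} r * et r) = indicator {0..} r * et r" for r
    using et_nonneg[of r] by (auto split: split_indicator)
  ultimately show ?thesis by (simp only: total_decay_def)
qed

text \<open>Integrate the covariances over pairs of times. For a fixed earlier time \<open>s\<close> the bound is integrable over all
later times \<open>u\<close>, which saves a factor \<open>t\<close>; the average over \<open>s\<close> is an integral against the mean
occupation measure.\<close>

lemma second_moment_deviation_le:
  assumes t: "0 < t" and A[measurable]: "A \<in> sets borel"
  shows "ennreal (\<integral>\<omega>. (deviation t A \<omega>)\<^sup>2 \<partial>M)
    \<le> 2 * (\<integral>\<^sup>+x. ennreal (\<bar>centered A x\<bar> * \<phi> x) \<partial>mean_occupation M X t) * (total_decay / ennreal t)"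
proof -
  let ?U = "uniform_time t"
  interpret U: prob_space ?U by (rule uniform_time_facts(2)[OF t])
  interpret UU: pair_prob_space ?U ?U ..
  interpret UM: pair_prob_space ?U M ..
  note [measurable] = X_jointly_measurable[OF t] uniform_time_facts(3)[OF t]
  have sp: "space ?U = {0..t}" by (rule uniform_time_facts(1)[OF t])
  define F where "F s u = weight A s * ennreal (indicator {0..} (u - s) * et (u - s))" for s u
  have wm[measurable]: "weight A \<in> borel_measurable ?U"
    unfolding weight_def by (rule borel_measurable_nn_integral) (simp add: split_beta')
  have Fm: "(\<lambda>(s, u). F s u) \<in> borel_measurable (?U \<Otimes>\<^sub>M ?U)"
    unfolding F_def split_beta' by measurable
  have Fi: "(\<integral>\<^sup>+s. \<integral>\<^sup>+u. F s u \<partial>?U \<partial>?U) \<le> (\<integral>\<^sup>+x. ennreal (\<bar>centered A x\<bar> * \<phi> x) \<partial>mean_occupation M X t) * (total_decay / ennreal t)"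
  proof -
    have shift: "(\<integral>\<^sup>+u. ennreal (indicator {0..} (u - s) * et (u - s)) \<partial>?U) \<le> total_decay / ennreal t" for s
    proof -
      have "(\<integral>\<^sup>+u. ennreal (indicator {0..} (u - s) * et (u - s)) \<partial>lborel) = total_decay"
        unfolding total_decay_def
        using nn_integral_real_affine[of "\<lambda>r. ennreal (indicator {0..} r * et r)" 1 "- s"] by simp
      moreover have "(\<lambda>u. ennreal (indicator {0..} (u - s) * et (u - s))) \<in> borel_measurable borel"
        by (rule measurable_compose[OF _ measurable_compose[OF decay_measurable measurable_ennreal]]) simp
      ultimately show ?thesis using uniform_time_facts(4)[OF t, of "\<lambda>u. ennreal (indicator {0..} (u - s) * et (u - s))"] by simp
    qed
    have "(\<integral>\<^sup>+s. \<integral>\<^sup>+u. F s u \<partial>?U \<partial>?U) = (\<integral>\<^sup>+s. weight A s * (\<integral>\<^sup>+u. ennreal (indicator {0..} (u - s) * et (u - s)) \<partial>?U) \<partial>?U)"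
      unfolding F_def by (intro nn_integral_cong nn_integral_cmult) measurable
    also have "\<dots> \<le> (\<integral>\<^sup>+s. weight A s * (total_decay / ennreal t) \<partial>?U)"
      by (intro nn_integral_mono mult_left_mono shift) simp
    also have "\<dots> = (\<integral>\<^sup>+s. weight A s \<partial>?U) * (total_decay / ennreal t)" by (rule nn_integral_multc) measurable
    also have "(\<integral>\<^sup>+s. weight A s \<partial>?U) = (\<integral>\<^sup>+x. ennreal (\<bar>centered A x\<bar> * \<phi> x) \<partial>mean_occupation M X t)"
      unfolding weight_def by (rule nn_integral_mean_occupation[OF t, symmetric]) measurable
    finally show ?thesis .
  qed
  have cov: "ennreal \<bar>\<integral>\<omega>. centered A (X s \<omega>) * centered A (X u \<omega>) \<partial>M\<bar> \<le> F s u + F u s"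
    if "s \<in> space ?U" "u \<in> space ?U" for s u
  proof (cases "s \<le> u")
    case True
    then have "ennreal \<bar>\<integral>\<omega>. centered A (X s \<omega>) * centered A (X u \<omega>) \<partial>M\<bar> \<le> F s u"
      using covariance_le[of s "u - s" A] that sp A by (simp add: F_def)
    then show ?thesis by (rule order_trans) simp
  next
    case False
    then have "ennreal \<bar>\<integral>\<omega>. centered A (X u \<omega>) * centered A (X s \<omega>) \<partial>M\<bar> \<le> F u s"
      using covariance_le[of u "s - u" A] that sp A by (simp add: F_def)
    also have "F u s \<le> F s u + F u s" by simp
    finally show ?thesis unfolding mult.commute[of "centered A (X u _)"] .
  qed
  have "ennreal (\<integral>\<omega>. (deviation t A \<omega>)\<^sup>2 \<partial>M) \<le> ennreal \<bar>\<integral>\<omega>. deviation t A \<omega> * deviation t A \<omega> \<partial>M\<bar>"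
    by (intro ennreal_leI) (simp add: power2_eq_square)
  also have "\<dots> \<le> (\<integral>\<^sup>+s. ennreal \<bar>\<integral>\<omega>. deviation t A \<omega> * centered A (X s \<omega>) \<partial>M\<bar> \<partial>?U)"
    by (rule integral_mult_deviation_le[OF t A deviation_measurable[OF t A] deviation_abs_le[OF t]])
  also have "\<dots> \<le> (\<integral>\<^sup>+s. (\<integral>\<^sup>+u. ennreal \<bar>\<integral>\<omega>. centered A (X s \<omega>) * centered A (X u \<omega>) \<partial>M\<bar> \<partial>?U) \<partial>?U)"
  proof (intro nn_integral_mono)
    fix s assume "s \<in> space ?U"
    then have [measurable]: "X s \<in> borel_measurable M" using sp by (intro X_measurable) auto
    have "ennreal \<bar>\<integral>\<omega>. centered A (X s \<omega>) * deviation t A \<omega> \<partial>M\<bar>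
        \<le> (\<integral>\<^sup>+u. ennreal \<bar>\<integral>\<omega>. centered A (X s \<omega>) * centered A (X u \<omega>) \<partial>M\<bar> \<partial>?U)"
      by (rule integral_mult_deviation_le[OF t A _ centered_abs_le]) measurable
    then show "ennreal \<bar>\<integral>\<omega>. deviation t A \<omega> * centered A (X s \<omega>) \<partial>M\<bar>
        \<le> (\<integral>\<^sup>+u. ennreal \<bar>\<integral>\<omega>. centered A (X s \<omega>) * centered A (X u \<omega>) \<partial>M\<bar> \<partial>?U)"
      by (simp add: mult.commute)
  qed
  also have "\<dots> \<le> (\<integral>\<^sup>+s. (\<integral>\<^sup>+u. F s u + F u s \<partial>?U) \<partial>?U)"
    by (intro nn_integral_mono cov)
  also have "\<dots> = (\<integral>\<^sup>+s. (\<integral>\<^sup>+u. F s u \<partial>?U) + (\<integral>\<^sup>+u. F u s \<partial>?U) \<partial>?U)"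
    by (intro nn_integral_cong nn_integral_add) (unfold F_def, measurable)
  also have "\<dots> = (\<integral>\<^sup>+s. \<integral>\<^sup>+u. F s u \<partial>?U \<partial>?U) + (\<integral>\<^sup>+s. \<integral>\<^sup>+u. F u s \<partial>?U \<partial>?U)"
    by (rule nn_integral_add) (unfold F_def, measurable)
  also have "(\<integral>\<^sup>+s. \<integral>\<^sup>+u. F u s \<partial>?U \<partial>?U) = (\<integral>\<^sup>+s. \<integral>\<^sup>+u. F s u \<partial>?U \<partial>?U)"
    by (rule UU.Fubini'[OF Fm])
  also have "(\<integral>\<^sup>+s. \<integral>\<^sup>+u. F s u \<partial>?U \<partial>?U) + (\<integral>\<^sup>+s. \<integral>\<^sup>+u. F s u \<partial>?U \<partial>?U)
     \<le> (\<integral>\<^sup>+x. ennreal (\<bar>centered A x\<bar> * \<phi> x) \<partial>mean_occupation M X t) * (total_decay / ennreal t)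
      + (\<integral>\<^sup>+x. ennreal (\<bar>centered A x\<bar> * \<phi> x) \<partial>mean_occupation M X t) * (total_decay / ennreal t)"
    by (rule add_mono[OF Fi Fi])
  finally show ?thesis by (simp add: mult_2 distrib_right)
qed

end

section \<open>The discrepancy estimate with a power of the mass\<close>

text \<open>A form of the Hoelder inequality for functions \<open>h\<close> with values in the unit interval, where \<open>h \<le> h powr (1 - 1 / q)\<close>: after
normalization by \<open>a\<close> and \<open>s\<close> it is the integrated inequality between weighted means.\<close>

lemma nn_integral_product_le:
  assumes m: "m \<in> space (prob_algebra (borel :: 'a::euclidean_space measure))" and q: "1 < q" and a: "0 < a" and s: "0 < s"
    and h[measurable]: "h \<in> borel_measurable borel" and h1: "\<And>x. 0 \<le> h x \<and> h x \<le> 1"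
    and f[measurable]: "f \<in> borel_measurable borel" and f1: "\<And>x. 0 < f x"
    and ha: "(\<integral>\<^sup>+x. ennreal (h x) \<partial>m) \<le> ennreal a" and fs: "(\<integral>\<^sup>+x. ennreal (f x powr q) \<partial>m) \<le> ennreal s"
  shows "(\<integral>\<^sup>+x. ennreal (h x * f x) \<partial>m) \<le> ennreal (a powr (1 - 1 / q) * s powr (1 / q))"
proof -
  have Sm[measurable_cong]: "sets m = sets borel" by (rule prob_algebra_simps[OF m])
  define C where "C = a powr (1 - 1 / q) * s powr (1 / q)"
  define u where "u = C * ((1 - 1 / q) / a)"
  define v where "v = C * ((1 / q) / s)"
  have C: "0 < C" using a s by (simp add: C_def)
  have "q \<noteq> 0" using q by simp
  have uv: "0 \<le> u" "0 \<le> v" using C q a s by (auto simp: u_def v_def)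
  have pw: "h x * f x \<le> u * h x + v * f x powr q" for x
  proof (cases "h x = 0")
    case False
    then have hx: "0 < h x" "h x \<le> 1" using h1[of x] by auto
    have "h x powr 1 \<le> h x powr (1 - 1 / q)" using hx q by (intro powr_mono') auto
    then have "h x * f x \<le> h x powr (1 - 1 / q) * f x" using hx f1[of x] by (intro mult_right_mono) auto
    also have "\<dots> = C * ((h x / a) powr (1 - 1 / q) * (f x powr q / s) powr (1 / q))"
    proof -
      have "(h x / a) powr (1 - 1 / q) = h x powr (1 - 1 / q) / a powr (1 - 1 / q)"
        using hx a by (simp add: powr_divide)
      moreover have "(f x powr q / s) powr (1 / q) = f x / s powr (1 / q)"
        using f1[of x] s q by (simp add: powr_divide powr_powr)
      ultimately show ?thesis using a s by (simp add: C_def)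
    qed
    also have "\<dots> \<le> C * ((1 - 1 / q) * (h x / a) + (1 / q) * (f x powr q / s))"
      using hx f1[of x] a s q C by (intro mult_left_mono Youngs_inequality_0) auto
    also have "\<dots> = u * h x + v * f x powr q"
      using a s \<open>q \<noteq> 0\<close> by (simp add: u_def v_def field_simps)
    finally show ?thesis .
  qed (use uv in simp)
  have "(\<integral>\<^sup>+x. ennreal (h x * f x) \<partial>m) \<le> (\<integral>\<^sup>+x. ennreal u * ennreal (h x) + ennreal v * ennreal (f x powr q) \<partial>m)"
  proof (intro nn_integral_mono)
    fix x
    have "ennreal u * ennreal (h x) + ennreal v * ennreal (f x powr q) = ennreal (u * h x + v * f x powr q)"
      using uv h1[of x] by (simp add: ennreal_mult ennreal_plus)
    then show "ennreal (h x * f x) \<le> ennreal u * ennreal (h x) + ennreal v * ennreal (f x powr q)"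
      using pw[of x] by (simp add: ennreal_leI)
  qed
  also have "\<dots> = ennreal u * (\<integral>\<^sup>+x. ennreal (h x) \<partial>m) + ennreal v * (\<integral>\<^sup>+x. ennreal (f x powr q) \<partial>m)"
    by (simp add: nn_integral_add nn_integral_cmult)
  also have "\<dots> \<le> ennreal u * ennreal a + ennreal v * ennreal s"
    by (intro add_mono mult_left_mono ha fs) auto
  also have "\<dots> = ennreal (u * a + v * s)" using uv a s by (simp add: ennreal_mult ennreal_plus)
  also have "u * a + v * s = C" using a s \<open>q \<noteq> 0\<close> by (simp add: u_def v_def field_simps)
  finally show ?thesis by (simp add: C_def)
qed

context ergodic_process
begin

definition mean_law :: "real \<Rightarrow> 'a measure" where
  "mean_law t = half_sum (mean_occupation M X t) \<nu>"

lemma mean_law_prob: "0 < t \<Longrightarrow> mean_law t \<in> space (prob_algebra borel)"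
  unfolding mean_law_def by (intro half_sum_mixture mean_occupation_prob \<nu>_prob)

lemma measure_mean_law:
  "0 < t \<Longrightarrow> A \<in> sets borel \<Longrightarrow> 2 * measure (mean_law t) A = measure (mean_occupation M X t) A + measure \<nu> A"
  unfolding mean_law_def by (subst half_sum_mixture(2)) (simp_all add: mean_occupation_prob \<nu>_prob)

text \<open>The mean of the occupation measure is the mean occupation measure, by Fubini's theorem.\<close>

lemma first_moment_deviation_le:
  assumes t: "0 < t" and A[measurable]: "A \<in> sets borel"
  shows "(\<integral>\<^sup>+\<omega>. ennreal \<bar>deviation t A \<omega>\<bar> \<partial>M) \<le> ennreal (2 * measure (mean_law t) A)"
proof -
  interpret U: prob_space "uniform_time t" by (rule uniform_time_facts(2)[OF t])
  interpret UM: pair_prob_space "uniform_time t" M ..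
  note [measurable] = X_jointly_measurable[OF t]
  have m: "mean_occupation M X t \<in> space (prob_algebra borel)" by (rule mean_occupation_prob[OF t])
  interpret m: prob_space "mean_occupation M X t" by (rule prob_algebra_simps[OF m])
  have occ: "ennreal (measure (occupation X t \<omega>) A) = (\<integral>\<^sup>+s. indicator A (X s \<omega>) \<partial>uniform_time t)"
    if \<omega>: "\<omega> \<in> space M" for \<omega>
  proof -
    interpret o: prob_space "occupation X t \<omega>" by (rule prob_algebra_simps[OF occupation_prob[OF t \<omega>]])
    have "ennreal (measure (occupation X t \<omega>) A) = (\<integral>\<^sup>+x. indicator A x \<partial>occupation X t \<omega>)"
      using prob_algebra_simps(2)[OF occupation_prob[OF t \<omega>]] by (simp add: o.emeasure_eq_measure)
    also have "\<dots> = (\<integral>\<^sup>+s. indicator A (X s \<omega>) \<partial>uniform_time t)"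
      unfolding occupation_distr[OF t \<omega>] by (rule nn_integral_distr[OF path_measurable[OF t \<omega>]]) simp
    finally show ?thesis .
  qed
  have "(\<integral>\<^sup>+\<omega>. ennreal \<bar>deviation t A \<omega>\<bar> \<partial>M) \<le> (\<integral>\<^sup>+\<omega>. (\<integral>\<^sup>+s. indicator A (X s \<omega>) \<partial>uniform_time t) + ennreal (measure \<nu> A) \<partial>M)"
  proof (intro nn_integral_mono)
    fix \<omega> assume \<omega>: "\<omega> \<in> space M"
    have "\<bar>deviation t A \<omega>\<bar> \<le> measure (occupation X t \<omega>) A + measure \<nu> A"
      unfolding deviation_def using measure_nonneg[of "occupation X t \<omega>" A] measure_nonneg[of \<nu> A] by linarith
    then have "ennreal \<bar>deviation t A \<omega>\<bar> \<le> ennreal (measure (occupation X t \<omega>) A + measure \<nu> A)"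
      by (rule ennreal_leI)
    then show "ennreal \<bar>deviation t A \<omega>\<bar> \<le> (\<integral>\<^sup>+s. indicator A (X s \<omega>) \<partial>uniform_time t) + ennreal (measure \<nu> A)"
      unfolding occ[OF \<omega>, symmetric] by (simp add: ennreal_plus)
  qed
  also have "\<dots> = (\<integral>\<^sup>+\<omega>. (\<integral>\<^sup>+s. indicator A (X s \<omega>) \<partial>uniform_time t) \<partial>M) + ennreal (measure \<nu> A)"
  proof -
    have "(\<lambda>\<omega>. ennreal (measure (occupation X t \<omega>) A)) \<in> borel_measurable M"
      using measurable_measure_occupation[OF t A] by measurable
    then have "(\<lambda>\<omega>. \<integral>\<^sup>+s. indicator A (X s \<omega>) \<partial>uniform_time t) \<in> borel_measurable M"
      by (subst measurable_cong[OF occ[symmetric]])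
    then show ?thesis by (subst nn_integral_add) (auto simp: emeasure_space_1)
  qed
  also have "(\<integral>\<^sup>+\<omega>. (\<integral>\<^sup>+s. indicator A (X s \<omega>) \<partial>uniform_time t) \<partial>M) = (\<integral>\<^sup>+s. (\<integral>\<^sup>+\<omega>. indicator A (X s \<omega>) \<partial>M) \<partial>uniform_time t)"
    by (rule UM.Fubini') (simp add: split_beta')
  also have "\<dots> = (\<integral>\<^sup>+x. indicator A x \<partial>mean_occupation M X t)"
    by (rule nn_integral_mean_occupation[OF t, symmetric]) measurable
  also have "\<dots> = ennreal (measure (mean_occupation M X t) A)"
    using prob_algebra_simps(2)[OF m] by (simp add: m.emeasure_eq_measure)
  finally show ?thesis unfolding measure_mean_law[OF t A] by (simp add: ennreal_plus)
qed

lemma abs_moment_le_sqrt: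
  assumes Y: "Y \<in> borel_measurable M" and Y1: "\<And>\<omega>. \<omega> \<in> space M \<Longrightarrow> \<bar>Y \<omega>\<bar> \<le> (1::real)"
    and b: "(\<integral>\<omega>. (Y \<omega>)\<^sup>2 \<partial>M) \<le> b"
  shows "(\<integral>\<^sup>+\<omega>. ennreal \<bar>Y \<omega>\<bar> \<partial>M) \<le> ennreal (sqrt b)"
proof -
  have i: "integrable M (\<lambda>\<omega>. \<bar>Y \<omega>\<bar>)" "integrable M (\<lambda>\<omega>. \<bar>Y \<omega>\<bar>\<^sup>2)"
    using Y Y1 by (auto intro!: integrable_const_bound[where B=1] AE_I2 simp: abs_square_le_1)
  have "0 \<le> variance (\<lambda>\<omega>. \<bar>Y \<omega>\<bar>)" by (rule variance_positive)
  then have "(\<integral>\<omega>. \<bar>Y \<omega>\<bar> \<partial>M)\<^sup>2 \<le> (\<integral>\<omega>. (Y \<omega>)\<^sup>2 \<partial>M)" unfolding variance_eq[OF i] by simp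
  then have "(\<integral>\<omega>. \<bar>Y \<omega>\<bar> \<partial>M) \<le> sqrt b" using b by (intro real_le_rsqrt) linarith
  then show ?thesis using i by (subst nn_integral_eq_integral) (auto intro: ennreal_leI)
qed

text \<open>The variance bound and the Hoelder inequality, followed by a square root. The centered indicator of
\<open>A\<close> has integral at most \<open>2 * measure (mean_law t) A\<close> under the mean occupation measure.\<close>

lemma deviation_rate:
  obtains C where "0 < C" "\<And>t A. 0 < t \<Longrightarrow> A \<in> sets borel \<Longrightarrow>
    (\<integral>\<^sup>+\<omega>. ennreal \<bar>deviation t A \<omega>\<bar> \<partial>M)
      \<le> ennreal (C * (measure (mean_law t) A powr (1 / 2 * (1 - 1 / q)) * t powr (- (1 / 2))))"
proof -
  obtain E where E: "total_decay = ennreal E" "0 \<le> E" using total_decay_finite less_top_ennreal by auto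
  obtain s' where s': "moment_sup = ennreal s'" "0 \<le> s'" using moment_sup_finite less_top_ennreal by auto
  \<comment> \<open>any positive bound will do; adding one excludes the value zero\<close>
  define s where "s = s' + 1"
  have s: "0 < s" "moment_sup \<le> ennreal s" using s' by (auto simp: s_def intro: ennreal_leI)
  define \<beta> where "\<beta> = 1 / 2 * (1 - 1 / q)"
  \<comment> \<open>the power of two comes from \<open>a = 2 * measure (mean_law t) A\<close>\<close>
  define C where "C = 1 + 2 powr \<beta> * sqrt (2 * s powr (1 / q) * E)"
  have C: "0 < C" using E by (simp add: C_def add_pos_nonneg)
  have "(\<integral>\<^sup>+\<omega>. ennreal \<bar>deviation t A \<omega>\<bar> \<partial>M) \<le> ennreal (C * (measure (mean_law t) A powr \<beta> * t powr (- (1 / 2))))"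
    if t: "0 < t" and A[measurable]: "A \<in> sets borel" for t A
  proof (cases "measure (mean_law t) A = 0")
    case True
    then show ?thesis using first_moment_deviation_le[OF t A] by simp
  next
    case False
    define a where "a = 2 * measure (mean_law t) A"
    have a: "0 < a" using False measure_nonneg[of "mean_law t" A] by (simp add: a_def less_le)
    have m: "mean_occupation M X t \<in> space (prob_algebra borel)" by (rule mean_occupation_prob[OF t])
    interpret m: prob_space "mean_occupation M X t" by (rule prob_algebra_simps[OF m])
    have Sm[measurable_cong]: "sets (mean_occupation M X t) = sets borel" by (rule prob_algebra_simps[OF m])
    have ca: "(\<integral>\<^sup>+x. ennreal \<bar>centered A x\<bar> \<partial>mean_occupation M X t) \<le> ennreal a"
    proof -
      have "(\<integral>\<^sup>+x. ennreal \<bar>centered A x\<bar> \<partial>mean_occupation M X t) \<le> (\<integral>\<^sup>+x. indicator A x + ennreal (measure \<nu> A) \<partial>mean_occupation M X t)"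
      proof (intro nn_integral_mono)
        fix x
        have "\<bar>centered A x\<bar> \<le> indicat_real A x + measure \<nu> A"
          using measure_nonneg[of \<nu> A] by (cases "x \<in> A") (auto simp: centered_def abs_if)
        then have "ennreal \<bar>centered A x\<bar> \<le> ennreal (indicat_real A x + measure \<nu> A)" by (rule ennreal_leI)
        then show "ennreal \<bar>centered A x\<bar> \<le> indicator A x + ennreal (measure \<nu> A)"
          by (simp add: ennreal_plus ennreal_indicator)
      qed
      also have "\<dots> = ennreal (measure (mean_occupation M X t) A) + ennreal (measure \<nu> A)"
        by (subst nn_integral_add) (auto simp: m.emeasure_eq_measure m.prob_space)
      also have "\<dots> = ennreal a" unfolding a_def measure_mean_law[OF t A] by (simp add: ennreal_plus)
      finally show ?thesis .
    qed
    have "(\<integral>\<^sup>+x. ennreal (\<phi> x powr q) \<partial>mean_occupation M X t) \<le> moment_sup"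
      by (rule mean_occupation_le[OF t _ \<phi>_moment_le]) measurable
    then have fs: "(\<integral>\<^sup>+x. ennreal (\<phi> x powr q) \<partial>mean_occupation M X t) \<le> ennreal s" using s by (meson order_trans)
    have H: "(\<integral>\<^sup>+x. ennreal (\<bar>centered A x\<bar> * \<phi> x) \<partial>mean_occupation M X t) \<le> ennreal (a powr (1 - 1 / q) * s powr (1 / q))"
      using \<phi>_ge(1) centered_abs_le
      by (intro nn_integral_product_le[OF m q a s(1) _ _ _ _ ca fs]) (auto intro: less_le_trans[OF zero_less_one])
    define b where "b = 2 * (a powr (1 - 1 / q) * s powr (1 / q)) * (E / t)"
    have b0: "0 \<le> b" using E t by (simp add: b_def)
    have "ennreal (\<integral>\<omega>. (deviation t A \<omega>)\<^sup>2 \<partial>M) \<le> 2 * ennreal (a powr (1 - 1 / q) * s powr (1 / q)) * (total_decay / ennreal t)"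
      by (rule order_trans[OF second_moment_deviation_le[OF t A]]) (intro mult_right_mono mult_left_mono H; simp)
    also have "\<dots> = ennreal b"
    proof -
      have "total_decay / ennreal t = ennreal (E / t)" unfolding E(1) using E t by (intro divide_ennreal) auto
      moreover have "(2::ennreal) = ennreal 2" by simp
      ultimately show ?thesis unfolding b_def using E t by (simp only: ennreal_mult'[symmetric] ennreal_mult''[symmetric] zero_le_numeral mult_nonneg_nonneg powr_ge_zero divide_nonneg_pos less_imp_le)
    qed
    finally have "(\<integral>\<omega>. (deviation t A \<omega>)\<^sup>2 \<partial>M) \<le> b" using b0 by (simp add: ennreal_le_iff)
    then have "(\<integral>\<^sup>+\<omega>. ennreal \<bar>deviation t A \<omega>\<bar> \<partial>M) \<le> ennreal (sqrt b)"
      by (intro abs_moment_le_sqrt deviation_measurable t A deviation_abs_le) auto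
    also have "sqrt b = sqrt (2 * s powr (1 / q) * E) * a powr \<beta> * t powr (- (1 / 2))"
    proof -
      have "sqrt (a powr (1 - 1 / q)) = a powr \<beta>"
        using a by (simp add: powr_half_sqrt[symmetric] powr_powr \<beta>_def mult.commute)
      moreover have "sqrt (1 / t) = t powr (- (1 / 2))"
        using t by (simp add: powr_half_sqrt[symmetric] powr_minus_divide powr_divide)
      moreover have "b = (2 * s powr (1 / q) * E) * (a powr (1 - 1 / q)) * (1 / t)" by (simp add: b_def)
      ultimately show ?thesis by (simp only: real_sqrt_mult)
    qed
    also have "\<dots> \<le> C * (measure (mean_law t) A powr \<beta> * t powr (- (1 / 2)))"
    proof -
      have "a powr \<beta> = 2 powr \<beta> * measure (mean_law t) A powr \<beta>" by (simp add: a_def powr_mult)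
      then have "sqrt (2 * s powr (1 / q) * E) * a powr \<beta> * t powr (- (1 / 2))
          = (2 powr \<beta> * sqrt (2 * s powr (1 / q) * E)) * (measure (mean_law t) A powr \<beta> * t powr (- (1 / 2)))"
        by (simp only: ac_simps)
      also have "\<dots> \<le> C * (measure (mean_law t) A powr \<beta> * t powr (- (1 / 2)))"
        by (intro mult_right_mono) (auto simp: C_def)
      finally show ?thesis .
    qed
    finally show ?thesis by (simp add: ennreal_leI)
  qed
  then show ?thesis using C that unfolding \<beta>_def by blast
qed

lemma max_moment_mean_law_finite:
  assumes t0: "0 < t0" shows "max_moment t0 mean_law q < \<infinity>"
proof -
  have "moment q (mean_law t) \<le> moment_sup + (moment_sup + 1)" if t: "t0 \<le> t" for t
  proof -
    have t': "0 < t" using t t0 by simp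
    have nm: "(\<lambda>x. ennreal (norm x powr q)) \<in> borel_measurable (borel :: 'a measure)" by measurable
    have "moment q (mean_law t) \<le> moment q (mean_occupation M X t) + moment q \<nu>"
      unfolding mean_law_def moment_def by (rule half_sum_mixture(3)[OF mean_occupation_prob[OF t'] \<nu>_prob nm])
    also have "\<dots> \<le> moment_sup + (moment_sup + 1)"
      unfolding moment_def[of q "mean_occupation M X t"]
      by (intro add_mono \<nu>_moment_le mean_occupation_le[OF t' nm] moment_le[unfolded moment_def])
    finally show ?thesis .
  qed
  then have "max_moment t0 mean_law q \<le> max 1 (moment_sup + (moment_sup + 1))"
    unfolding max_moment_def by (intro max.mono SUP_least) auto
  also have "\<dots> < \<infinity>" using moment_sup_finite by (simp add: max_def)
  finally show ?thesis .
qed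

lemma property_A_bound:
  obtains C0 where "0 < C0" "\<And>t A. 0 < t \<Longrightarrow> A \<in> sets borel \<Longrightarrow>
    (\<integral>\<^sup>+\<omega>. ennreal \<bar>measure (occupation X t \<omega>) A - measure \<nu> A\<bar> \<partial>M)
      \<le> ennreal (C0 * min (measure (mean_law t) A) (measure (mean_law t) A powr (1 / 2 * (1 - 1 / q)) * t powr (- (1 / 2))))"
proof -
  obtain C where C: "0 < C" "\<And>t A. 0 < t \<Longrightarrow> A \<in> sets borel \<Longrightarrow>
    (\<integral>\<^sup>+\<omega>. ennreal \<bar>deviation t A \<omega>\<bar> \<partial>M)
      \<le> ennreal (C * (measure (mean_law t) A powr (1 / 2 * (1 - 1 / q)) * t powr (- (1 / 2))))"
    using deviation_rate by blast
  have "(\<integral>\<^sup>+\<omega>. ennreal \<bar>measure (occupation X t \<omega>) A - measure \<nu> A\<bar> \<partial>M)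
      \<le> ennreal (max 2 C * min (measure (mean_law t) A) (measure (mean_law t) A powr (1 / 2 * (1 - 1 / q)) * t powr (- (1 / 2))))"
    if t: "0 < t" and A: "A \<in> sets borel" for t A
  proof -
    define x where "x = measure (mean_law t) A"
    define y where "y = measure (mean_law t) A powr (1 / 2 * (1 - 1 / q)) * t powr (- (1 / 2))"
    have xy: "0 \<le> x" "0 \<le> y" by (auto simp: x_def y_def)
    have "2 * x \<le> max 2 C * x" "C * y \<le> max 2 C * y" using xy by (auto intro: mult_right_mono)
    then have "(\<integral>\<^sup>+\<omega>. ennreal \<bar>deviation t A \<omega>\<bar> \<partial>M) \<le> ennreal (max 2 C * x)"
      "(\<integral>\<^sup>+\<omega>. ennreal \<bar>deviation t A \<omega>\<bar> \<partial>M) \<le> ennreal (max 2 C * y)"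
      using first_moment_deviation_le[OF t A] C(2)[OF t A] unfolding x_def y_def
      by (meson ennreal_leI order_trans)+
    then have "(\<integral>\<^sup>+\<omega>. ennreal \<bar>deviation t A \<omega>\<bar> \<partial>M) \<le> ennreal (max 2 C * min x y)"
      by (cases "x \<le> y") (auto simp: min_def)
    then show ?thesis by (simp only: deviation_def x_def y_def)
  qed
  then show ?thesis using that[of "max 2 C"] by auto
qed

lemma property_A_mean_law:
  assumes t0: "0 < t0"
  shows "property_A M (occupation X) \<nu> t0 mean_law (1 / 2 * (1 - 1 / q)) q (1 / 2)"
proof -
  obtain C0 where C0: "0 < C0" "\<And>t A. 0 < t \<Longrightarrow> A \<in> sets borel \<Longrightarrow>
    (\<integral>\<^sup>+\<omega>. ennreal \<bar>measure (occupation X t \<omega>) A - measure \<nu> A\<bar> \<partial>M)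
      \<le> ennreal (C0 * min (measure (mean_law t) A) (measure (mean_law t) A powr (1 / 2 * (1 - 1 / q)) * t powr (- (1 / 2))))"
    using property_A_bound by blast
  show ?thesis unfolding property_A_def
  proof (intro conjI allI impI exI[of _ C0] ballI)
    show "mean_law t \<in> space (prob_algebra borel)" if "t0 \<le> t" for t using that t0 by (intro mean_law_prob) simp
    show "max_moment t0 mean_law q < \<infinity>" by (rule max_moment_mean_law_finite[OF t0])
  qed (use C0 t0 in auto)
qed

text \<open>The exponents of the double series for \<open>\<beta> = 1/2 (1 - 1/q)\<close> are \<open>q \<beta> = (q - 1)/2\<close> and \<open>d (1 - \<beta>) = d/2 (1 + 1/q)\<close>.\<close>

lemma expected_wasserstein_series:
  assumes p: "0 < p" "p < q" and t0: "0 < t0"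
  defines "d \<equiv> real DIM('a)"
  obtains K where "0 < K" "\<And>t. t0 \<le> t \<Longrightarrow>
    (\<integral>\<^sup>+\<omega>. ennpowr (wasserstein p (occupation X t \<omega>) \<nu>) p \<partial>M)
      \<le> ennreal K * max_moment t0 mean_law q *
        (\<Sum>n. \<Sum>l. ennreal (scale_term p q ((q - 1) / 2) (d / 2 * (1 + 1 / q)) (t powr (- (1 / 2))) n l))"
proof -
  obtain C0 where C0: "0 < C0" "\<And>t A. 0 < t \<Longrightarrow> A \<in> sets borel \<Longrightarrow>
    (\<integral>\<^sup>+\<omega>. ennreal \<bar>measure (occupation X t \<omega>) A - measure \<nu> A\<bar> \<partial>M)
      \<le> ennreal (C0 * min (measure (mean_law t) A) (measure (mean_law t) A powr (1 / 2 * (1 - 1 / q)) * t powr (- (1 / 2))))"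
    using property_A_bound by blast
  obtain Q where Q: "max_moment t0 mean_law q = ennreal Q" "0 \<le> Q"
    using max_moment_mean_law_finite[OF t0] less_top_ennreal by auto
  have "1 \<le> max_moment t0 mean_law q" by (simp add: max_moment_def)
  then have Q1: "1 \<le> Q" unfolding Q(1) using Q(2) by (simp flip: ennreal_1)
  have d: "0 < d" unfolding d_def by simp
  define K where "K = 2 * 2 powr p * (2 * d) powr p * C0 * 2 powr q"
  have K: "0 < K" using C0 d by (simp add: K_def)
  have mom: "moment p \<nu> < \<infinity>"
  proof -
    interpret \<nu>: prob_space \<nu> by (rule prob_algebra_simps[OF \<nu>_prob])
    have moment_sup\<nu>[measurable_cong]: "sets \<nu> = sets borel" by (rule prob_algebra_simps[OF \<nu>_prob])
    have "moment p \<nu> \<le> (\<integral>\<^sup>+x. 1 + ennreal (norm x powr q) \<partial>\<nu>)"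
      unfolding moment_def
    proof (intro nn_integral_mono)
      fix x :: 'a
      have "norm x powr p \<le> 1 + norm x powr q"
      proof (cases "norm x \<le> 1")
        case True
        then have "norm x powr p \<le> 1 powr p" using p by (intro powr_mono2) auto
        then show ?thesis by (simp add: add_increasing2)
      next
        case False
        then have "norm x powr p \<le> norm x powr q" using p by (intro powr_mono) auto
        then show ?thesis by simp
      qed
      then have "ennreal (norm x powr p) \<le> ennreal (1 + norm x powr q)" by (rule ennreal_leI)
      then show "ennreal (norm x powr p) \<le> 1 + ennreal (norm x powr q)" by (simp add: ennreal_plus)
    qed
    also have "\<dots> = 1 + moment q \<nu>"
      unfolding moment_def by (subst nn_integral_add) (auto simp: \<nu>.emeasure_space_1)
    also have "\<dots> \<le> 1 + (moment_sup + 1)" by (intro add_left_mono \<nu>_moment_le)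
    also have "\<dots> < \<infinity>" using moment_sup_finite by simp
    finally show ?thesis .
  qed
  have "(\<integral>\<^sup>+\<omega>. ennpowr (wasserstein p (occupation X t \<omega>) \<nu>) p \<partial>M)
      \<le> ennreal K * max_moment t0 mean_law q *
        (\<Sum>n. \<Sum>l. ennreal (scale_term p q ((q - 1) / 2) (d / 2 * (1 + 1 / q)) (t powr (- (1 / 2))) n l))"
    if t: "t0 \<le> t" for t
  proof -
    define \<beta> where "\<beta> = 1 / 2 * (1 - 1 / q)"
    have t': "0 < t" using t t0 by simp
    have mq: "moment q (mean_law t) \<le> ennreal Q"
      unfolding Q(1)[symmetric] max_moment_def using t by (intro max.coboundedI2 SUP_upper) simp
    have \<beta>: "0 < \<beta>" "\<beta> < 1" using q by (auto simp: \<beta>_def field_simps)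
    have e1: "q * \<beta> = (q - 1) / 2" using q by (simp add: \<beta>_def field_simps)
    have e2: "d * (1 - \<beta>) = d / 2 * (1 + 1 / q)" using q by (simp add: \<beta>_def field_simps)
    have "0 < q" using q by simp
    have "(\<integral>\<^sup>+\<omega>. ennpowr (wasserstein p (occupation X t \<omega>) \<nu>) p \<partial>M)
      \<le> ennreal (2 * 2 powr p * (2 * d) powr p * C0 * 2 powr q * Q) *
        (\<Sum>n. \<Sum>l. ennreal (scale_term p q (q * \<beta>) (d * (1 - \<beta>)) (t powr (- (1 / 2))) n l))"
      unfolding d_def
    proof (rule expected_wasserstein_le[OF _ _ \<nu>_prob p(1) mom mean_law_prob[OF t'] \<open>0 < q\<close> mq Q1 C0(1) _ \<beta>])
      show "occupation X t \<omega> \<in> space (prob_algebra borel)" if "\<omega> \<in> space M" for \<omega>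
        by (rule occupation_prob[OF t' that])
      show "(\<lambda>\<omega>. measure (occupation X t \<omega>) A) \<in> borel_measurable M" if "A \<in> sets borel" for A
        by (rule measurable_measure_occupation[OF t' that])
      show "0 < t powr (- (1 / 2))" using t' by simp
      show "(\<integral>\<^sup>+\<omega>. ennreal \<bar>measure (occupation X t \<omega>) A - measure \<nu> A\<bar> \<partial>M)
        \<le> ennreal (C0 * min (measure (mean_law t) A) (measure (mean_law t) A powr \<beta> * t powr (- (1 / 2))))"
        if "A \<in> sets borel" for A unfolding \<beta>_def by (rule C0(2)[OF t' that])
    qed
    also have "ennreal (2 * 2 powr p * (2 * d) powr p * C0 * 2 powr q * Q) = ennreal K * max_moment t0 mean_law q"
      unfolding Q(1) K_def[symmetric] using K Q by (simp add: ennreal_mult)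
    finally show ?thesis unfolding e1 e2 .
  qed
  then show ?thesis using K that by blast
qed

end

section \<open>Rates of convergence\<close>

text \<open>\<open>d_plus d\<close> is the positive root of \<open>q (q - 1) = d (q + 1)\<close>, that is, the value of \<open>q\<close> at which \<open>d/2 (1 + 1/q)\<close> equals
\<open>(q - 1)/2\<close>; the other root is \<open>- m\<close>.\<close>

lemma less_d_plus_iff:
  fixes d q :: real
  assumes "0 < d" "0 < q"
  shows "q < d_plus d \<longleftrightarrow> q * (q - 1) < d * (q + 1)" "d_plus d < q \<longleftrightarrow> d * (q + 1) < q * (q - 1)"
proof -
  define r where "r = sqrt ((d + 1)\<^sup>2 + 4 * d)"
  have r2: "r\<^sup>2 = (d + 1)\<^sup>2 + 4 * d" unfolding r_def using assms by (intro real_sqrt_pow2) auto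
  have rp: "d + 1 < r" unfolding r_def using assms by (intro real_less_rsqrt) auto
  have dp: "d_plus d = (d + 1 + r) / 2" by (simp only: d_plus_def r_def)
  define m where "m = (r - (d + 1)) / 2"
  have m: "0 < m" using rp by (simp add: m_def)
  have f: "q * (q - 1) - d * (q + 1) = (q - d_plus d) * (q + m)"
    using r2 unfolding dp by (simp add: m_def power2_eq_square field_simps)
  have qm: "0 < q + m" using m assms by simp
  show "q < d_plus d \<longleftrightarrow> q * (q - 1) < d * (q + 1)"
    using f qm by (metis diff_less_0_iff_less mult_less_0_iff not_less_iff_gr_or_eq)
  show "d_plus d < q \<longleftrightarrow> d * (q + 1) < q * (q - 1)"
    using f qm by (metis diff_gt_0_iff_gt zero_less_mult_iff not_less_iff_gr_or_eq)
qed

context ergodic_process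
begin

text \<open>Each regime is one of the estimates of the double series at \<open>\<tau> = t powr (-1/2)\<close>. The three regimes with exponent
\<open>(q - p)/(q + 1)\<close> are the same estimate; they differ only in how the inequalities \<open>b < p\<close> and
\<open>D (q - p) < p (q - b)\<close> follow from the conditions on \<open>p\<close> and \<open>q\<close>.\<close>

lemma rates:
  assumes p: "0 < p" "p < q" and t0: "0 < t0"
  defines "d \<equiv> real DIM('a)"
  defines "bound \<equiv> \<lambda>K t r. (\<integral>\<^sup>+\<omega>. ennpowr (wasserstein p (occupation X t \<omega>) \<nu>) p \<partial>M)
      \<le> ennreal K * max_moment t0 mean_law q * ennreal r"
  shows coarse_rate: "p < d / 2 * (1 + 1 / q) \<Longrightarrow> p < d * q / (d + q) \<Longrightarrow>
      \<exists>K>0. \<forall>t\<ge>t0. bound K t (t powr (- (p * q / ((q + 1) * d))))"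
    and balanced_rate_small: "p < d / 2 * (1 + 1 / q) \<Longrightarrow> d * q / (d + q) < p \<Longrightarrow>
      \<exists>K>0. \<forall>t\<ge>t0. bound K t (t powr (- ((q - p) / (q + 1))))"
    and balanced_rate_critical: "p = d / 2 * (1 + 1 / q) \<Longrightarrow> q < d_plus d \<Longrightarrow>
      \<exists>K>0. \<forall>t\<ge>t0. bound K t (t powr (- ((q - p) / (q + 1))))"
    and logarithmic_rate: "p = d / 2 * (1 + 1 / q) \<Longrightarrow> d_plus d < q \<Longrightarrow>
      \<exists>K>0. \<forall>t\<ge>t0. bound K t (t powr (- (1 / 2)) * ln (1 + t))"
    and fine_rate: "d / 2 * (1 + 1 / q) < p \<Longrightarrow> p < (q - 1) / 2 \<Longrightarrow>
      \<exists>K>0. \<forall>t\<ge>t0. bound K t (t powr (- (1 / 2)))"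
    and balanced_rate_large: "d / 2 * (1 + 1 / q) < p \<Longrightarrow> (q - 1) / 2 < p \<Longrightarrow>
      \<exists>K>0. \<forall>t\<ge>t0. bound K t (t powr (- ((q - p) / (q + 1))))"
proof -
  define b where "b = (q - 1) / 2"
  define D where "D = d / 2 * (1 + 1 / q)"
  have d: "0 < d" unfolding d_def by simp
  have q0: "0 < q" using q by simp
  have D: "0 < D" "D * q = d * (q + 1) / 2" "D + q - b = (q + 1) * (d + q) / (2 * q)"
    using d q0 by (auto simp: D_def b_def field_simps add_pos_pos)
  have dbl: "q * (2 * b) = q * (q - 1)" "q * (2 * D) = d * (q + 1)"
    using q0 by (simp_all add: b_def D_def field_simps)
  have qb: "q - b = (q + 1) / 2" by (simp add: b_def field_simps)
  obtain K1 where K1: "0 < K1" "\<And>t. t0 \<le> t \<Longrightarrow>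
    (\<integral>\<^sup>+\<omega>. ennpowr (wasserstein p (occupation X t \<omega>) \<nu>) p \<partial>M)
      \<le> ennreal K1 * max_moment t0 mean_law q * (\<Sum>n. \<Sum>l. ennreal (scale_term p q b D (t powr (- (1 / 2))) n l))"
    using expected_wasserstein_series[OF p t0] unfolding d_def[symmetric] b_def[symmetric] D_def[symmetric] by metis
  have conclude: "\<exists>K>0. \<forall>t\<ge>t0. bound K t (r t)"
    if K: "0 < K" and s: "\<And>t. t0 \<le> t \<Longrightarrow> (\<Sum>n. \<Sum>l. ennreal (scale_term p q b D (t powr (- (1 / 2))) n l)) \<le> ennreal (K * r t)"
    for K r
  proof (intro exI[of _ "K1 * K"] conjI allI impI)
    show "0 < K1 * K" using K1 K by simp
    fix t assume t: "t0 \<le> t"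
    have "(\<integral>\<^sup>+\<omega>. ennpowr (wasserstein p (occupation X t \<omega>) \<nu>) p \<partial>M)
        \<le> ennreal K1 * max_moment t0 mean_law q * ennreal (K * r t)"
      by (rule order_trans[OF K1(2)[OF t]]) (intro mult_left_mono s[OF t]; simp)
    also have "\<dots> = ennreal (K1 * K) * max_moment t0 mean_law q * ennreal (r t)"
      using K K1 by (simp add: ennreal_mult' mult_ac)
    finally show "bound (K1 * K) t (r t)" by (simp add: bound_def)
  qed
  have powr_half: "(t powr (- (1 / 2))) powr x = t powr (- (x / 2))" for t x :: real by (simp add: powr_powr)
  have balanced: "\<exists>K>0. \<forall>t\<ge>t0. bound K t (t powr (- ((q - p) / (q + 1))))"
    if c: "b < p" "D * (q - p) < p * (q - b)"
  proof -
    obtain K where K: "0 < K" "\<And>\<tau>. 0 < \<tau> \<Longrightarrow>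
      (\<Sum>n. \<Sum>l. ennreal (scale_term p q b D \<tau> n l)) \<le> ennreal (K * \<tau> powr ((q - p) / (q - b)))"
      using scale_series_balanced[OF p(2) c] by metis
    show ?thesis
    proof (rule conclude[OF K(1)])
      fix t assume "t0 \<le> t"
      then have "0 < t powr (- (1 / 2))" using t0 by simp
      moreover have "(q - p) / (q - b) / 2 = (q - p) / (q + 1)" unfolding qb using q0 by (simp add: field_simps)
      then have "(t powr (- (1 / 2))) powr ((q - p) / (q - b)) = t powr (- ((q - p) / (q + 1)))"
        by (simp only: powr_half)
      ultimately show "(\<Sum>n. \<Sum>l. ennreal (scale_term p q b D (t powr (- (1 / 2))) n l)) \<le> ennreal (K * t powr (- ((q - p) / (q + 1))))"
        using K(2)[of "t powr (- (1 / 2))"] by simp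
    qed
  qed
  have threshold: "p < d * q / (d + q) \<longleftrightarrow> p * (D + q - b) < D * q" "d * q / (d + q) < p \<longleftrightarrow> D * q < p * (D + q - b)"
  proof -
    have e: "p * (D + q - b) * (2 * q) = p * (d + q) * (q + 1)" "D * q * (2 * q) = d * q * (q + 1)"
      using q0 unfolding D(2,3) by (simp_all add: field_simps)
    have "p < d * q / (d + q) \<longleftrightarrow> p * (d + q) * (q + 1) < d * q * (q + 1)"
      using d q0 by (simp add: pos_less_divide_eq)
    also have "\<dots> \<longleftrightarrow> p * (D + q - b) < D * q" unfolding e[symmetric] by (rule mult_less_cancel_right_pos) (use q0 in simp)
    finally show "p < d * q / (d + q) \<longleftrightarrow> p * (D + q - b) < D * q" .
    have "d * q / (d + q) < p \<longleftrightarrow> d * q * (q + 1) < p * (d + q) * (q + 1)"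
      using d q0 by (simp add: pos_divide_less_eq)
    also have "\<dots> \<longleftrightarrow> D * q < p * (D + q - b)" unfolding e[symmetric] by (rule mult_less_cancel_right_pos) (use q0 in simp)
    finally show "d * q / (d + q) < p \<longleftrightarrow> D * q < p * (D + q - b)" .
  qed
  have slow: "D * (q - p) < p * (q - b)" if "D \<le> p" "b < p"
  proof -
    have "D * (q - p) \<le> p * (q - p)" using that p by (intro mult_right_mono) auto
    also have "\<dots> < p * (q - b)" using that p by (intro mult_strict_left_mono) auto
    finally show ?thesis .
  qed
  show "\<exists>K>0. \<forall>t\<ge>t0. bound K t (t powr (- (p * q / ((q + 1) * d))))"
    if c: "p < d / 2 * (1 + 1 / q)" "p < d * q / (d + q)"
  proof -
    have c': "p < D" "p * (D + q - b) < D * q" using c threshold by (auto simp: D_def)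
    obtain K where K: "0 < K" "\<And>\<tau>. 0 < \<tau> \<Longrightarrow>
      (\<Sum>n. \<Sum>l. ennreal (scale_term p q b D \<tau> n l)) \<le> ennreal (K * \<tau> powr (p / D))"
      using scale_series_coarse[OF p(1) c'] by metis
    show ?thesis
    proof (rule conclude[OF K(1)])
      fix t assume "t0 \<le> t"
      then have "0 < t powr (- (1 / 2))" using t0 by simp
      moreover have "2 * D = (q + 1) * d / q" using q0 by (simp add: D_def field_simps)
      then have "p / (2 * D) = p * q / ((q + 1) * d)" by simp
      then have "p / D / 2 = p * q / ((q + 1) * d)" by (simp add: mult.commute)
      then have "(t powr (- (1 / 2))) powr (p / D) = t powr (- (p * q / ((q + 1) * d)))"
        by (simp only: powr_half)
      ultimately show "(\<Sum>n. \<Sum>l. ennreal (scale_term p q b D (t powr (- (1 / 2))) n l)) \<le> ennreal (K * t powr (- (p * q / ((q + 1) * d))))"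
        using K(2)[of "t powr (- (1 / 2))"] by simp
    qed
  qed
  show "\<exists>K>0. \<forall>t\<ge>t0. bound K t (t powr (- ((q - p) / (q + 1))))"
    if c: "p < d / 2 * (1 + 1 / q)" "d * q / (d + q) < p"
  proof (rule balanced)
    have "D * q < p * (D + q - b)" using c threshold by simp
    then show c': "D * (q - p) < p * (q - b)" by (simp add: algebra_simps)
    show "b < p"
    proof (rule ccontr)
      assume "\<not> b < p"
      then have "D * (q - b) \<le> D * (q - p)" using D(1) by (intro mult_left_mono) auto
      moreover have "p * (q - b) \<le> D * (q - b)"
        unfolding qb using c q0 by (intro mult_right_mono) (auto simp: D_def)
      ultimately show False using c' by linarith
    qed
  qed
  show "\<exists>K>0. \<forall>t\<ge>t0. bound K t (t powr (- ((q - p) / (q + 1))))"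
    if c: "p = d / 2 * (1 + 1 / q)" "q < d_plus d"
  proof (rule balanced)
    have pD: "p = D" using c by (simp add: D_def)
    have "q * (q - 1) < d * (q + 1)" using c less_d_plus_iff(1)[OF d q0] by simp
    then have "q * (2 * b) < q * (2 * D)" by (simp only: dbl)
    then show bp: "b < p" using q0 pD by simp
    show "D * (q - p) < p * (q - b)" using slow bp pD by simp
  qed
  show "\<exists>K>0. \<forall>t\<ge>t0. bound K t (t powr (- (1 / 2)) * ln (1 + t))"
    if c: "p = d / 2 * (1 + 1 / q)" "d_plus d < q"
  proof -
    have pD: "p = D" using c by (simp add: D_def)
    have "d * (q + 1) < q * (q - 1)" using c less_d_plus_iff(2)[OF d q0] by simp
    then have "q * (2 * D) < q * (2 * b)" by (simp only: dbl)
    then have pb: "p < b" using q0 pD by simp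
    have bq: "b \<le> q" using q by (simp add: b_def)
    obtain K where K: "0 < K" "\<And>t. t0 \<le> t \<Longrightarrow>
      (\<Sum>n. \<Sum>l. ennreal (scale_term p q b p (t powr (- (1 / 2))) n l)) \<le> ennreal (K * (t powr (- (1 / 2)) * ln (1 + t)))"
      using scale_series_critical[OF p(1) pb bq t0] by metis
    show ?thesis by (rule conclude[OF K(1)]) (use K(2) pD in simp)
  qed
  show "\<exists>K>0. \<forall>t\<ge>t0. bound K t (t powr (- (1 / 2)))"
    if c: "d / 2 * (1 + 1 / q) < p" "p < (q - 1) / 2"
  proof -
    have c': "D < p" "p < b" using c by (auto simp: D_def b_def)
    obtain K where K: "0 < K" "\<And>\<tau>. 0 < \<tau> \<Longrightarrow>
      (\<Sum>n. \<Sum>l. ennreal (scale_term p q b D \<tau> n l)) \<le> ennreal (K * \<tau>)"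
      using scale_series_fine[OF c', of q] by metis
    show ?thesis by (rule conclude[OF K(1)]) (use K(2) t0 in simp)
  qed
  show "\<exists>K>0. \<forall>t\<ge>t0. bound K t (t powr (- ((q - p) / (q + 1))))"
    if c: "d / 2 * (1 + 1 / q) < p" "(q - 1) / 2 < p"
    using c by (intro balanced slow) (auto simp: D_def b_def)
qed

text \<open>A rate for the \<open>p\<close>-th power gives a rate for the norm. A larger exponent is no loss because \<open>t\<close> stays above \<open>t0\<close>.\<close>

lemma root_rate:
  assumes p: "0 < p" "p < q" and t0: "0 < t0" and K: "0 < K" and xy: "y \<le> x / p"
    and b: "\<And>t. t0 \<le> t \<Longrightarrow> (\<integral>\<^sup>+\<omega>. ennpowr (wasserstein p (occupation X t \<omega>) \<nu>) p \<partial>M)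
      \<le> ennreal K * max_moment t0 mean_law q * ennreal (t powr (- x))"
  shows "\<exists>K>0. \<forall>t\<ge>t0. ennpowr (\<integral>\<^sup>+\<omega>. ennpowr (wasserstein p (occupation X t \<omega>) \<nu>) p \<partial>M) (1 / p)
      \<le> ennreal (K * t powr (- y))"
proof -
  obtain Q where Q: "max_moment t0 mean_law q = ennreal Q" "0 \<le> Q"
    using max_moment_mean_law_finite[OF t0] less_top_ennreal by auto
  define K' where "K' = 1 + (K * Q) powr (1 / p) * t0 powr (- (x / p - y))"
  have "0 < K'" by (simp add: K'_def add_pos_nonneg)
  moreover have "ennpowr (\<integral>\<^sup>+\<omega>. ennpowr (wasserstein p (occupation X t \<omega>) \<nu>) p \<partial>M) (1 / p) \<le> ennreal (K' * t powr (- y))"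
    if t: "t0 \<le> t" for t
  proof -
    have t': "0 < t" using t t0 by simp
    have "(\<integral>\<^sup>+\<omega>. ennpowr (wasserstein p (occupation X t \<omega>) \<nu>) p \<partial>M) \<le> ennreal (K * Q * t powr (- x))"
      using b[OF t] K Q unfolding Q(1) by (simp add: ennreal_mult)
    then have "ennpowr (\<integral>\<^sup>+\<omega>. ennpowr (wasserstein p (occupation X t \<omega>) \<nu>) p \<partial>M) (1 / p) \<le> ennpowr (ennreal (K * Q * t powr (- x))) (1 / p)"
      using p by (intro ennpowr_mono) auto
    also have "\<dots> = ennreal ((K * Q * t powr (- x)) powr (1 / p))"
      using K Q by (simp add: ennpowr_def)
    also have "\<dots> \<le> ennreal (K' * t powr (- y))"
    proof (rule ennreal_leI)
      have "(K * Q * t powr (- x)) powr (1 / p) = (K * Q) powr (1 / p) * (t powr (- (x / p - y)) * t powr (- y))"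
        by (simp add: powr_mult powr_powr powr_add[symmetric])
      also have "\<dots> \<le> (K * Q) powr (1 / p) * (t0 powr (- (x / p - y)) * t powr (- y))"
        using xy t t0 by (intro mult_left_mono mult_right_mono powr_mono2') auto
      also have "\<dots> \<le> K' * t powr (- y)" by (simp add: K'_def distrib_right mult.assoc)
      finally show "(K * Q * t powr (- x)) powr (1 / p) \<le> K' * t powr (- y)" .
    qed
    finally show ?thesis .
  qed
  ultimately show ?thesis by blast
qed

end

section \<open>Convergence of occupation measures\<close>

theorem proposition2p7:
  fixes P :: "real \<Rightarrow> 'a::euclidean_space \<Rightarrow> 'a measure"
    and \<nu> \<mu>0 :: "'a measure"
    and \<psi> :: "'a \<Rightarrow> real" and e :: "real \<Rightarrow> real"
    and \<theta>0 c q :: real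
  assumes "markov_semigroup P"
    and "invariant_distribution P \<nu>"
    and "\<And>\<mu>. invariant_distribution P \<mu> \<Longrightarrow> \<mu> = \<nu>"
    and "0 < \<theta>0" and "0 < c"
    and "\<And>g :: 'a \<Rightarrow> real. g \<in> borel_measurable borel \<Longrightarrow> bounded (range g) \<Longrightarrow>
           (c * (SUP x. \<bar>g x\<bar>))-lipschitz_on UNIV (\<lambda>x. \<integral>y. g y \<partial>P \<theta>0 x)"
    and "1 < q" and "\<mu>0 \<in> prob_moment q"
    and "\<psi> \<in> borel_measurable borel" and "\<And>x. 0 \<le> \<psi> x"
    and "set_integrable lborel {0..} e" and "\<And>t. 0 \<le> t \<Longrightarrow> 0 \<le> e t"
    and "\<And>t x. 0 \<le> t \<Longrightarrow> wasserstein 1 (P t x) \<nu> \<le> ennreal (\<psi> x * e t)"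
    and "(SUP t\<in>{0..}. \<integral>\<^sup>+y. ennreal (\<psi> y powr q + norm y powr q) \<partial>(\<mu>0 \<bind> P t)) < \<infinity>"
  shows
    "set_integrable lborel {0..} (e_tilde \<theta>0 c e) \<and>
     (\<forall>t\<ge>0. \<forall>x. tv_norm (P t x) \<nu> \<le> psi_tilde \<psi> x * e_tilde \<theta>0 c e t) \<and>
     (SUP t\<in>{0..}. \<integral>\<^sup>+y. ennreal (psi_tilde \<psi> y powr q + norm y powr q) \<partial>(\<mu>0 \<bind> P t)) < \<infinity> \<and>
     moment q \<nu> < \<infinity> \<and>
     (\<forall>(M :: 'w measure) X. right_continuous_markov_process M X P \<mu>0 \<longrightarrow>
       (let d = real DIM('a);
            \<pi> = (\<lambda>t. half_sum (mean_occupation M X t) \<nu>)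
        in
        (\<forall>t0>0. property_A M (occupation X) \<nu> t0 \<pi> (1 / 2 * (1 - 1 / q)) q (1 / 2)) \<and>
        (\<forall>p t0. 0 < p \<and> p < q \<and> 0 < t0 \<longrightarrow>
          (\<exists>K>0. \<forall>t\<ge>t0.
            (let bound = (\<lambda>r. (\<integral>\<^sup>+\<omega>. ennpowr (wasserstein p (occupation X t \<omega>) \<nu>) p \<partial>M)
                                \<le> ennreal K * max_moment t0 \<pi> q * ennreal r)
             in
             (p < d / 2 * (1 + 1 / q) \<longrightarrow>
                (p < d * q / (d + q) \<longrightarrow> bound (t powr (- (p * q / ((q + 1) * d))))) \<and>
                (d * q / (d + q) < p \<longrightarrow> bound (t powr (- ((q - p) / (q + 1)))))) \<and>
             (p = d / 2 * (1 + 1 / q) \<longrightarrow>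
                (d_minus d < q \<and> q < d_plus d \<longrightarrow> bound (t powr (- ((q - p) / (q + 1))))) \<and>
                (d_plus d < q \<longrightarrow> bound (t powr (- (1 / 2)) * ln (1 + t)))) \<and>
             (d / 2 * (1 + 1 / q) < p \<longrightarrow>
                (p < (q - 1) / 2 \<longrightarrow> bound (t powr (- (1 / 2)))) \<and>
                ((q - 1) / 2 < p \<longrightarrow> bound (t powr (- ((q - p) / (q + 1))))))))) \<and>
        ((\<forall>q'>0. (SUP t\<in>{0..}. \<integral>\<^sup>+y. ennreal (\<psi> y powr q' + norm y powr q') \<partial>(\<mu>0 \<bind> P t)) < \<infinity>) \<longrightarrow>
          (\<forall>p \<epsilon> t0. 0 < p \<and> 0 < \<epsilon> \<and> 0 < t0 \<longrightarrow>
            (\<exists>K>0. \<forall>t\<ge>t0.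
              (let Lp_norm = ennpowr (\<integral>\<^sup>+\<omega>. ennpowr (wasserstein p (occupation X t \<omega>) \<nu>) p \<partial>M) (1 / p)
               in
               (p \<le> d / 2 \<longrightarrow> Lp_norm \<le> ennreal (K * t powr (- ((1 - \<epsilon>) / d)))) \<and>
               (d / 2 < p \<longrightarrow> Lp_norm \<le> ennreal (K * t powr (- (1 / (2 * p)))))))))))"
proof -
  interpret regularizing_semigroup P \<nu> \<psi> e \<theta>0 c
    by (rule regularizing_semigroup.intro; fact assms)
  have \<mu>0: "\<mu>0 \<in> space (prob_algebra borel)" using assms(8) by (simp add: prob_moment_def)
  interpret regularizing_semigroup_moments P \<nu> \<psi> e \<theta>0 c \<mu>0 q
    by unfold_locales (fact assms \<mu>0)+
  have markov: "(let d = real DIM('a);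
            \<pi> = (\<lambda>t. half_sum (mean_occupation M X t) \<nu>)
        in
        (\<forall>t0>0. property_A M (occupation X) \<nu> t0 \<pi> (1 / 2 * (1 - 1 / q)) q (1 / 2)) \<and>
        (\<forall>p t0. 0 < p \<and> p < q \<and> 0 < t0 \<longrightarrow>
          (\<exists>K>0. \<forall>t\<ge>t0.
            (let bound = (\<lambda>r. (\<integral>\<^sup>+\<omega>. ennpowr (wasserstein p (occupation X t \<omega>) \<nu>) p \<partial>M)
                                \<le> ennreal K * max_moment t0 \<pi> q * ennreal r)
             in
             (p < d / 2 * (1 + 1 / q) \<longrightarrow>
                (p < d * q / (d + q) \<longrightarrow> bound (t powr (- (p * q / ((q + 1) * d))))) \<and>
                (d * q / (d + q) < p \<longrightarrow> bound (t powr (- ((q - p) / (q + 1)))))) \<and>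
             (p = d / 2 * (1 + 1 / q) \<longrightarrow>
                (d_minus d < q \<and> q < d_plus d \<longrightarrow> bound (t powr (- ((q - p) / (q + 1))))) \<and>
                (d_plus d < q \<longrightarrow> bound (t powr (- (1 / 2)) * ln (1 + t)))) \<and>
             (d / 2 * (1 + 1 / q) < p \<longrightarrow>
                (p < (q - 1) / 2 \<longrightarrow> bound (t powr (- (1 / 2)))) \<and>
                ((q - 1) / 2 < p \<longrightarrow> bound (t powr (- ((q - p) / (q + 1))))))))) \<and>
        ((\<forall>q'>0. (SUP t\<in>{0..}. \<integral>\<^sup>+y. ennreal (\<psi> y powr q' + norm y powr q') \<partial>(\<mu>0 \<bind> P t)) < \<infinity>) \<longrightarrow>
          (\<forall>p \<epsilon> t0. 0 < p \<and> 0 < \<epsilon> \<and> 0 < t0 \<longrightarrow>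
            (\<exists>K>0. \<forall>t\<ge>t0.
              (let Lp_norm = ennpowr (\<integral>\<^sup>+\<omega>. ennpowr (wasserstein p (occupation X t \<omega>) \<nu>) p \<partial>M) (1 / p)
               in
               (p \<le> d / 2 \<longrightarrow> Lp_norm \<le> ennreal (K * t powr (- ((1 - \<epsilon>) / d)))) \<and>
               (d / 2 < p \<longrightarrow> Lp_norm \<le> ennreal (K * t powr (- (1 / (2 * p))))))))))"
    if process: "right_continuous_markov_process M X P \<mu>0" for M :: "'w measure" and X
  proof -
    interpret M: prob_space M using process by (simp add: right_continuous_markov_process_def)
    interpret ergodic_process P \<nu> \<psi> e \<theta>0 c \<mu>0 q M X by unfold_locales (rule process)
    define d where "d = real DIM('a)"
    have d: "0 < d" by (simp add: d_def)
    have law: "(\<lambda>t. half_sum (mean_occupation M X t) \<nu>) = mean_law" by (rule ext) (simp add: mean_law_def)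
    have A: "property_A M (occupation X) \<nu> t0 mean_law (1 / 2 * (1 - 1 / q)) q (1 / 2)" if "0 < t0" for t0
      by (rule property_A_mean_law[OF that])
    have B: "\<exists>K>0. \<forall>t\<ge>t0.
        (let bound = (\<lambda>r. (\<integral>\<^sup>+\<omega>. ennpowr (wasserstein p (occupation X t \<omega>) \<nu>) p \<partial>M)
              \<le> ennreal K * max_moment t0 mean_law q * ennreal r)
         in
          (p < d / 2 * (1 + 1 / q) \<longrightarrow>
             (p < d * q / (d + q) \<longrightarrow> bound (t powr (- (p * q / ((q + 1) * d))))) \<and>
             (d * q / (d + q) < p \<longrightarrow> bound (t powr (- ((q - p) / (q + 1)))))) \<and>
          (p = d / 2 * (1 + 1 / q) \<longrightarrow>
             (d_minus d < q \<and> q < d_plus d \<longrightarrow> bound (t powr (- ((q - p) / (q + 1))))) \<and>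
             (d_plus d < q \<longrightarrow> bound (t powr (- (1 / 2)) * ln (1 + t)))) \<and>
          (d / 2 * (1 + 1 / q) < p \<longrightarrow>
             (p < (q - 1) / 2 \<longrightarrow> bound (t powr (- (1 / 2)))) \<and>
             ((q - 1) / 2 < p \<longrightarrow> bound (t powr (- ((q - p) / (q + 1)))))))"
      if p: "0 < p" "p < q" and t0: "0 < t0" for p t0
    proof -
      note rates = rates[OF p t0, folded d_def]
      define D where "D = d / 2 * (1 + 1 / q)"
      consider "p < D" "p < d * q / (d + q)" | "p < D" "d * q / (d + q) < p" | "p < D" "p = d * q / (d + q)"
        | "p = D" "q < d_plus d" | "p = D" "d_plus d < q" | "p = D" "q = d_plus d"
        | "D < p" "p < (q - 1) / 2" | "D < p" "(q - 1) / 2 < p" | "D < p" "p = (q - 1) / 2"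
        by linarith
      then show ?thesis
      proof cases
        case 1
        then obtain K where "0 < K" "\<forall>t\<ge>t0. (\<integral>\<^sup>+\<omega>. ennpowr (wasserstein p (occupation X t \<omega>) \<nu>) p \<partial>M)
          \<le> ennreal K * max_moment t0 mean_law q * ennreal (t powr (- (p * q / ((q + 1) * d))))"
          using rates(1) unfolding D_def by blast
        with 1 show ?thesis unfolding Let_def D_def[symmetric] by (intro exI[of _ K]) auto
      next
        case 2
        then obtain K where "0 < K" "\<forall>t\<ge>t0. (\<integral>\<^sup>+\<omega>. ennpowr (wasserstein p (occupation X t \<omega>) \<nu>) p \<partial>M)
          \<le> ennreal K * max_moment t0 mean_law q * ennreal (t powr (- ((q - p) / (q + 1))))"
          using rates(2) unfolding D_def by blast
        with 2 show ?thesis unfolding Let_def D_def[symmetric] by (intro exI[of _ K]) auto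
      next
        case 4
        then obtain K where "0 < K" "\<forall>t\<ge>t0. (\<integral>\<^sup>+\<omega>. ennpowr (wasserstein p (occupation X t \<omega>) \<nu>) p \<partial>M)
          \<le> ennreal K * max_moment t0 mean_law q * ennreal (t powr (- ((q - p) / (q + 1))))"
          using rates(3) unfolding D_def by blast
        with 4 show ?thesis unfolding Let_def D_def[symmetric] by (intro exI[of _ K]) auto
      next
        case 5
        then obtain K where "0 < K" "\<forall>t\<ge>t0. (\<integral>\<^sup>+\<omega>. ennpowr (wasserstein p (occupation X t \<omega>) \<nu>) p \<partial>M)
          \<le> ennreal K * max_moment t0 mean_law q * ennreal (t powr (- (1 / 2)) * ln (1 + t))"
          using rates(4) unfolding D_def by blast
        with 5 show ?thesis unfolding Let_def D_def[symmetric] by (intro exI[of _ K]) auto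
      next
        case 7
        then obtain K where "0 < K" "\<forall>t\<ge>t0. (\<integral>\<^sup>+\<omega>. ennpowr (wasserstein p (occupation X t \<omega>) \<nu>) p \<partial>M)
          \<le> ennreal K * max_moment t0 mean_law q * ennreal (t powr (- (1 / 2)))"
          using rates(5) unfolding D_def by blast
        with 7 show ?thesis unfolding Let_def D_def[symmetric] by (intro exI[of _ K]) auto
      next
        case 8
        then obtain K where "0 < K" "\<forall>t\<ge>t0. (\<integral>\<^sup>+\<omega>. ennpowr (wasserstein p (occupation X t \<omega>) \<nu>) p \<partial>M)
          \<le> ennreal K * max_moment t0 mean_law q * ennreal (t powr (- ((q - p) / (q + 1))))"
          using rates(6) unfolding D_def by blast
        with 8 show ?thesis unfolding Let_def D_def[symmetric] by (intro exI[of _ K]) auto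
      next
        case 3 then show ?thesis unfolding Let_def D_def[symmetric] by (intro exI[of _ 1]) auto
      next
        case 6 then show ?thesis unfolding Let_def D_def[symmetric] by (intro exI[of _ 1]) auto
      next
        case 9 then show ?thesis unfolding Let_def D_def[symmetric] by (intro exI[of _ 1]) auto
      qed
    qed
    have C: "\<exists>K>0. \<forall>t\<ge>t0.
          (let Lp_norm = ennpowr (\<integral>\<^sup>+\<omega>. ennpowr (wasserstein p (occupation X t \<omega>) \<nu>) p \<partial>M) (1 / p)
           in
           (p \<le> d / 2 \<longrightarrow> Lp_norm \<le> ennreal (K * t powr (- ((1 - \<epsilon>) / d)))) \<and>
           (d / 2 < p \<longrightarrow> Lp_norm \<le> ennreal (K * t powr (- (1 / (2 * p))))))"
      if all: "\<forall>q'>0. (SUP t\<in>{0..}. \<integral>\<^sup>+y. ennreal (\<psi> y powr q' + norm y powr q') \<partial>(\<mu>0 \<bind> P t)) < \<infinity>"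
        and p: "0 < p" and \<epsilon>: "0 < \<epsilon>" and t0: "0 < t0" for p \<epsilon> t0
    proof -
      have proc: "ergodic_process P \<nu> \<psi> e \<theta>0 c \<mu>0 q' M X" if "1 < q'" for q'
      proof (intro ergodic_process.intro regularizing_semigroup_moments.intro
          regularizing_semigroup_moments_axioms.intro ergodic_process_axioms.intro)
        show "(SUP t\<in>{0..}. \<integral>\<^sup>+y. ennreal (\<psi> y powr q' + norm y powr q') \<partial>(\<mu>0 \<bind> P t)) < \<infinity>"
          using all that by simp
      qed (fact that \<mu>0 process M.prob_space_axioms regularizing_semigroup_axioms)+
      show ?thesis
      proof (cases "p \<le> d / 2")
        case True
        \<comment> \<open>\<open>r > d\<close> puts \<open>p\<close> below \<open>d * r / (d + r)\<close>, and \<open>r > 1 / \<epsilon>\<close> makes \<open>r / (r + 1)\<close> at least \<open>1 - \<epsilon>\<close>\<close>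
        define r where "r = d + 1 + 1 / \<epsilon>"
        have r: "1 < r" "d < r" "1 / \<epsilon> < r" using d \<epsilon> by (auto simp: r_def add_pos_pos)
        interpret R: ergodic_process P \<nu> \<psi> e \<theta>0 c \<mu>0 r M X by (rule proc[OF r(1)])
        have pr: "p < r" using True r d by linarith
        have c1: "p < d / 2 * (1 + 1 / r)"
        proof -
          have "d / 2 < d / 2 * (1 + 1 / r)" using d r by (simp add: distrib_left)
          then show ?thesis using True by linarith
        qed
        have c2: "p < d * r / (d + r)"
        proof -
          have "d / 2 < d * r / (d + r)" using d r by (simp add: field_simps)
          then show ?thesis using True by linarith
        qed
        obtain K where K: "0 < K" "\<And>t. t0 \<le> t \<Longrightarrow> (\<integral>\<^sup>+\<omega>. ennpowr (wasserstein p (occupation X t \<omega>) \<nu>) p \<partial>M)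
            \<le> ennreal K * max_moment t0 R.mean_law r * ennreal (t powr (- (p * r / ((r + 1) * d))))"
          using R.rates(1)[OF p pr t0, folded d_def, OF c1 c2] by blast
        have "(1 - \<epsilon>) / d \<le> (p * r / ((r + 1) * d)) / p"
        proof -
          have "1 \<le> \<epsilon> * r" using r(3) \<epsilon> by (simp add: field_simps)
          then have "(1 - \<epsilon>) * (r + 1) \<le> r" using \<epsilon> by (simp add: algebra_simps)
          then have "1 - \<epsilon> \<le> r / (r + 1)" using r by (simp add: pos_le_divide_eq)
          then have "(1 - \<epsilon>) / d \<le> r / (r + 1) / d" using d by (intro divide_right_mono) auto
          then show ?thesis using p by simp
        qed
        from R.root_rate[OF p pr t0 K(1) this K(2)] True show ?thesis by (auto simp: Let_def)
      next
        case False
        define \<delta> where "\<delta> = 2 * p / d - 1"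
        have \<delta>: "0 < \<delta>" using False d by (simp add: \<delta>_def field_simps)
        \<comment> \<open>\<open>r > 1 / \<delta>\<close> puts \<open>p\<close> above \<open>d / 2 * (1 + 1 / r)\<close>, and \<open>r > 2 * p + 1\<close> puts it below \<open>(r - 1) / 2\<close>\<close>
        define r where "r = 2 * p + 2 + 1 / \<delta>"
        have r: "1 < r" "p < r" "p < (r - 1) / 2" "1 / \<delta> < r" using p \<delta> by (auto simp: r_def add_pos_pos add_nonneg_pos field_simps)
        interpret R: ergodic_process P \<nu> \<psi> e \<theta>0 c \<mu>0 r M X by (rule proc[OF r(1)])
        have c1: "d / 2 * (1 + 1 / r) < p"
        proof -
          have "1 / r < \<delta>" using r(1,4) \<delta> by (simp add: field_simps)
          then have "d / 2 * (1 + 1 / r) < d / 2 * (1 + \<delta>)" using d by (intro mult_strict_left_mono) auto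
          also have "\<dots> = p" using d by (simp add: \<delta>_def)
          finally show ?thesis .
        qed
        obtain K where K: "0 < K" "\<And>t. t0 \<le> t \<Longrightarrow> (\<integral>\<^sup>+\<omega>. ennpowr (wasserstein p (occupation X t \<omega>) \<nu>) p \<partial>M)
            \<le> ennreal K * max_moment t0 R.mean_law r * ennreal (t powr (- (1 / 2)))"
          using R.rates(5)[OF p r(2) t0, folded d_def, OF c1 r(3)] by blast
        have "1 / (2 * p) \<le> 1 / 2 / p" by simp
        from R.root_rate[OF p r(2) t0 K(1) this K(2)] False show ?thesis by (auto simp: Let_def)
      qed
    qed
    show ?thesis
      unfolding Let_def law d_def[symmetric]
    proof (intro conjI allI impI)
      show "property_A M (occupation X) \<nu> t0 mean_law (1 / 2 * (1 - 1 / q)) q (1 / 2)" if "0 < t0" for t0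
        by (rule A[OF that])
    qed (rule B[unfolded Let_def] C[unfolded Let_def]; simp)+
  qed
  show ?thesis
  proof (intro conjI allI impI)
    show "set_integrable lborel {0..} et" by (rule et_integrable)
    show "tv_norm (P t x) \<nu> \<le> \<phi> x * et t" if "0 \<le> t" for t x by (rule tv_decay[OF that])
    show "(SUP t\<in>{0..}. \<integral>\<^sup>+y. ennreal (\<phi> y powr q + norm y powr q) \<partial>(\<mu>0 \<bind> P t)) < \<infinity>"
      using moment_sup_finite unfolding moment_sup_def .
    have "moment_sup + 1 < \<infinity>" using moment_sup_finite by simp
    then show "moment q \<nu> < \<infinity>" by (rule order_le_less_trans[OF \<nu>_moment_le])
  qed (rule markov)
qed

end
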